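(* Let $\alpha_{12}>\alpha_{23}>\alpha_{13}>0$ and $a_0,b_0,c_0\in\mathbb{C}$. Consider the Euler equations for complex functions $a,b,c$ of $t\in\mathbb{R}$: $$i\dot a=(\alpha_{23}-\alpha_{13})\,b\bar c,\qquad i\dot b=(\alpha_{23}-\alpha_{12})\,ac,\qquad i\dot c=(\alpha_{13}-\alpha_{12})\,\bar a b,$$ with $a(0)=a_0$, $b(0)=b_0$, $c(0)=c_0$. Define $$\mathrm I_2=|c_0|^2+\frac{\alpha_{12}-\alpha_{13}}{\alpha_{23}-\alpha_{13}}|a_0|^2,\qquad \mathrm I_3=|c_0|^2+\frac{\alpha_{12}-\alpha_{13}}{\alpha_{12}-\alpha_{23}}|b_0|^2,\qquad \mathsf h_4=\bar a_0b_0\bar c_0+a_0\bar b_0c_0,$$ $$\mathrm I_4=-\frac{(\alpha_{12}-\alpha_{13})^2}{(\alpha_{12}-\alpha_{23})(\alpha_{23}-\alpha_{13})}\mathsf h_4^2,\qquad g_2=\tfrac43(\mathrm I_2^2-\mathrm I_2\mathrm I_3+\mathrm I_3^2),$$ $$g_3=-\mathrm I_4+\tfrac{4}{27}(\mathrm I_2+\mathrm I_3)(2\mathrm I_2^2-5\mathrm I_2\mathrm I_3+2\mathrm I_3^2).$$ Let the roots of the cubic $4Y^3-g_2Y-g_3$ (which are all real) be $e_1>e_2>e_3$. Let $\wp,\zeta,\sigma$ be the Weierstrass functions with invariants $g_2,g_3$, with fundamental periods $2\omega_1\in\mathbb{R}_{>0}$ and $2\omega_2\in i\mathbb{R}_{>0}$.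 Put $\tau=\sqrt{(\alpha_{12}-\alpha_{23})(\alpha_{23}-\alpha_{13})}\;t$, and let $\mu_1,\mu_2,\mu_3\in\mathbb{C}$ satisfy $$\wp(\mu_1)=\tfrac23\mathrm I_2-\tfrac13\mathrm I_3,\qquad \wp(\mu_2)=-\tfrac13\mathrm I_2+\tfrac23\mathrm I_3,\qquad \wp(\mu_3)=-\tfrac13\mathrm I_2-\tfrac13\mathrm I_3 .$$ Let $\tau_0\in\mathbb{R}$ be the constant, determined by the initial conditions, for which $|c|^2=\wp(\tau-\tau_0+\omega_2)+\frac13(\mathrm I_2+\mathrm I_3)$. Then the solution to the Euler equations is $$a=\mathcal A_+y_+(\tau|\mu_1)+\mathcal A_-y_-(\tau|\mu_1),\qquad b=\mathcal B_+y_+(\tau|\mu_2)+\mathcal B_-y_-(\tau|\mu_2),\qquad c=\mathcal C_+y_+(\tau|\mu_3)+\mathcal C_-y_-(\tau|\mu_3),$$ where $$y_\pm(\tau|\mu)=e^{\mp\tau\zeta(\mu)}\,\frac{\sigma(\tau-\tau_0+\omega_2\pm\mu)\,\sigma(-\tau_0+\omega_2)}{\sigma(\tau-\tau_0+\omega_2)\,\sigma(-\tau_0+\omega_2\pm\mu)},$$ $$\mathcal A_\pm=\tfrac12\mathrm M_\pm(\mu_1)a_0\pm i\,\mathrm N(\mu_1)\sqrt{\tfrac{\alpha_{23}-\alpha_{13}}{\alpha_{12}-\alpha_{23}}}\;b_0\bar c_0,$$ $$\mathcal B_\pm=\tfrac12\mathrm M_\pm(\mu_2)b_0\mp i\,\mathrm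 N(\mu_2)\sqrt{\tfrac{\alpha_{12}-\alpha_{23}}{\alpha_{23}-\alpha_{13}}}\;a_0c_0,$$ $$\mathcal C_\pm=\tfrac12\mathrm M_\pm(\mu_3)c_0\mp i\,\mathrm N(\mu_3)\frac{\alpha_{12}-\alpha_{13}}{\sqrt{(\alpha_{12}-\alpha_{23})(\alpha_{23}-\alpha_{13})}}\;\bar a_0b_0,$$ $$\mathrm M_\pm(\mu)=1\pm\frac{\wp'(-\tau_0+\omega_2)}{\wp'(\mu)},\qquad \mathrm N(\mu)=\frac{\wp(-\tau_0+\omega_2)-\wp(\mu)}{\wp'(\mu)} .$$ The respective geodesic on $\mathcal F(3)$ with the metric $\mathrm ds^2=\frac1{\alpha_{12}}|\bar u_1\cdot \mathrm du_2|^2+\frac1{\alpha_{13}}|\bar u_1\cdot \mathrm du_3|^2+\frac1{\alpha_{23}}|\bar u_2\cdot \mathrm du_3|^2$ can be found as follows. Let $$\mathcal L(t)=\begin{pmatrix}0&a&b\\ \bar a&0&c\\ \bar b&\bar c&0\end{pmatrix},\qquad \mathfrak I(\mathcal L)=\begin{pmatrix}0&\alpha_{12}a&\alpha_{13}b\\ \alpha_{12}\bar a&0&\alpha_{23}c\\ \alpha_{13}\bar b&\alpha_{23}\bar c&0\end{pmatrix},$$ assume that the spectrum of $\mathcal L$ is simple, let $\mathsf E(t)$ be a (differentiable) unitary matrix of eigenvectors of $\mathcal L(t)$, so that $\mathcal L(t)=\mathsf E(t)\Lambda\mathsf E(t)^\dagger$ with $\Lambda$ a constant diagonal matrix, and set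 $$\mathsf Q=-i\,\mathsf E^\dagger\dot{\mathsf E}-\mathsf E^\dagger\mathfrak I(\mathcal L)\mathsf E,\qquad \mathsf V(t)=\mathsf E(0)\exp\Big(i\int_0^t\mathsf Q(t')\,dt'\Big)\mathsf E(t)^\dagger .$$ Then the geodesic is represented by $\mathsf U(t)=\mathsf U(0)\,\mathsf V(t)$.
   Context: $\mathcal F(3)=\mathrm U(3)/\mathrm U(1)^3$ is the manifold of ordered triples of pairwise orthogonal complex lines in $\mathbb C^3$; a unitary matrix $\mathsf U=(u_1\;u_2\;u_3)$ represents the point given by the lines spanned by its columns (each column being defined up to a phase), and $\bar x\cdot y=\sum_k\bar x_ky_k$. A dot denotes $\mathrm d/\mathrm dt$. The geodesic corresponding to $\mathcal L$ is the one with $\mathsf U^\dagger\dot{\mathsf U}=-i\,\mathfrak I(\mathcal L)$. Weierstrass functions with invariants $g_2,g_3$: $(\wp')^2=4\wp^3-g_2\wp-g_3$, $\zeta'=-\wp$, $\sigma'/\sigma=\zeta$, with the standard normalizations $\wp(z)\sim z^{-2}$, $\zeta(z)\sim z^{-1}$, $\sigma(z)\sim z$ at $z=0$. *)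

theory Defs
  imports "HOL-Complex_Analysis.Complex_Analysis"
begin

section \<open>The Euler equations\<close>

definition euler_solution ::
  "real \<Rightarrow> real \<Rightarrow> real \<Rightarrow> complex \<Rightarrow> complex \<Rightarrow> complex \<Rightarrow>
   (real \<Rightarrow> complex) \<Rightarrow> (real \<Rightarrow> complex) \<Rightarrow> (real \<Rightarrow> complex) \<Rightarrow> bool" where
  "euler_solution \<alpha>12 \<alpha>13 \<alpha>23 a0 b0 c0 a b c \<longleftrightarrow>
     a 0 = a0 \<and> b 0 = b0 \<and> c 0 = c0 \<and>
     (\<forall>t. \<exists>a' b' c'.
        (a has_vector_derivative a') (at t) \<and>
        (b has_vector_derivative b') (at t) \<and>
        (c has_vector_derivative c') (at t) \<and>
        \<i> * a' = of_real (\<alpha>23 - \<alpha>13) * b t * cnj (c t) \<and>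
        \<i> * b' = of_real (\<alpha>23 - \<alpha>12) * a t * c t \<and>
        \<i> * c' = of_real (\<alpha>13 - \<alpha>12) * cnj (a t) * b t)"

section \<open>Weierstrass functions\<close>

text \<open>
  The conditions determine the three functions uniquely, including their values at poles (where a
  nicely meromorphic function is 0 by convention). The additive constant of the
  zeta function is not fixed by its leading behaviour at 0 alone, so the standard
  normalization is taken to be the vanishing of the constant term.
\<close>

definition weierstrass_functions ::
  "complex \<Rightarrow> complex \<Rightarrow> (complex \<Rightarrow> complex) \<Rightarrow> (complex \<Rightarrow> complex) \<Rightarrow> (complex \<Rightarrow> complex) \<Rightarrow> bool" where
  "weierstrass_functions g2 g3 wp \<zeta> \<sigma> \<longleftrightarrow>
     (wp nicely_meromorphic_on UNIV \<and>
      (\<forall>z. \<not> is_pole wp z \<longrightarrow> (deriv wp z)^2 = 4 * wp z ^ 3 - g2 * wp z - g3) \<and>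
      ((\<lambda>z. z^2 * wp z) \<longlongrightarrow> 1) (at 0)) \<and>
     (\<zeta> nicely_meromorphic_on UNIV \<and>
      (\<forall>z. \<not> is_pole wp z \<longrightarrow> (\<zeta> has_field_derivative - wp z) (at z)) \<and>
      ((\<lambda>z. \<zeta> z - 1 / z) \<longlongrightarrow> 0) (at 0)) \<and>
     (\<sigma> holomorphic_on UNIV \<and>
      (\<forall>z. \<not> is_pole wp z \<longrightarrow> \<sigma> z \<noteq> 0 \<and> deriv \<sigma> z / \<sigma> z = \<zeta> z) \<and>
      ((\<lambda>z. \<sigma> z / z) \<longlongrightarrow> 1) (at 0))"

definition fundamental_half_periods :: "(complex \<Rightarrow> complex) \<Rightarrow> complex \<Rightarrow> complex \<Rightarrow> bool" where
  "fundamental_half_periods f \<omega>1 \<omega>2 \<longleftrightarrow>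
     {w. \<forall>z. f (z + w) = f z} = {of_int m * (2 * \<omega>1) + of_int n * (2 * \<omega>2) | m n. True}"

text \<open>
  In the next three definitions \<open>x\<close> stands for the shifted initial argument
  \<open>- \<tau>0 + \<omega>2\<close>, and the sign \<open>s\<close> is 1 or -1.
\<close>

definition lame_y ::
  "(complex \<Rightarrow> complex) \<Rightarrow> (complex \<Rightarrow> complex) \<Rightarrow> complex \<Rightarrow> complex \<Rightarrow> complex \<Rightarrow> complex \<Rightarrow> complex" where
  "lame_y \<zeta> \<sigma> x s \<tau> \<mu> =
     exp (- s * \<tau> * \<zeta> \<mu>) * (\<sigma> (\<tau> + x + s * \<mu>) * \<sigma> x) / (\<sigma> (\<tau> + x) * \<sigma> (x + s * \<mu>))"

definition lame_M :: "(complex \<Rightarrow> complex) \<Rightarrow> complex \<Rightarrow> complex \<Rightarrow> complex \<Rightarrow> complex" where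
  "lame_M wp x s \<mu> = 1 + s * (deriv wp x / deriv wp \<mu>)"

definition lame_N :: "(complex \<Rightarrow> complex) \<Rightarrow> complex \<Rightarrow> complex \<Rightarrow> complex" where
  "lame_N wp x \<mu> = (wp x - wp \<mu>) / deriv wp \<mu>"

section \<open>Complex matrices\<close>

definition cdot :: "complex^'n \<Rightarrow> complex^'n \<Rightarrow> complex" where
  "cdot x y = (\<Sum>k\<in>UNIV. cnj (x $ k) * y $ k)"

definition dagger :: "complex^'n^'m \<Rightarrow> complex^'m^'n" where
  "dagger A = map_matrix cnj (transpose A)"

definition unitary_matrix :: "complex^'n^'n \<Rightarrow> bool" where
  "unitary_matrix U \<longleftrightarrow> dagger U ** U = mat 1"

definition diagonal_matrix :: "complex^'n^'n \<Rightarrow> bool" where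
  "diagonal_matrix A \<longleftrightarrow> (\<forall>i j. i \<noteq> j \<longrightarrow> A $ i $ j = 0)"

definition matrix_scale :: "complex \<Rightarrow> complex^'n^'m \<Rightarrow> complex^'n^'m" where
  "matrix_scale z A = map_matrix ((*) z) A"

definition simple_spectrum :: "complex^'n^'n \<Rightarrow> bool" where
  "simple_spectrum A \<longleftrightarrow> card {z. \<exists>v. v \<noteq> 0 \<and> A *v v = z *s v} = CARD('n)"

text \<open>The power operation of the class \<open>power\<close> would multiply matrices entrywise.\<close>

primrec matrix_pow :: "complex^'n^'n \<Rightarrow> nat \<Rightarrow> complex^'n^'n" where
  "matrix_pow A 0 = mat 1"
| "matrix_pow A (Suc k) = A ** matrix_pow A k"

definition matrix_exp :: "complex^'n^'n \<Rightarrow> complex^'n^'n" where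
  "matrix_exp A = (\<Sum>k. (1 / fact k) *\<^sub>R matrix_pow A k)"

text \<open>
  A gauge integral: the derivative of a frame that is merely differentiable need not be
  Lebesgue integrable.
\<close>

definition oriented_integral :: "real \<Rightarrow> real \<Rightarrow> (real \<Rightarrow> 'a::euclidean_space) \<Rightarrow> 'a" where
  "oriented_integral s t f = (if s \<le> t then integral {s..t} f else - integral {t..s} f)"

section \<open>Geodesics on the manifold of complete flags\<close>

text \<open>
  A point of the flag manifold is a triple of pairwise orthogonal lines. It is represented by a
  unitary matrix, whose columns span the lines.
\<close>

definition flag_of :: "complex^3^3 \<Rightarrow> 3 \<Rightarrow> (complex^3) set" where
  "flag_of U j = vec.span {column j U}"

text \<open>
  The squared length of the velocity of a curve of flags, in terms of a unitary representative
  \<open>U\<close> and its velocity \<open>X\<close>. The value is unchanged when the columns of the representing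
  curve are multiplied by (time dependent) phases.
\<close>

definition flag_metric :: "real \<Rightarrow> real \<Rightarrow> real \<Rightarrow> complex^3^3 \<Rightarrow> complex^3^3 \<Rightarrow> real" where
  "flag_metric \<alpha>12 \<alpha>13 \<alpha>23 U X =
     1 / \<alpha>12 * (cmod (cdot (column 1 U) (column 2 X)))^2 +
     1 / \<alpha>13 * (cmod (cdot (column 1 U) (column 3 X)))^2 +
     1 / \<alpha>23 * (cmod (cdot (column 2 U) (column 3 X)))^2"

definition flag_energy :: "real \<Rightarrow> real \<Rightarrow> real \<Rightarrow> real \<Rightarrow> real \<Rightarrow> (real \<Rightarrow> complex^3^3) \<Rightarrow> real" where
  "flag_energy \<alpha>12 \<alpha>13 \<alpha>23 t0 t1 U =
     1 / 2 * integral {t0..t1}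
       (\<lambda>t. flag_metric \<alpha>12 \<alpha>13 \<alpha>23 (U t) (vector_derivative U (at t within {t0..t1})))"

text \<open>
  A variation, with parameter \<open>s\<close>, of the curve of flags represented by \<open>U\<close>, fixing the
  end points in the flag manifold (but not their representatives).
\<close>

definition proper_flag_variation ::
  "(real \<Rightarrow> complex^3^3) \<Rightarrow> real \<Rightarrow> real \<Rightarrow> (real \<Rightarrow> real \<Rightarrow> complex^3^3) \<Rightarrow> bool" where
  "proper_flag_variation U t0 t1 W \<longleftrightarrow>
     (\<forall>t\<in>{t0..t1}. W 0 t = U t) \<and>
     (\<forall>s. \<forall>t\<in>{t0..t1}. unitary_matrix (W s t)) \<and>
     (\<forall>s. flag_of (W s t0) = flag_of (U t0) \<and> flag_of (W s t1) = flag_of (U t1)) \<and>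
     (\<exists>Ws Wt Wst.
        continuous_on (UNIV \<times> {t0..t1}) (\<lambda>(s, t). Ws s t) \<and>
        continuous_on (UNIV \<times> {t0..t1}) (\<lambda>(s, t). Wt s t) \<and>
        continuous_on (UNIV \<times> {t0..t1}) (\<lambda>(s, t). Wst s t) \<and>
        (\<forall>s. \<forall>t\<in>{t0..t1}.
           ((\<lambda>s. W s t) has_vector_derivative Ws s t) (at s) \<and>
           (W s has_vector_derivative Wt s t) (at t within {t0..t1}) \<and>
           (Ws s has_vector_derivative Wst s t) (at t within {t0..t1}) \<and>
           ((\<lambda>s. Wt s t) has_vector_derivative Wst s t) (at s)))"

text \<open>
  Geodesics (with their affine parametrization) are the critical points of the energy under
  variations with fixed end points. The condition does not depend on the choice of the
  representative \<open>U\<close>.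
\<close>

definition flag_geodesic :: "real \<Rightarrow> real \<Rightarrow> real \<Rightarrow> (real \<Rightarrow> 3 \<Rightarrow> (complex^3) set) \<Rightarrow> bool" where
  "flag_geodesic \<alpha>12 \<alpha>13 \<alpha>23 \<gamma> \<longleftrightarrow>
     (\<exists>U U' U''.
        (\<forall>t. unitary_matrix (U t) \<and> flag_of (U t) = \<gamma> t) \<and>
        (\<forall>t. (U has_vector_derivative U' t) (at t)) \<and>
        (\<forall>t. (U' has_vector_derivative U'' t) (at t)) \<and>
        continuous_on UNIV U'' \<and>
        (\<forall>t0 t1 W. t0 < t1 \<and> proper_flag_variation U t0 t1 W \<longrightarrow>
           ((\<lambda>s. flag_energy \<alpha>12 \<alpha>13 \<alpha>23 t0 t1 (W s)) has_real_derivative 0) (at 0)))"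

section \<open>The matrices attached to a solution\<close>

definition lax_matrix :: "complex \<Rightarrow> complex \<Rightarrow> complex \<Rightarrow> complex^3^3" where
  "lax_matrix a b c =
     vector [vector [0, a, b],
             vector [cnj a, 0, c],
             vector [cnj b, cnj c, 0]]"

definition inertia_matrix :: "real \<Rightarrow> real \<Rightarrow> real \<Rightarrow> complex \<Rightarrow> complex \<Rightarrow> complex \<Rightarrow> complex^3^3" where
  "inertia_matrix \<alpha>12 \<alpha>13 \<alpha>23 a b c =
     vector [vector [0, of_real \<alpha>12 * a, of_real \<alpha>13 * b],
             vector [of_real \<alpha>12 * cnj a, 0, of_real \<alpha>23 * c],
             vector [of_real \<alpha>13 * cnj b, of_real \<alpha>23 * cnj c, 0]]"

definition eigenframe :: "(real \<Rightarrow> complex^3^3) \<Rightarrow> (real \<Rightarrow> complex^3^3) \<Rightarrow> bool" where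
  "eigenframe L E \<longleftrightarrow>
     (\<forall>t. E differentiable (at t) \<and> unitary_matrix (E t) \<and>
          (\<forall>j. \<exists>z. L t *v column j (E t) = z *s column j (E t)))"

text \<open>Below, \<open>J t\<close> is the inertia matrix at time \<open>t\<close> and \<open>E\<close> a frame of eigenvectors.\<close>

definition frame_Q :: "(real \<Rightarrow> complex^3^3) \<Rightarrow> (real \<Rightarrow> complex^3^3) \<Rightarrow> real \<Rightarrow> complex^3^3" where
  "frame_Q J E t =
     matrix_scale (- \<i>) (dagger (E t) ** vector_derivative E (at t)) - dagger (E t) ** J t ** E t"

definition frame_V :: "(real \<Rightarrow> complex^3^3) \<Rightarrow> (real \<Rightarrow> complex^3^3) \<Rightarrow> real \<Rightarrow> complex^3^3" where
  "frame_V J E t =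
     E 0 ** matrix_exp (matrix_scale \<i> (oriented_integral 0 t (frame_Q J E))) ** dagger (E t)"

definition lifts_geodesic_of :: "(real \<Rightarrow> complex^3^3) \<Rightarrow> (real \<Rightarrow> complex^3^3) \<Rightarrow> bool" where
  "lifts_geodesic_of J U \<longleftrightarrow>
     (\<forall>t. unitary_matrix (U t) \<and>
          (\<exists>U'. (U has_vector_derivative U') (at t) \<and> dagger (U t) ** U' = matrix_scale (- \<i>) (J t)))"

end

theory Submission
  imports Defs
begin

text \<open>
  All Weierstrass theory used here comes from uniqueness for second order equations. At a pole the
  reciprocal of \<open>\<wp>\<close> satisfies a regular second order equation with vanishing initial data, so
  two solutions with a common pole coincide: every pole is a period, \<open>\<wp>\<close> is even, and it commutes
  with conjugation. A point is determined modulo periods by the values of \<open>\<wp>\<close> and \<open>\<wp>'\<close>, hence the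
  three half periods give the three roots and \<open>\<wp>\<close> maps the line \<open>\<omega>2 + \<real>\<close> onto \<open>[e3, e2]\<close>.
  The quasi-addition law of zeta follows by differentiating along \<open>u + v = const\<close>.

  Along the Euler flow \<open>I2\<close>, \<open>I3\<close> and \<open>h4\<close> are conserved, so \<open>|c|\<^sup>2\<close>, shifted by a constant, solves the
  Weierstrass equation, while \<open>a\<close>, \<open>b\<close>, \<open>c\<close> each solve a Lame equation with the parameter \<open>\<mu>\<close> in question.

  The Euler equations are the Lax equation \<open>L' = i (J L - L J)\<close>. If \<open>V' = - i V J\<close> and \<open>V(0) = 1\<close>, then
  \<open>E(0)\<^sup>\<dagger> V E\<close> solves a linear equation whose coefficient \<open>i Q\<close> commutes with the simple spectrum \<open>\<Lambda>\<close>
  and is therefore diagonal. The first variation of the energy of \<open>U V\<close> is the integral of the derivative of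
  \<open>Re tr (i L N)\<close>, where \<open>N = U\<^sup>\<dagger> \<partial>U/\<partial>s\<close>, which vanishes at the end points because \<open>N\<close> is diagonal
  there and \<open>L\<close> has zero diagonal.
\<close>

section \<open>Linear differential inequalities and global existence\<close>

text \<open>Three obstacles shape the proof. The Euler field is quadratic, hence only locally
  Lipschitz: it is cut off outside a ball. Being homogeneous it is merely rescaled there, so the
  positive quantities \<open>I2\<close> and \<open>I3\<close> stay conserved and confine the orbit
  to the region where nothing was cut off. The same bound on the orbit makes the linear equation for
  \<open>V\<close> globally Lipschitz.

  The location of \<open>|c|^2\<close> is decided by signs. Along an orbit the shifted cubic is the
  square of a real number, while at \<open>I2\<close> and \<open>I3\<close>, which bound
  \<open>|c|^2\<close> from above, it is not positive. This forces the roots to be real and puts the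
  orbit between the two smaller ones, which is why the argument of \<open>wp\<close> runs on the
  line through \<open>\<omega>2\<close> and not on the real axis.

  The eigenframe is only differentiable, so \<open>Q\<close> need not be continuous. The equation
  for \<open>V\<close> in that frame is therefore solved entry by entry, through logarithms of the
  diagonal phases, and their derivatives are integrated in the gauge sense.\<close>

lemma antiderivative_on_reals:
  fixes g :: "real \<Rightarrow> 'a::banach"
  assumes "continuous_on UNIV g"
  shows "((\<lambda>t. integral {0..t} g - integral {t..0} g) has_vector_derivative g t) (at t)"
proof -
  define N where "N = \<bar>t\<bar> + 1"
  \<comment> \<open>At most one of the two integrals is over a nondegenerate interval, so
    \<open>G\<close> is the oriented integral from 0; near \<open>t\<close> it differs by a constant
    from the integral with the fixed left end \<open>-N\<close>.\<close>
  define G where "G = (\<lambda>t. integral {0..t} g - integral {t..0} g)"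
  have cont: "continuous_on A g" for A
    using assms continuous_on_subset by blast
  have int: "g integrable_on {a..b}" for a b
    by (rule integrable_continuous_real[OF cont])
  have eq: "G u = integral {-N..u} g - integral {-N..0} g" if "u \<in> {-N<..<N}" for u
  proof (cases "u \<ge> 0")
    case True
    have "integral {-N..0} g + integral {0..u} g = integral {-N..u} g"
      by (rule Henstock_Kurzweil_Integration.integral_combine) (use True that int N_def in auto)
    moreover have "integral {u..0} g = 0" using True by (cases "u = 0") auto
    ultimately show ?thesis by (simp add: G_def algebra_simps)
  next
    case False
    have "integral {-N..u} g + integral {u..0} g = integral {-N..0} g"
      by (rule Henstock_Kurzweil_Integration.integral_combine) (use False that int N_def in auto)
    moreover have "integral {0..u} g = 0" using False by auto
    ultimately show ?thesis by (simp add: G_def algebra_simps)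
  qed
  have tN: "t \<in> {-N<..<N}" by (auto simp: N_def)
  have "((\<lambda>u. integral {-N..u} g) has_vector_derivative g t) (at t within {-N..N})"
    by (rule integral_has_vector_derivative[OF cont]) (use tN in auto)
  hence "((\<lambda>u. integral {-N..u} g) has_vector_derivative g t) (at t)"
    using tN at_within_interior[of t "{-N..N}"] by (simp add: interior_atLeastAtMost_real)
  hence "((\<lambda>u. integral {-N..u} g - integral {-N..0} g) has_vector_derivative g t) (at t)"
    by (auto intro!: derivative_eq_intros)
  hence "(G has_vector_derivative g t) (at t)"
    by (rule has_vector_derivative_transform_within_open[where S="{-N<..<N}"])
       (use tN eq in auto)
  thus ?thesis by (simp add: G_def)
qed

lemma continuous_on_vector_derivative:
  "(\<And>t. (f has_vector_derivative f' t) (at t)) \<Longrightarrow> continuous_on S f"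
  by (intro continuous_at_imp_continuous_on ballI has_vector_derivative_continuous)

text \<open>One integration raises the power of the time by one and divides by the new exponent:
  this is the induction step behind the factorials of the Picard iteration. Negative times are
  reflected to positive ones.\<close>

lemma norm_antiderivative_le:
  fixes G :: "real \<Rightarrow> 'a::real_normed_vector"
  assumes G: "\<And>s. (G has_vector_derivative g s) (at s)" and "G 0 = 0"
    and g: "\<And>s. \<bar>s\<bar> \<le> T \<Longrightarrow> norm (g s) \<le> C * \<bar>s\<bar> ^ n" and t: "\<bar>t\<bar> \<le> T"
  shows "norm (G t) \<le> C * \<bar>t\<bar> ^ Suc n / Suc n"
proof -
  have pos: "norm (H t) \<le> C * t ^ Suc n / Suc n"
    if H: "\<And>s. (H has_vector_derivative h s) (at s)" "H 0 = 0"
      "\<And>s. 0 \<le> s \<Longrightarrow> s \<le> T \<Longrightarrow> norm (h s) \<le> C * s ^ n" and t: "0 \<le> t" "t \<le> T" for t and H h :: "real \<Rightarrow> 'a"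
  proof (cases "t = 0")
    case False
    have "norm (H t - H 0) \<le> C * t ^ Suc n / Suc n - C * 0 ^ Suc n / Suc n"
    proof (rule differentiable_bound_general)
      show "0 < t" using False t by simp
      show "continuous_on {0..t} H"
        by (rule continuous_on_vector_derivative[OF H(1)])
      show "continuous_on {0..t} (\<lambda>t. C * t ^ Suc n / Suc n)" by (intro continuous_intros) auto
      show "(H has_vector_derivative h x) (at x)" for x by fact
      show "((\<lambda>t. C * t ^ Suc n / Suc n) has_vector_derivative C * x ^ n) (at x)" for x
        unfolding has_real_derivative_iff_has_vector_derivative[symmetric]
        by (auto intro!: derivative_eq_intros simp del: power_Suc of_nat_Suc)
      show "norm (h x) \<le> C * x ^ n" if "0 < x" "x < t" for x using that t H(3) by auto
    qed
    thus ?thesis using H(2) by simp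
  qed (use that in auto)
  show ?thesis
  proof (cases "t \<ge> 0")
    case True
    have "norm (g s) \<le> C * s ^ n" if "0 \<le> s" "s \<le> T" for s using g[of s] that by simp
    from pos[OF assms(1,2) this] show ?thesis using True t by simp
  next
    case False
    have "((\<lambda>t. G (- t)) has_vector_derivative - g (- s)) (at s)" for s
      using vector_diff_chain_at[of uminus "-1" s G "g (- s)"] G[of "-s"]
      by (auto simp: o_def has_vector_derivative_minus intro!: derivative_eq_intros)
    moreover have "norm (- g (- s)) \<le> C * s ^ n" if "0 \<le> s" "s \<le> T" for s using g[of "-s"] that by simp
    ultimately show ?thesis using pos[of "\<lambda>t. G (- t)" "\<lambda>s. - g (- s)" "-t"] False t \<open>G 0 = 0\<close> by simp
  qed
qed

text \<open>Picard iteration. A Lipschitz constant that is global in space bounds the successive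
  differences by the terms of an exponential series, so the iterates converge uniformly on every
  bounded interval. Continuity of \<open>F\<close> is asked along continuous curves, the form in
  which the integrands of the iteration occur.\<close>

theorem global_ode_existence:
  fixes F :: "real \<Rightarrow> 'a::banach \<Rightarrow> 'a"
  assumes cont: "\<And>x. continuous_on UNIV x \<Longrightarrow> continuous_on UNIV (\<lambda>s. F s (x s))"
    and lip: "\<And>s u v. norm (F s u - F s v) \<le> L * norm (u - v)" and L: "L \<ge> 0"
  obtains x where "x 0 = x0" "\<And>t. (x has_vector_derivative F t (x t)) (at t)"
proof -
  define A :: "(real \<Rightarrow> 'a) \<Rightarrow> real \<Rightarrow> 'a" where "A = (\<lambda>g t. integral {0..t} g - integral {t..0} g)"
  have A0: "A g 0 = 0" for g by (simp add: A_def)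
  have A': "(A g has_vector_derivative g t) (at t)" if "continuous_on UNIV g" for g t
    using antiderivative_on_reals[OF that] by (simp add: A_def)
  define X where "X = rec_nat (\<lambda>_. x0) (\<lambda>_ f t. x0 + A (\<lambda>s. F s (f s)) t)"
  have X0: "X 0 = (\<lambda>_. x0)" and XS: "X (Suc n) = (\<lambda>t. x0 + A (\<lambda>s. F s (X n s)) t)" for n
    by (simp_all add: X_def)
  have contX: "continuous_on UNIV (X n)" for n
  proof (induction n)
    case (Suc n)
    have "continuous_on UNIV (A (\<lambda>s. F s (X n s)))"
      by (rule continuous_on_vector_derivative[OF A'[OF cont[OF Suc]]])
    thus ?case by (simp add: XS continuous_on_add)
  qed (simp add: X0)
  have X': "(X (Suc n) has_vector_derivative F s (X n s)) (at s)" for n s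
    unfolding XS by (auto intro!: derivative_eq_intros A' cont contX)
  have bound: "\<exists>M. \<forall>n t. \<bar>t\<bar> \<le> T \<longrightarrow> norm (X (Suc n) t - X n t) \<le> M * L ^ n * \<bar>t\<bar> ^ Suc n / fact (Suc n)" for T
  proof -
    have "compact ((\<lambda>s. F s x0) ` {-T..T})"
      by (intro compact_continuous_image continuous_on_subset[OF cont[of "\<lambda>_. x0"]]) auto
    then obtain M where M: "\<And>s. \<bar>s\<bar> \<le> T \<Longrightarrow> norm (F s x0) \<le> M"
      using compact_imp_bounded[THEN bounded_normE] by (metis abs_le_iff atLeastAtMost_iff imageI minus_le_iff)
    have "norm (X (Suc n) t - X n t) \<le> M * L ^ n * \<bar>t\<bar> ^ Suc n / fact (Suc n)" if "\<bar>t\<bar> \<le> T" for n t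
      using that
    proof (induction n arbitrary: t)
      case 0
      show ?case
        using norm_antiderivative_le[OF A'[OF cont[of "\<lambda>_. x0"]] A0, of T M 0 t] M 0
        by (simp add: XS X0)
    next
      case (Suc n)
      have "norm (X (Suc (Suc n)) t - X (Suc n) t) \<le> (M * L ^ Suc n / fact (Suc n)) * \<bar>t\<bar> ^ Suc (Suc n) / Suc (Suc n)"
      proof (rule norm_antiderivative_le[where T=T and g="\<lambda>s. F s (X (Suc n) s) - F s (X n s)"])
        show "((\<lambda>t. X (Suc (Suc n)) t - X (Suc n) t) has_vector_derivative F s (X (Suc n) s) - F s (X n s)) (at s)" for s
          by (rule has_vector_derivative_diff[OF X' X'])
        show "X (Suc (Suc n)) 0 - X (Suc n) 0 = 0" by (simp add: XS A0)
        show "\<bar>t\<bar> \<le> T" by fact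
        fix s assume s: "\<bar>s\<bar> \<le> T"
        have "norm (F s (X (Suc n) s) - F s (X n s)) \<le> L * norm (X (Suc n) s - X n s)" by (rule lip)
        also have "\<dots> \<le> L * (M * L ^ n * \<bar>s\<bar> ^ Suc n / fact (Suc n))"
          by (intro mult_left_mono Suc.IH s L)
        finally show "norm (F s (X (Suc n) s) - F s (X n s)) \<le> M * L ^ Suc n / fact (Suc n) * \<bar>s\<bar> ^ Suc n"
          by (simp add: mult_ac)
      qed
      thus ?case by (simp add: field_simps del: of_nat_Suc)
    qed
    thus ?thesis by blast
  qed
  have ulim: "uniform_limit {-T..T} X (\<lambda>t. lim (\<lambda>n. X n t)) sequentially" for T
  proof -
    obtain M where M: "\<And>n t. \<bar>t\<bar> \<le> T \<Longrightarrow> norm (X (Suc n) t - X n t) \<le> M * L ^ n * \<bar>t\<bar> ^ Suc n / fact (Suc n)"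
      using bound by blast
    \<comment> \<open>These are the terms of \<open>\<bar>M\<bar> * T * exp (L * T)\<close>;
      replacing \<open>fact (Suc n)\<close> by \<open>fact n\<close> only enlarges the
      bound.\<close>
    define B where "B = (\<lambda>n. \<bar>M\<bar> * T * ((L * T) ^ n / fact n))"
    have "uniform_limit {-T..T} (\<lambda>n t. \<Sum>i<n. X (Suc i) t - X i t) (\<lambda>t. \<Sum>i. X (Suc i) t - X i t) sequentially"
    proof (rule Weierstrass_m_test)
      show "summable B" unfolding B_def using summable_exp[of "L*T"]
        by (intro summable_mult) (simp add: divide_inverse mult.commute)
      fix n t assume "t \<in> {-T..T}"
      hence t: "\<bar>t\<bar> \<le> T" by auto
      have "norm (X (Suc n) t - X n t) \<le> M * L ^ n * \<bar>t\<bar> ^ Suc n / fact (Suc n)" using M t by blast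
      also have "\<dots> \<le> \<bar>M\<bar> * L ^ n * T ^ Suc n / fact n"
        using t L by (intro frac_le mult_mono power_mono fact_mono) auto
      finally show "norm (X (Suc n) t - X n t) \<le> B n" by (simp add: B_def power_mult_distrib mult_ac)
    qed
    hence "uniform_limit {-T..T} (\<lambda>n t. X n t - x0) (\<lambda>t. \<Sum>i. X (Suc i) t - X i t) sequentially"
      using sum_lessThan_telescope[of "\<lambda>i. X i t" for t] by (simp add: X0)
    hence "uniform_limit {-T..T} (\<lambda>n t. (X n t - x0) + x0) (\<lambda>t. (\<Sum>i. X (Suc i) t - X i t) + x0) sequentially"
      by (intro uniform_limit_intros)
    hence u: "uniform_limit {-T..T} X (\<lambda>t. (\<Sum>i. X (Suc i) t - X i t) + x0) sequentially" by simp
    show ?thesis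
      by (rule uniform_limit_cong'[THEN iffD1, OF _ _ u]) (use tendsto_uniform_limitI[OF u] limI in metis)+
  qed
  define x where "x = (\<lambda>t. lim (\<lambda>n. X n t))"
  have contx: "continuous_on UNIV x"
  proof -
    have "isCont x t" for t
    proof -
      have "continuous_on {-(\<bar>t\<bar>+1)..\<bar>t\<bar>+1} x"
        by (rule uniform_limit_theorem[OF _ ulim[folded x_def]])
           (auto intro: continuous_on_subset[OF contX] always_eventually)
      thus ?thesis by (rule continuous_on_interior) auto
    qed
    thus ?thesis by (simp add: continuous_at_imp_continuous_on)
  qed
  have xeq: "x t = x0 + A (\<lambda>s. F s (x s)) t" for t
  proof -
    define T where "T = \<bar>t\<bar>"
    have lim1: "(\<lambda>n. X (Suc n) t) \<longlonglongrightarrow> x t"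
      by (rule LIMSEQ_Suc, rule tendsto_uniform_limitI[OF ulim[of T, folded x_def]]) (auto simp: T_def)
    have lim2: "(\<lambda>n. X (Suc n) t) \<longlonglongrightarrow> x0 + A (\<lambda>s. F s (x s)) t"
    proof (rule metric_LIMSEQ_I)
      fix e :: real assume e: "e > 0"
      \<comment> \<open>Iterates that are \<open>d\<close>-close give integrals at distance at most
        \<open>L * T * d\<close>; the summand 1 keeps the denominator positive and the final
        inequality strict.\<close>
      define d where "d = e / (L * T + 1)"
      have d: "d > 0" using e L by (simp add: d_def T_def add_nonneg_pos)
      obtain N where N: "\<And>n s. n \<ge> N \<Longrightarrow> \<bar>s\<bar> \<le> T \<Longrightarrow> dist (X n s) (x s) < d"
        using uniform_limitD[OF ulim[of T, folded x_def] d] by (force simp: eventually_sequentially abs_le_iff)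
      have "dist (X (Suc n) t) (x0 + A (\<lambda>s. F s (x s)) t) < e" if "n \<ge> N" for n
      proof -
        have "norm (X (Suc n) t - (x0 + A (\<lambda>s. F s (x s)) t)) \<le> (L * d) * \<bar>t\<bar> ^ Suc 0 / Suc 0"
        proof (rule norm_antiderivative_le[where T=T and g="\<lambda>s. F s (X n s) - F s (x s)"])
          show "((\<lambda>t. X (Suc n) t - (x0 + A (\<lambda>s. F s (x s)) t)) has_vector_derivative F s (X n s) - F s (x s)) (at s)" for s
            by (rule has_vector_derivative_eq_rhs, rule has_vector_derivative_diff[OF X'
                  has_vector_derivative_add[OF has_vector_derivative_const A'[OF cont[OF contx]]]]) simp
          show "X (Suc n) 0 - (x0 + A (\<lambda>s. F s (x s)) 0) = 0" by (simp add: XS A0)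
          show "\<bar>t\<bar> \<le> T" by (simp add: T_def)
          fix s assume "\<bar>s\<bar> \<le> T"
          hence "L * norm (X n s - x s) \<le> L * d"
            using N[OF that, of s] L by (intro mult_left_mono) (auto simp: dist_norm)
          thus "norm (F s (X n s) - F s (x s)) \<le> L * d * \<bar>s\<bar> ^ 0"
            using lip[of s "X n s" "x s"] by simp
        qed
        also have "\<dots> = L * T * d" by (simp add: T_def)
        also have "\<dots> < (L * T + 1) * d" using d by (simp add: distrib_right)
        also have "\<dots> = e" using L by (simp add: d_def T_def add_nonneg_pos less_imp_neq[symmetric])
        finally show ?thesis by (simp add: dist_norm)
      qed
      thus "\<exists>no. \<forall>n\<ge>no. dist (X (Suc n) t) (x0 + A (\<lambda>s. F s (x s)) t) < e" by blast
    qed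
    show ?thesis by (rule LIMSEQ_unique[OF lim1 lim2])
  qed
  show thesis
  proof
    show "x 0 = x0" using xeq[of 0] by (simp add: A0)
    have "((\<lambda>t. x0 + A (\<lambda>s. F s (x s)) t) has_vector_derivative F t (x t)) (at t)" for t
      by (auto intro!: derivative_eq_intros A' cont contx)
    moreover have "(\<lambda>t. x0 + A (\<lambda>s. F s (x s)) t) = x"
      by (intro HOL.ext xeq[symmetric])
    ultimately show "(x has_vector_derivative F t (x t)) (at t)" for t by simp
  qed
qed

text \<open>Gronwall: \<open>exp (- 2 L t) |d|\<^sup>2\<close> is decreasing.\<close>

lemma gronwall_zero:
  fixes d :: "real \<Rightarrow> 'a::real_inner"
  assumes d: "\<And>t. 0 \<le> t \<Longrightarrow> t \<le> T \<Longrightarrow> (d has_vector_derivative d' t) (at t within {0..T})"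
    and le: "\<And>t. 0 \<le> t \<Longrightarrow> t \<le> T \<Longrightarrow> norm (d' t) \<le> L * norm (d t)"
    and "d 0 = 0" "0 \<le> t" "t \<le> T"
  shows "d t = 0"
proof -
  define f where "f = (\<lambda>t. exp (- 2 * L * t) * (d t \<bullet> d t))"
  have "(f has_real_derivative exp (- 2 * L * s) * (2 * (d s \<bullet> d' s) - 2 * L * (d s \<bullet> d s))) (at s within {0..T})"
    if "0 \<le> s" "s \<le> T" for s
  proof -
    have "((\<lambda>t. d t \<bullet> d t) has_real_derivative 2 * (d s \<bullet> d' s)) (at s within {0..T})"
      using bounded_bilinear.has_vector_derivative[OF bounded_bilinear_inner d[OF that] d[OF that]]
      by (simp add: has_real_derivative_iff_has_vector_derivative inner_commute)
    thus ?thesis unfolding f_def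
      by (auto intro!: derivative_eq_intros simp: algebra_simps)
  qed
  moreover have "exp (- 2 * L * s) * (2 * (d s \<bullet> d' s) - 2 * L * (d s \<bullet> d s)) \<le> 0" if "0 \<le> s" "s \<le> T" for s
  proof -
    have "d s \<bullet> d' s \<le> norm (d s) * norm (d' s)" by (rule norm_cauchy_schwarz)
    also have "\<dots> \<le> norm (d s) * (L * norm (d s))" by (intro mult_left_mono le that) auto
    also have "\<dots> = L * (d s \<bullet> d s)" by (simp add: power2_norm_eq_inner[symmetric] power2_eq_square)
    finally show ?thesis by (simp add: mult_le_0_iff)
  qed
  ultimately have f': "\<exists>y. (f has_real_derivative y) (at s) \<and> y \<le> 0" if "0 < s" "s < t" for s
    using that at_within_interior[of s "{0..T}"] \<open>t \<le> T\<close> by (metis (no_types, lifting) greaterThanLessThan_iff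
        interior_atLeastAtMost_real less_eq_real_def less_le_trans)
  have "continuous_on {0..T} f"
    unfolding f_def using d
    by (intro continuous_intros) (auto simp: continuous_on_eq_continuous_within intro!: has_vector_derivative_continuous)
  hence "f t \<le> f 0"
    by (intro DERIV_nonpos_imp_decreasing_open[of 0 t f] f') (use assms in \<open>auto intro: continuous_on_subset\<close>)
  hence "f t \<le> 0" using assms by (simp add: f_def)
  hence "d t \<bullet> d t \<le> 0" by (simp add: f_def mult_le_0_iff)
  thus ?thesis by (metis inner_gt_zero_iff not_less)
qed

text \<open>The pair \<open>(u, v)\<close> satisfies a first order inequality with constant
  \<open>1 + \<bar>M\<bar>\<close>, to which \<open>gronwall_zero\<close> applies.\<close>

lemma second_order_gronwall_zero:
  fixes u :: "real \<Rightarrow> 'a::real_inner"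
  assumes u: "\<And>t. 0 \<le> t \<Longrightarrow> t \<le> T \<Longrightarrow> (u has_vector_derivative v t) (at t within {0..T})"
    and v: "\<And>t. 0 \<le> t \<Longrightarrow> t \<le> T \<Longrightarrow> (v has_vector_derivative v' t) (at t within {0..T})"
    and le: "\<And>t. 0 \<le> t \<Longrightarrow> t \<le> T \<Longrightarrow> norm (v' t) \<le> M * norm (u t)"
    and "u 0 = 0" "v 0 = 0" "0 \<le> t" "t \<le> T"
  shows "u t = 0"
proof -
  have "(u t, v t) = 0"
  proof (rule gronwall_zero[where T=T and d="\<lambda>t. (u t, v t)" and d'="\<lambda>t. (v t, v' t)" and L="1 + \<bar>M\<bar>"])
    fix t assume t: "0 \<le> t" "t \<le> T"
    show "((\<lambda>t. (u t, v t)) has_vector_derivative (v t, v' t)) (at t within {0..T})"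
      by (intro has_vector_derivative_Pair u v t)
    have "norm (v t, v' t) \<le> norm (v t) + norm (v' t)" by (rule norm_Pair_le)
    also have "\<dots> \<le> norm (v t) + \<bar>M\<bar> * norm (u t)"
      using le[OF t] mult_right_mono[OF abs_ge_self[of M] norm_ge_zero[of "u t"]] by linarith
    also have "\<dots> \<le> norm (u t, v t) + \<bar>M\<bar> * norm (u t, v t)"
      using norm_fst_le[of "u t" "v t"] norm_snd_le[of "v t" "u t"] by (intro add_mono mult_left_mono) auto
    finally show "norm (v t, v' t) \<le> (1 + \<bar>M\<bar>) * norm (u t, v t)" by (simp add: distrib_right)
  qed (use assms in \<open>auto simp: zero_prod_def\<close>)
  thus ?thesis by (simp add: zero_prod_def)
qed

section \<open>The Weierstrass equation\<close>

text \<open>Restricted to the segment from 0 to \<open>z\<close>, the equation becomes one in a real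
  variable, with a coefficient that is bounded by compactness.\<close>

lemma holomorphic_linear_ode_zero:
  assumes d: "d holomorphic_on ball 0 r"
    and ode: "\<And>z. z \<in> ball 0 r \<Longrightarrow> deriv (deriv d) z = R z * d z"
    and R: "continuous_on (ball 0 r) R" and "d 0 = 0" "deriv d 0 = 0" "z \<in> ball 0 r"
  shows "d z = 0"
proof -
  have sub: "(\<lambda>t. of_real t * z) ` {0..1} \<subseteq> ball 0 r"
  proof safe
    fix t :: real assume t: "t \<in> {0..1}"
    have "norm (of_real t * z) \<le> 1 * norm z"
      unfolding norm_mult using t by (intro mult_right_mono) auto
    thus "of_real t * z \<in> ball 0 r" using assms by auto
  qed
  have "compact ((\<lambda>t. z^2 * R (of_real t * z)) ` {0..1})"
    using sub by (intro compact_continuous_image continuous_intros continuous_on_compose2[OF R]) auto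
  then obtain M where M: "\<And>t. t \<in> {0..1} \<Longrightarrow> norm (z^2 * R (of_real t * z)) \<le> M"
    by (meson bounded_iff compact_imp_bounded imageI)
  have "d (of_real 1 * z) = 0"
  proof (rule second_order_gronwall_zero[where T=1 and M=M and u="\<lambda>t. d (of_real t * z)"
        and v="\<lambda>t. z * deriv d (of_real t * z)" and v'="\<lambda>t. z^2 * deriv (deriv d) (of_real t * z)"])
    fix t :: real assume "0 \<le> t" "t \<le> 1"
    hence t: "of_real t * z \<in> ball 0 r" using sub by (metis atLeastAtMost_iff image_subset_iff)
    have lin: "((\<lambda>w. w * z) has_field_derivative z) (at (of_real t))" by (auto intro!: derivative_eq_intros)
    have 1: "(d has_field_derivative deriv d (of_real t * z)) (at (of_real t * z))"
      by (rule holomorphic_derivI[OF d _ t]) simp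
    have "((\<lambda>w. d (w * z)) has_field_derivative deriv d (of_real t * z) * z) (at (of_real t))"
      using DERIV_chain2[OF 1 lin] by simp
    thus "((\<lambda>t. d (of_real t * z)) has_vector_derivative z * deriv d (of_real t * z)) (at t within {0..1})"
      using has_vector_derivative_real_field[of "\<lambda>w. d (w * z)"]
      by (simp add: mult.commute has_vector_derivative_at_within)
    have 2: "(deriv d has_field_derivative deriv (deriv d) (of_real t * z)) (at (of_real t * z))"
      by (rule holomorphic_derivI[OF holomorphic_deriv[OF d] _ t]) simp_all
    have "((\<lambda>w. z * deriv d (w * z)) has_field_derivative z^2 * deriv (deriv d) (of_real t * z)) (at (of_real t))"
      using DERIV_cmult[OF DERIV_chain2[OF 2 lin], of z] by (simp add: power2_eq_square mult_ac)
    thus "((\<lambda>t. z * deriv d (of_real t * z)) has_vector_derivative z^2 * deriv (deriv d) (of_real t * z)) (at t within {0..1})"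
      using has_vector_derivative_real_field[of "\<lambda>w. z * deriv d (w * z)"]
      by (simp add: has_vector_derivative_at_within)
    show "norm (z^2 * deriv (deriv d) (of_real t * z)) \<le> M * norm (d (of_real t * z))"
      unfolding ode[OF t] using M[of t] \<open>0 \<le> t\<close> \<open>t \<le> 1\<close>
      by (simp add: norm_mult mult.assoc[symmetric] mult_right_mono)
  qed (use assms in auto)
  thus ?thesis by simp
qed

text \<open>Collected here are properties that survive translation, reflection and conjugation
  (which also conjugates the invariants), with no normalization at 0. The transformed functions are
  again instances and can be compared with the original by uniqueness. The fixed value 0 at poles
  makes such comparisons equalities of total functions.\<close>

locale weierstrass_ode =
  fixes g2 g3 :: complex and f :: "complex \<Rightarrow> complex"
  assumes closed_poles: "closed {z. is_pole f z}"
    and countable_poles: "countable {z. is_pole f z}"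
    and differentiable: "\<not> is_pole f z \<Longrightarrow> f field_differentiable at z"
    and at_pole: "is_pole f z \<Longrightarrow> f z = 0"
    and ode: "\<not> is_pole f z \<Longrightarrow> (deriv f z)^2 = 4 * f z ^ 3 - g2 * f z - g3"
    and ex_pole: "\<exists>z. is_pole f z"
begin

definition reg :: "complex set" where "reg = - {z. is_pole f z}"

lemma mem_reg: "z \<in> reg \<longleftrightarrow> \<not> is_pole f z" by (simp add: reg_def)

lemma open_reg: "open reg" using closed_poles by (simp add: reg_def open_Compl)

lemma connected_reg: "connected reg"
  using connected_open_diff_countable[of "UNIV :: complex set" "{z. is_pole f z}"] countable_poles
  by (simp add: reg_def Compl_eq_Diff_UNIV connected_UNIV)

lemma holomorphic: "f holomorphic_on reg"
  using differentiable by (simp add: holomorphic_on_def mem_reg field_differentiable_at_within)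

lemma holomorphic_deriv': "deriv f holomorphic_on reg"
  by (intro holomorphic_deriv holomorphic open_reg)

lemma DERIV1: "\<not> is_pole f z \<Longrightarrow> (f has_field_derivative deriv f z) (at z)"
  by (rule holomorphic_derivI[OF holomorphic open_reg]) (simp add: mem_reg)

lemma DERIV2_aux: "\<not> is_pole f z \<Longrightarrow> (deriv f has_field_derivative deriv (deriv f) z) (at z)"
  by (rule holomorphic_derivI[OF holomorphic_deriv' open_reg]) (simp add: mem_reg)

lemma eventually_large: "is_pole f p \<Longrightarrow> eventually (\<lambda>z. norm (f z) > C \<and> z \<in> reg) (at p)"
proof -
  assume "is_pole f p"
  hence "eventually (\<lambda>z. norm (f z) > max C 0) (at p)"
    unfolding is_pole_def
    by (auto dest!: filterlim_at_infinity_imp_norm_at_top simp: filterlim_at_top_dense simp del: max_less_iff_conj)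
  thus ?thesis by eventually_elim (use at_pole in \<open>auto simp: mem_reg\<close>)
qed

text \<open>Differentiating the first order equation only gives \<open>deriv f z * F z = 0\<close>.
  Since a constant has no pole, \<open>deriv f\<close> is nonzero somewhere, hence on an open set,
  and the identity theorem on the connected set \<open>reg\<close> removes the factor.\<close>

lemma deriv_deriv: assumes "\<not> is_pole f z" shows "deriv (deriv f) z = 6 * f z ^ 2 - g2 / 2"
proof -
  define F where "F = (\<lambda>z. deriv (deriv f) z - (6 * f z ^ 2 - g2 / 2))"
  have F0: "deriv f z * F z = 0" if z: "z \<in> reg" for z
  proof -
    have "((\<lambda>z. (deriv f z)^2 - (4 * f z ^ 3 - g2 * f z - g3)) has_field_derivative
             2 * deriv f z * deriv (deriv f) z - (12 * f z ^ 2 * deriv f z - g2 * deriv f z)) (at z)"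
      using z by (auto intro!: derivative_eq_intros DERIV1 DERIV2_aux simp: mem_reg)
    moreover have "((\<lambda>z. (deriv f z)^2 - (4 * f z ^ 3 - g2 * f z - g3)) has_field_derivative 0) (at z)"
      by (rule has_field_derivative_transform_within_open[OF DERIV_const[of 0] open_reg z])
         (auto simp: ode mem_reg)
    ultimately have "2 * deriv f z * deriv (deriv f) z - (12 * f z ^ 2 * deriv f z - g2 * deriv f z) = 0"
      by (rule DERIV_unique)
    moreover have "deriv f z * F z =
        (2 * deriv f z * deriv (deriv f) z - (12 * f z ^ 2 * deriv f z - g2 * deriv f z)) / 2"
      by (simp add: F_def field_simps)
    ultimately show ?thesis by simp
  qed
  have "\<exists>z1\<in>reg. deriv f z1 \<noteq> 0"
  proof (rule ccontr)
    assume "\<not> ?thesis"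
    hence "\<And>z. z \<in> reg \<Longrightarrow> (f has_field_derivative 0) (at z)" using DERIV1 mem_reg by metis
    then obtain c where c: "\<And>z. z \<in> reg \<Longrightarrow> f z = c"
      using DERIV_zero_connected_constant[OF connected_reg open_reg finite.emptyI, of f]
      holomorphic_on_imp_continuous_on[OF holomorphic] by blast
    obtain p where "is_pole f p" using ex_pole by blast
    have "\<forall>\<^sub>F z in at p. False"
      using eventually_large[OF \<open>is_pole f p\<close>, of "norm c"] by eventually_elim (use c in auto)
    thus False by simp
  qed
  then obtain z1 where z1: "z1 \<in> reg" "deriv f z1 \<noteq> 0" by blast
  define T where "T = {z \<in> reg. deriv f z \<noteq> 0}"
  have "open T"
    using continuous_open_preimage[OF holomorphic_on_imp_continuous_on[OF holomorphic_deriv'] open_reg, of "-{0}"]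
    by (auto simp: T_def vimage_def Int_def)
  have "F z = 0"
  proof (rule analytic_continuation_open[of T reg F "\<lambda>_. 0"])
    show "F holomorphic_on reg"
      unfolding F_def by (intro holomorphic_intros holomorphic_deriv holomorphic open_reg)
    show "\<And>z. z \<in> T \<Longrightarrow> F z = 0" using F0 by (auto simp: T_def)
  qed (use \<open>open T\<close> z1 open_reg connected_reg assms in \<open>auto simp: T_def mem_reg\<close>)
  thus ?thesis by (simp add: F_def)
qed

lemma DERIV2: "\<not> is_pole f z \<Longrightarrow> (deriv f has_field_derivative 6 * f z ^ 2 - g2 / 2) (at z)"
  using DERIV2_aux deriv_deriv by simp

text \<open>The reciprocal turns poles into regular points of a second order equation.\<close>

lemma reciprocal:
  assumes "is_pole f p"
  obtains r where "r > 0" "(\<lambda>z. 1 / f z) holomorphic_on ball p r" "deriv (\<lambda>z. 1 / f z) p = 0"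
    "\<And>z. z \<in> ball p r \<Longrightarrow> deriv (deriv (\<lambda>z. 1 / f z)) z = 2 - 3/2 * g2 * (1 / f z)^2 - 2 * g3 * (1 / f z)^3"
proof -
  define g where "g = (\<lambda>z. 1 / f z)"
  obtain r where r: "r > 0" "\<And>z. z \<in> ball p r - {p} \<Longrightarrow> f z \<noteq> 0 \<and> z \<in> reg"
    using eventually_large[OF assms, of 0] unfolding eventually_at by (force simp: dist_commute)
  \<comment> \<open>The value 0 of \<open>f\<close> at its pole and the convention
    \<open>1 / 0 = 0\<close> give \<open>g\<close> exactly the value that removes the
    singularity.\<close>
  have gp: "g p = 0" using at_pole[OF assms] by (simp add: g_def)
  have hol': "g holomorphic_on ball p r - {p}"
    unfolding g_def
  proof (intro holomorphic_intros holomorphic_on_subset[OF holomorphic])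
    show "ball p r - {p} \<subseteq> reg" using r(2) by blast
  qed (use r(2) in blast)
  have "(g \<longlongrightarrow> 0) (at p)"
    using assms unfolding is_pole_def g_def by (intro tendsto_divide_0[OF tendsto_const])
  hence lim: "(g \<longlongrightarrow> g p) (at p)" by (simp add: gp)
  have hol: "g holomorphic_on ball p r"
  proof (rule no_isolated_singularity'[where K="{p}"])
    show "(g \<longlongrightarrow> g z) (at z within ball p r)" if "z \<in> {p}" for z
      using lim that by (auto intro: tendsto_within_subset)
  qed (use hol' in auto)
  \<comment> \<open>Identities for \<open>g\<close> are proved on the punctured ball, where
    \<open>f\<close> is regular, and extended to \<open>p\<close> by continuity.\<close>
  have ext: "h p = 0" if "h holomorphic_on ball p r" "\<And>z. z \<in> ball p r - {p} \<Longrightarrow> h z = 0" for h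
  proof -
    have "(h \<longlongrightarrow> h p) (at p)"
      using that(1) r(1) by (metis centre_in_ball continuous_on_eq_continuous_at holomorphic_on_imp_continuous_on isContD open_ball)
    moreover have "eventually (\<lambda>z. h z = 0) (at p)"
      using eventually_at_ball'[OF r(1), of p UNIV] by eventually_elim (use that in auto)
    hence "(h \<longlongrightarrow> 0) (at p)" by (simp add: tendsto_eventually)
    ultimately show ?thesis by (metis LIM_unique)
  qed
  have d1: "(g has_field_derivative - deriv f z / (f z)^2) (at z)" if "z \<in> ball p r - {p}" for z
    unfolding g_def using r(2)[OF that] by (auto intro!: derivative_eq_intros DERIV1 simp: mem_reg power2_eq_square)
  have g1: "deriv g z = - deriv f z / (f z)^2" if "z \<in> ball p r - {p}" for z
    using d1[OF that] by (rule DERIV_imp_deriv)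
  have g2: "deriv (deriv g) z = 2 - 3/2 * g2 * g z^2 - 2 * g3 * g z^3" if z: "z \<in> ball p r - {p}" for z
  proof -
    have nz: "f z \<noteq> 0" "\<not> is_pole f z" using r(2)[OF z] by (auto simp: mem_reg)
    have "((\<lambda>z. - deriv f z / (f z)^2) has_field_derivative
            - (6 * f z ^ 2 - g2 / 2) / (f z)^2 + 2 * (deriv f z)^2 / (f z)^3) (at z)"
      using nz by (auto intro!: derivative_eq_intros DERIV1 DERIV2 simp: field_simps power2_eq_square power3_eq_cube)
    hence "(deriv g has_field_derivative - (6 * f z ^ 2 - g2 / 2) / (f z)^2 + 2 * (deriv f z)^2 / (f z)^3) (at z)"
      by (rule has_field_derivative_transform_within_open[of _ _ _ "ball p r - {p}"]) (use z g1 in auto)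
    hence "deriv (deriv g) z = - (6 * f z ^ 2 - g2 / 2) / (f z)^2 + 2 * (deriv f z)^2 / (f z)^3"
      by (rule DERIV_imp_deriv)
    also have "\<dots> = 2 - 3/2 * g2 * g z^2 - 2 * g3 * g z^3"
      unfolding ode[OF nz(2)] g_def using nz(1) by (simp add: field_simps power2_eq_square power3_eq_cube)
    finally show ?thesis .
  qed
  \<comment> \<open>The first order equation becomes \<open>(g')^2 = 4 g - g2 g^3 - g3 g^4\<close>,
    whose right side vanishes with \<open>g\<close> at \<open>p\<close>.\<close>
  have "deriv g p = 0"
  proof -
    have "(deriv g p)^2 - (4 * g p - g2 * g p^3 - g3 * g p^4) = 0"
    proof (rule ext[of "\<lambda>z. (deriv g z)^2 - (4 * g z - g2 * g z^3 - g3 * g z^4)"])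
      fix z assume z: "z \<in> ball p r - {p}"
      have nz: "f z \<noteq> 0" "\<not> is_pole f z" using r(2)[OF z] by (auto simp: mem_reg)
      have "(deriv g z)^2 = (deriv f z)^2 / f z ^ 4" unfolding g1[OF z] by (simp add: power_divide)
      also have "\<dots> = 4 * (1 / f z) - g2 * (1 / f z)^3 - g3 * (1 / f z)^4"
        unfolding ode[OF nz(2)] using nz(1) by (simp add: field_simps eval_nat_numeral)
      finally show "(deriv g z)^2 - (4 * g z - g2 * g z^3 - g3 * g z^4) = 0"
        by (simp add: g_def)
    qed (intro holomorphic_intros hol holomorphic_deriv open_ball)
    thus ?thesis by (simp add: gp)
  qed
  moreover have "deriv (deriv g) z = 2 - 3/2 * g2 * g z^2 - 2 * g3 * g z^3" if "z \<in> ball p r" for z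
  proof (cases "z = p")
    case True
    have "deriv (deriv g) p - (2 - 3/2 * g2 * g p^2 - 2 * g3 * g p^3) = 0"
      by (rule ext[of "\<lambda>z. deriv (deriv g) z - (2 - 3/2 * g2 * g z^2 - 2 * g3 * g z^3)"])
         (use g2 in \<open>auto intro!: holomorphic_intros hol holomorphic_deriv\<close>)
    thus ?thesis using True by simp
  qed (use that g2 in auto)
  ultimately show thesis using that[of r] r(1) hol by (simp add: g_def)
qed

end

text \<open>The common regular set is connected because its complement is countable, so the identity
  theorem applies there. The poles then coincide as well, and at poles both functions are 0.\<close>

lemma weierstrass_ode_identity:
  assumes "weierstrass_ode g2 g3 f" "weierstrass_ode g2 g3 h"
    and T: "open T" "T \<noteq> {}" "\<And>z. z \<in> T \<Longrightarrow> f z = h z"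
  shows "f = h"
proof -
  interpret f: weierstrass_ode g2 g3 f by fact
  interpret h: weierstrass_ode g2 g3 h by fact
  define S where "S = f.reg \<inter> h.reg"
  have "open S" by (simp add: S_def f.open_reg h.open_reg open_Int)
  have S': "S = UNIV - ({z. is_pole f z} \<union> {z. is_pole h z})" by (auto simp: S_def f.mem_reg h.mem_reg)
  have "connected S" unfolding S'
    by (rule connected_open_diff_countable) (auto simp: f.countable_poles h.countable_poles)
  have "open (T \<inter> S)" using T \<open>open S\<close> by auto
  \<comment> \<open>A nonempty open set is uncountable and cannot consist of poles only.\<close>
  have "T \<inter> S \<noteq> {}"
  proof
    assume "T \<inter> S = {}"
    hence "T \<subseteq> {z. is_pole f z} \<union> {z. is_pole h z}" by (auto simp: S')
    moreover have "countable ({z. is_pole f z} \<union> {z. is_pole h z})"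
      using f.countable_poles h.countable_poles by simp
    ultimately have "countable T" by (rule countable_subset)
    thus False using T(1,2) by (meson countable_subset open_contains_ball ex_in_conv uncountable_ball)
  qed
  have eq: "f z = h z" if "z \<in> S" for z
  proof (rule analytic_continuation_open[of "T \<inter> S" S f h])
    show "f holomorphic_on S" "h holomorphic_on S"
      by (rule holomorphic_on_subset[OF f.holomorphic], simp add: S_def)
         (rule holomorphic_on_subset[OF h.holomorphic], simp add: S_def)
  qed (use \<open>open (T \<inter> S)\<close> \<open>T \<inter> S \<noteq> {}\<close> \<open>open S\<close> \<open>connected S\<close> T(3) that in blast)+
  \<comment> \<open>The two functions agree on a punctured neighbourhood of a pole of one that is
    regular for the other, and being a pole depends only on such a neighbourhood.\<close>
  have pole: "is_pole h2 p" if W: "weierstrass_ode g2 g3 h1" "weierstrass_ode g2 g3 h2" "is_pole h1 p"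
    "\<And>z. \<not> is_pole h1 z \<Longrightarrow> \<not> is_pole h2 z \<Longrightarrow> h1 z = h2 z" for h1 h2 p
  proof (rule ccontr)
    interpret u: weierstrass_ode g2 g3 h1 by fact
    interpret v: weierstrass_ode g2 g3 h2 by fact
    assume np: "\<not> is_pole h2 p"
    hence "eventually (\<lambda>z. z \<in> v.reg) (at p)"
      using v.open_reg by (intro eventually_at_in_open') (auto simp: v.mem_reg)
    hence "eventually (\<lambda>z. h1 z = h2 z) (at p)" using u.eventually_large[OF W(3), of 0]
      by eventually_elim (use W(4) in \<open>auto simp: u.mem_reg v.mem_reg\<close>)
    hence "is_pole h1 p \<longleftrightarrow> is_pole h2 p" by (intro is_pole_cong) auto
    thus False using np W(3) by simp
  qed
  show ?thesis
  proof
    fix z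
    have "is_pole f z \<longleftrightarrow> is_pole h z"
      using pole[of f h z] pole[of h f z] assms eq by (auto simp: S')
    thus "f z = h z" using eq[of z] f.at_pole[of z] h.at_pole[of z] by (auto simp: S')
  qed
qed

lemma weierstrass_ode_unique_pole:
  assumes "weierstrass_ode g2 g3 f" "weierstrass_ode g2 g3 h" "is_pole f 0" "is_pole h 0"
  shows "f = h"
proof -
  interpret f: weierstrass_ode g2 g3 f by fact
  interpret h: weierstrass_ode g2 g3 h by fact
  define F H where "F = (\<lambda>z. 1 / f z)" and "H = (\<lambda>z. 1 / h z)"
  obtain r1 where r1: "r1 > 0" "F holomorphic_on ball 0 r1" "deriv F 0 = 0"
    "\<And>z. z \<in> ball 0 r1 \<Longrightarrow> deriv (deriv F) z = 2 - 3/2 * g2 * F z^2 - 2 * g3 * F z^3"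
    using f.reciprocal[OF assms(3)] unfolding F_def by metis
  obtain r2 where r2: "r2 > 0" "H holomorphic_on ball 0 r2" "deriv H 0 = 0"
    "\<And>z. z \<in> ball 0 r2 \<Longrightarrow> deriv (deriv H) z = 2 - 3/2 * g2 * H z^2 - 2 * g3 * H z^3"
    using h.reciprocal[OF assms(4)] unfolding H_def by metis
  define r where "r = min r1 r2"
  have F: "F holomorphic_on ball 0 r" and H: "H holomorphic_on ball 0 r"
    using r1(2) r2(2) by (auto simp: r_def intro: holomorphic_on_subset)
  have deriv1: "deriv (\<lambda>z. F z - H z) z = deriv F z - deriv H z" if "z \<in> ball 0 r" for z
    using that F H by (intro deriv_diff) (auto intro: holomorphic_on_imp_differentiable_at)
  have deriv2: "deriv (deriv (\<lambda>z. F z - H z)) z = deriv (deriv F) z - deriv (deriv H) z" if "z \<in> ball 0 r" for z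
  proof -
    have "deriv (deriv (\<lambda>z. F z - H z)) z = deriv (\<lambda>z. deriv F z - deriv H z) z"
      by (rule deriv_cong_ev) (use eventually_nhds_in_open[OF open_ball that] deriv1 in \<open>auto elim: eventually_mono\<close>)
    also have "\<dots> = deriv (deriv F) z - deriv (deriv H) z"
      using that F H by (intro deriv_diff)
        (auto intro!: holomorphic_on_imp_differentiable_at[OF holomorphic_deriv])
    finally show ?thesis .
  qed
  \<comment> \<open>Factoring \<open>F^2 - H^2\<close> and \<open>F^3 - H^3\<close> in the
    difference of the two nonlinear equations leaves a linear equation for \<open>F - H\<close> with
    a continuous coefficient.\<close>
  have "F z - H z = 0" if "z \<in> ball 0 r" for z
  proof (rule holomorphic_linear_ode_zero[where r=r and z=z and d="\<lambda>z. F z - H z" and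
        R="\<lambda>z. - 3/2 * g2 * (F z + H z) - 2 * g3 * (F z ^ 2 + F z * H z + H z ^ 2)"])
    show "deriv (deriv (\<lambda>z. F z - H z)) z =
        (- 3/2 * g2 * (F z + H z) - 2 * g3 * (F z ^ 2 + F z * H z + H z ^ 2)) * (F z - H z)" if "z \<in> ball 0 r" for z
    proof -
      have "z \<in> ball 0 r1" "z \<in> ball 0 r2" using that by (auto simp: r_def)
      thus ?thesis unfolding deriv2[OF that] by (simp only: r1(4) r2(4))
         (simp add: algebra_simps power2_eq_square power3_eq_cube add_divide_distrib diff_divide_distrib)
    qed
    show "continuous_on (ball 0 r) (\<lambda>z. - 3/2 * g2 * (F z + H z) - 2 * g3 * (F z ^ 2 + F z * H z + H z ^ 2))"
      by (intro continuous_intros holomorphic_on_imp_continuous_on F H)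
  qed (use that F H r1 r2 deriv1 f.at_pole[OF assms(3)] h.at_pole[OF assms(4)] in
      \<open>auto intro!: holomorphic_intros simp: r_def F_def H_def\<close>)
  hence "f z = h z" if "z \<in> ball 0 r" for z using that by (simp add: F_def H_def) 
  thus ?thesis
    by (intro weierstrass_ode_identity[OF assms(1,2), of "ball 0 r"]) (use r1 r2 in \<open>auto simp: r_def\<close>)
qed

text \<open>At a regular point the equation \<open>f'' = 6 f^2 - g2 / 2\<close> can be used
  directly; the difference of two solutions satisfies a linear equation with coefficient
  \<open>6 * (f + h)\<close>.\<close>

lemma weierstrass_ode_unique_regular:
  assumes "weierstrass_ode g2 g3 f" "weierstrass_ode g2 g3 h" "\<not> is_pole f 0" "\<not> is_pole h 0"
    and "f 0 = h 0" "deriv f 0 = deriv h 0"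
  shows "f = h"
proof -
  interpret f: weierstrass_ode g2 g3 f by fact
  interpret h: weierstrass_ode g2 g3 h by fact
  have "open (f.reg \<inter> h.reg)" "0 \<in> f.reg \<inter> h.reg"
    using assms by (auto simp: f.open_reg h.open_reg f.mem_reg h.mem_reg)
  then obtain r where r: "r > 0" "ball 0 r \<subseteq> f.reg \<inter> h.reg"
    by (meson open_contains_ball)
  have F: "f holomorphic_on ball 0 r" and H: "h holomorphic_on ball 0 r"
    using r f.holomorphic h.holomorphic by (auto intro: holomorphic_on_subset)
  have np: "\<not> is_pole f z" "\<not> is_pole h z" if "z \<in> ball 0 r" for z
    using r that by (auto simp: f.mem_reg h.mem_reg)
  have deriv1: "deriv (\<lambda>z. f z - h z) z = deriv f z - deriv h z" if "z \<in> ball 0 r" for z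
    using that F H by (intro deriv_diff) (auto intro: holomorphic_on_imp_differentiable_at)
  have deriv2: "deriv (deriv (\<lambda>z. f z - h z)) z = deriv (deriv f) z - deriv (deriv h) z" if "z \<in> ball 0 r" for z
  proof -
    have "deriv (deriv (\<lambda>z. f z - h z)) z = deriv (\<lambda>z. deriv f z - deriv h z) z"
      by (rule deriv_cong_ev) (use eventually_nhds_in_open[OF open_ball that] deriv1 in \<open>auto elim: eventually_mono\<close>)
    also have "\<dots> = deriv (deriv f) z - deriv (deriv h) z"
      using that F H by (intro deriv_diff)
        (auto intro!: holomorphic_on_imp_differentiable_at[OF holomorphic_deriv])
    finally show ?thesis .
  qed
  have "f z - h z = 0" if "z \<in> ball 0 r" for z
  proof (rule holomorphic_linear_ode_zero[where r=r and z=z and d="\<lambda>z. f z - h z" and R="\<lambda>z. 6 * (f z + h z)"])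
    show "deriv (deriv (\<lambda>z. f z - h z)) z = 6 * (f z + h z) * (f z - h z)" if "z \<in> ball 0 r" for z
      unfolding deriv2[OF that] f.deriv_deriv[OF np(1)[OF that]] h.deriv_deriv[OF np(2)[OF that]]
      by (simp add: algebra_simps power2_eq_square)
    show "continuous_on (ball 0 r) (\<lambda>z. 6 * (f z + h z))"
      by (intro continuous_intros holomorphic_on_imp_continuous_on F H)
  qed (use that F H assms deriv1[of 0] r in \<open>auto intro!: holomorphic_intros\<close>)
  thus ?thesis
    by (intro weierstrass_ode_identity[OF assms(1,2), of "ball 0 r"]) (use r in auto)
qed

section \<open>Transfer of the Weierstrass equation along affine maps and conjugation\<close>

lemma DERIV_zero_imp_constant:
  fixes f :: "complex \<Rightarrow> complex"
  assumes "connected S" "open S" "\<And>z. z \<in> S \<Longrightarrow> (f has_field_derivative 0) (at z)"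
  obtains c where "\<And>z. z \<in> S \<Longrightarrow> f z = c"
proof -
  have "continuous_on S f" using assms(3) by (intro continuous_at_imp_continuous_on ballI DERIV_isCont) blast
  thus thesis using DERIV_zero_connected_constant[OF assms(1,2) finite.emptyI, of f] assms(3) that by blast
qed

lemma filterlim_at_isCont:
  assumes "isCont g p" "\<And>x. x \<noteq> p \<Longrightarrow> g x \<noteq> g p"
  shows "filterlim g (at (g p)) (at p)"
  unfolding filterlim_at using assms by (simp add: isCont_def eventually_at_filter)

lemma is_pole_affine:
  fixes f :: "complex \<Rightarrow> complex" and s c p :: complex
  assumes "s \<noteq> 0"
  shows "is_pole (\<lambda>z. f (s * z + c)) p \<longleftrightarrow> is_pole f (s * p + c)"
proof -
  have *: "is_pole (\<lambda>z. f (s * z + c)) p" if "is_pole f (s * p + c)" "s \<noteq> 0"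
    for f :: "complex \<Rightarrow> complex" and s c p :: complex
    unfolding is_pole_def
  proof (rule filterlim_compose[OF that(1)[unfolded is_pole_def]])
    show "filterlim (\<lambda>z. s * z + c) (at (s * p + c)) (at p)"
      using filterlim_at_isCont[of p "\<lambda>z. s * z + c"] that(2) by simp
  qed
  show ?thesis
  proof
    assume "is_pole (\<lambda>z. f (s * z + c)) p"
    moreover have "inverse s * (s * p + c) + - c / s = p" using assms by (simp add: field_simps)
    ultimately have "is_pole (\<lambda>z. f (s * (inverse s * z + - c / s) + c)) (s * p + c)"
      using *[of "\<lambda>z. f (s * z + c)" "inverse s" "s * p + c" "- c / s"] assms by simp
    moreover have "s * (inverse s * z + - c / s) + c = z" for z using assms by (simp add: field_simps)
    ultimately show "is_pole f (s * p + c)" by simp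
  qed (rule *[OF _ assms])
qed

lemma is_pole_cnj:
  fixes f :: "complex \<Rightarrow> complex"
  shows "is_pole (\<lambda>z. cnj (f (cnj z))) p \<longleftrightarrow> is_pole f (cnj p)"
proof -
  have *: "is_pole (\<lambda>z. cnj (f (cnj z))) p" if "is_pole f (cnj p)" for f p
  proof -
    have "filterlim cnj (at (cnj p)) (at p)"
      by (intro filterlim_at_isCont continuous_intros) auto
    hence "filterlim (\<lambda>z. f (cnj z)) at_infinity (at p)"
      by (rule filterlim_compose[OF that[unfolded is_pole_def]])
    thus ?thesis by (simp add: is_pole_def filterlim_at_infinity_conv_norm_at_top)
  qed
  show ?thesis using *[of f p] *[of "\<lambda>z. cnj (f (cnj z))" "cnj p"] by auto
qed

text \<open>The derivative enters the equation only through its square, so a factor \<open>s\<close>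
  with \<open>s^2 = 1\<close> drops out. With \<open>s = 1\<close> this yields periodicity, with
  \<open>s = - 1\<close> evenness.\<close>

lemma weierstrass_ode_affine:
  assumes "weierstrass_ode g2 g3 f" and s: "s^2 = 1"
  shows "weierstrass_ode g2 g3 (\<lambda>z. f (s * z + c))"
proof -
  interpret weierstrass_ode g2 g3 f by fact
  have s0: "s \<noteq> 0" using s by auto
  have pole: "is_pole (\<lambda>z. f (s * z + c)) p \<longleftrightarrow> is_pole f (s * p + c)" for p
    by (rule is_pole_affine[OF s0])
  have D: "((\<lambda>z. f (s * z + c)) has_field_derivative deriv f (s * z + c) * s) (at z)"
    if "\<not> is_pole f (s * z + c)" for z
    by (rule DERIV_chain2[where f=f and g="\<lambda>z. s * z + c", OF DERIV1[OF that]]) (auto intro!: derivative_eq_intros)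
  show ?thesis
  proof
    show "closed {z. is_pole (\<lambda>z. f (s * z + c)) z}"
      using continuous_closed_vimage[OF closed_poles, of "\<lambda>z. s * z + c"] unfolding pole by (simp add: vimage_def)
    have "inj (\<lambda>z. s * z + c)" using s0 by (auto simp: inj_def)
    from countable_image_inj[OF countable_poles this] show "countable {z. is_pole (\<lambda>z. f (s * z + c)) z}"
      unfolding pole by simp
    show "(\<lambda>z. f (s * z + c)) field_differentiable at z" if "\<not> is_pole (\<lambda>z. f (s * z + c)) z" for z
      using D that unfolding pole field_differentiable_def by blast
    show "f (s * z + c) = 0" if "is_pole (\<lambda>z. f (s * z + c)) z" for z
      using at_pole that unfolding pole by blast
    show "(deriv (\<lambda>z. f (s * z + c)) z)\<^sup>2 = 4 * f (s * z + c) ^ 3 - g2 * f (s * z + c) - g3"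
      if "\<not> is_pole (\<lambda>z. f (s * z + c)) z" for z
      using DERIV_imp_deriv[OF D, of z] ode[of "s * z + c"] that s unfolding pole by (simp add: power_mult_distrib)
    obtain p where "is_pole f p" using ex_pole by blast
    thus "\<exists>z. is_pole (\<lambda>z. f (s * z + c)) z" unfolding pole using s0 by (intro exI[of _ "(p - c) / s"]) simp
  qed
qed

lemma weierstrass_ode_cnj:
  assumes "weierstrass_ode g2 g3 f"
  shows "weierstrass_ode (cnj g2) (cnj g3) (\<lambda>z. cnj (f (cnj z)))"
proof -
  interpret weierstrass_ode g2 g3 f by fact
  have D: "((\<lambda>z. cnj (f (cnj z))) has_field_derivative cnj (deriv f (cnj z))) (at z)"
    if "\<not> is_pole f (cnj z)" for z
    using has_field_derivative_cnj_cnj[of f "deriv f (cnj z)" z] DERIV1[OF that] by (simp add: o_def)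
  show ?thesis
  proof
    show "closed {z. is_pole (\<lambda>z. cnj (f (cnj z))) z}"
      using continuous_closed_vimage[OF closed_poles, of cnj] unfolding is_pole_cnj by (simp add: vimage_def continuous_cnj)
    have "inj cnj" by (auto simp: inj_def)
    from countable_image_inj[OF countable_poles this] show "countable {z. is_pole (\<lambda>z. cnj (f (cnj z))) z}"
      unfolding is_pole_cnj by simp
    show "(\<lambda>z. cnj (f (cnj z))) field_differentiable at z" if "\<not> is_pole (\<lambda>z. cnj (f (cnj z))) z" for z
      using D that unfolding is_pole_cnj field_differentiable_def by blast
    show "cnj (f (cnj z)) = 0" if "is_pole (\<lambda>z. cnj (f (cnj z))) z" for z
      using at_pole that unfolding is_pole_cnj by simp
    show "(deriv (\<lambda>z. cnj (f (cnj z))) z)\<^sup>2 = 4 * cnj (f (cnj z)) ^ 3 - cnj g2 * cnj (f (cnj z)) - cnj g3"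
      if "\<not> is_pole (\<lambda>z. cnj (f (cnj z))) z" for z
      using DERIV_imp_deriv[OF D, of z] arg_cong[OF ode[of "cnj z"], of cnj] that unfolding is_pole_cnj by simp
    show "\<exists>z. is_pole (\<lambda>z. cnj (f (cnj z))) z" unfolding is_pole_cnj using ex_pole by (metis complex_cnj_cnj)
  qed
qed

section \<open>The Weierstrass functions, their periods and the addition law of zeta\<close>

locale weierstrass =
  fixes g2 g3 :: complex and wp zt sg :: "complex \<Rightarrow> complex"
  assumes weierstrass: "weierstrass_functions g2 g3 wp zt sg"
begin

lemma pole_0: "is_pole wp 0"
proof -
  have lim: "((\<lambda>z. z^2 * wp z) \<longlongrightarrow> 1) (at 0)" using weierstrass by (simp add: weierstrass_functions_def)
  have "filterlim (\<lambda>z::complex. z^2) (at (0^2)) (at 0)"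
    by (intro filterlim_at_isCont continuous_intros) auto
  hence fl: "filterlim (\<lambda>z. (z^2 * wp z) / z^2) at_infinity (at 0)"
    by (intro filterlim_divide_at_infinity[OF lim]) (auto simp: filterlim_at)
  have ev: "eventually (\<lambda>z. (z^2 * wp z) / z^2 = wp z) (at 0)" by (simp add: eventually_at_filter)
  show ?thesis unfolding is_pole_def using filterlim_cong[OF refl refl ev] fl by (rule iffD1)
qed

sublocale weierstrass_ode g2 g3 wp
proof
  have nm: "wp nicely_meromorphic_on UNIV" using weierstrass by (simp add: weierstrass_functions_def)
  hence sp: "{z. is_pole wp z} sparse_in UNIV"
    using meromorphic_on_imp_not_pole_cosparse[of wp UNIV] by (simp add: nicely_meromorphic_on_def eventually_cosparse)
  show "closed {z. is_pole wp z}" using sp by (rule sparse_in_UNIV_imp_closed)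
  show "countable {z. is_pole wp z}" using sparse_imp_countable[OF open_UNIV sp] by simp
  show "wp field_differentiable at z" if "\<not> is_pole wp z" for z
    using nicely_meromorphic_on_imp_analytic_at[OF nm _ that] analytic_on_imp_differentiable_at by blast
  show "wp z = 0" if "is_pole wp z" for z
    using nm that unfolding nicely_meromorphic_on_def is_pole_def
    by (metis UNIV_I not_tendsto_and_filterlim_at_infinity trivial_limit_at)
  show "(deriv wp z)\<^sup>2 = 4 * wp z ^ 3 - g2 * wp z - g3" if "\<not> is_pole wp z" for z
    using weierstrass that by (simp add: weierstrass_functions_def)
  show "\<exists>z. is_pole wp z" using pole_0 by blast
qed

lemma ode_locale: "weierstrass_ode g2 g3 wp" by unfold_locales

definition periods :: "complex set" where "periods = {w. \<forall>z. wp (z + w) = wp z}"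

lemma periods_add: "u \<in> periods \<Longrightarrow> v \<in> periods \<Longrightarrow> u + v \<in> periods"
  by (simp add: periods_def add.assoc[symmetric])

lemma periods_minus: "u \<in> periods \<Longrightarrow> - u \<in> periods"
  unfolding periods_def by clarsimp (metis add.commute diff_add_cancel uminus_add_conv_diff)

lemma periods_diff: "u \<in> periods \<Longrightarrow> v \<in> periods \<Longrightarrow> u - v \<in> periods"
  using periods_add periods_minus by fastforce

lemma zero_period [simp]: "0 \<in> periods" by (simp add: periods_def)

lemma minus_periods_iff [simp]: "- u \<in> periods \<longleftrightarrow> u \<in> periods"
  using periods_minus by fastforce

lemma is_pole_iff: "is_pole wp z \<longleftrightarrow> z \<in> periods"
proof
  assume "is_pole wp z"
  have "(\<lambda>u. wp (1 * u + z)) = wp"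
    by (rule weierstrass_ode_unique_pole[OF weierstrass_ode_affine[OF ode_locale] ode_locale])
       (use \<open>is_pole wp z\<close> pole_0 is_pole_affine[of 1 wp z 0] in auto)
  thus "z \<in> periods" unfolding periods_def by (simp add: fun_eq_iff)
next
  assume "z \<in> periods"
  hence "(\<lambda>u. wp (1 * u + z)) = wp" by (simp add: periods_def)
  thus "is_pole wp z" using pole_0 is_pole_affine[of 1 wp z 0] by simp
qed

lemma even: "wp (- z) = wp z"
proof -
  have "(\<lambda>u. wp ((-1) * u + 0)) = wp"
    by (rule weierstrass_ode_unique_pole[OF weierstrass_ode_affine[OF ode_locale] ode_locale])
       (use pole_0 is_pole_affine[of "-1" wp 0 0] in auto)
  thus ?thesis by (simp add: fun_eq_iff)
qed

lemma D1: "z \<notin> periods \<Longrightarrow> (wp has_field_derivative deriv wp z) (at z)"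
  using DERIV1 is_pole_iff by blast

lemma D2: "z \<notin> periods \<Longrightarrow> (deriv wp has_field_derivative 6 * wp z ^ 2 - g2 / 2) (at z)"
  using DERIV2 is_pole_iff by blast

lemma odd_deriv: "z \<notin> periods \<Longrightarrow> deriv wp (- z) = - deriv wp z"
proof -
  assume z: "z \<notin> periods"
  have "((\<lambda>z. wp (- z)) has_field_derivative deriv wp (- z) * (-1)) (at z)"
    by (rule DERIV_chain2[where f=wp and g=uminus, OF D1]) (use z in \<open>auto intro!: derivative_eq_intros\<close>)
  hence "(wp has_field_derivative - deriv wp (- z)) (at z)" by (simp add: even)
  thus ?thesis using DERIV_imp_deriv by fastforce
qed

lemma D1_shift: "z + w \<notin> periods \<Longrightarrow> ((\<lambda>z. wp (z + w)) has_field_derivative deriv wp (z + w)) (at z)"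
  using D1 DERIV_shift by blast

lemma deriv_periodic:
  assumes "w \<in> periods" "z \<notin> periods"
  shows "deriv wp (z + w) = deriv wp z"
proof -
  have "z + w \<notin> periods" using periods_diff[of "z + w" w] assms by auto
  from DERIV_imp_deriv[OF D1_shift[OF this]] show ?thesis using assms by (simp add: periods_def)
qed

text \<open>The translates of \<open>wp\<close> by \<open>z\<close> and by \<open>w\<close> have the
  same initial data at 0 and hence coincide.\<close>

lemma eq_imp_period:
  assumes "z \<notin> periods" "w \<notin> periods" "wp z = wp w" "deriv wp z = deriv wp w"
  shows "z - w \<in> periods"
proof -
  have D: "deriv (\<lambda>u. wp (1 * u + v)) 0 = deriv wp v" if "v \<notin> periods" for v
  proof -
    have "0 + v \<notin> periods" using that by simp
    from DERIV_imp_deriv[OF D1_shift[OF this]] show ?thesis by (simp only: mult_1_left add_0_left)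
  qed
  have "(\<lambda>u. wp (1 * u + z)) = (\<lambda>u. wp (1 * u + w))"
    by (rule weierstrass_ode_unique_regular[OF weierstrass_ode_affine[OF ode_locale] weierstrass_ode_affine[OF ode_locale]])
       (use assms D is_pole_affine[of 1 wp z 0] is_pole_affine[of 1 wp w 0] is_pole_iff in auto)
  hence "wp (u + z) = wp (u + w)" for u by (simp add: fun_eq_iff)
  hence "wp (u + (z - w)) = wp u" for u
    by (metis add.commute add_diff_eq diff_add_cancel)
  thus ?thesis by (simp add: periods_def)
qed

text \<open>The first order equation determines \<open>deriv wp\<close> up to sign, and the sign is
  absorbed by passing from \<open>w\<close> to \<open>- w\<close>.\<close>

lemma eq_cases:
  assumes "z \<notin> periods" "w \<notin> periods" "wp z = wp w"
  shows "z - w \<in> periods \<or> z + w \<in> periods"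
proof -
  have "(deriv wp z)^2 = (deriv wp w)^2" using ode[of z] ode[of w] assms by (simp add: is_pole_iff)
  hence "deriv wp z = deriv wp w \<or> deriv wp z = deriv wp (- w)" using odd_deriv[OF assms(2)] by (simp add: power2_eq_iff)
  thus ?thesis using eq_imp_period[of z w] eq_imp_period[of z "-w"] assms by (auto simp: even)
qed

lemma closed_periods: "closed periods" and countable_periods: "countable periods"
  using closed_poles countable_poles by (simp_all add: is_pole_iff)

lemma DZ: "z \<notin> periods \<Longrightarrow> (zt has_field_derivative - wp z) (at z)"
  using weierstrass by (simp add: weierstrass_functions_def is_pole_iff)

lemma zt_lim: "((\<lambda>z. zt z - 1 / z) \<longlongrightarrow> 0) (at 0)"
  using weierstrass by (simp add: weierstrass_functions_def)

lemma sg_nz: "z \<notin> periods \<Longrightarrow> sg z \<noteq> 0"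
  using weierstrass by (simp add: weierstrass_functions_def is_pole_iff)

lemma DS: "z \<notin> periods \<Longrightarrow> (sg has_field_derivative zt z * sg z) (at z)"
proof -
  assume z: "z \<notin> periods"
  hence "deriv sg z / sg z = zt z" "sg holomorphic_on UNIV"
    using weierstrass by (simp_all add: weierstrass_functions_def is_pole_iff)
  thus ?thesis using sg_nz[OF z] holomorphic_derivI[of sg UNIV z] by (simp add: field_simps)
qed

lemma eventually_not_period: "eventually (\<lambda>z. z \<notin> periods) (at 0)"
  using eventually_large[OF pole_0, of 0] by eventually_elim (auto simp: mem_reg is_pole_iff)

text \<open>The sum of the two sides of the reflection has derivative 0 on the connected complement
  of the periods, and the normalization of \<open>zt\<close> at 0 makes the constant vanish.\<close>

lemma zt_odd: "z \<notin> periods \<Longrightarrow> zt (- z) = - zt z"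
proof -
  assume z: "z \<notin> periods"
  have conn: "connected (- periods)"
    using connected_reg by (simp add: reg_def is_pole_iff)
  have D: "((\<lambda>z. zt z + zt (- z)) has_field_derivative 0) (at z)" if "z \<in> - periods" for z
  proof -
    have "((\<lambda>z. zt (- z)) has_field_derivative (- wp (- z)) * (- 1)) (at z)"
      by (rule DERIV_chain2[where f=zt and g=uminus, OF DZ]) (use that in \<open>auto intro!: derivative_eq_intros\<close>)
    from DERIV_add[OF DZ this] show ?thesis using that by (simp add: even)
  qed
  obtain c where c: "\<And>z. z \<in> - periods \<Longrightarrow> zt z + zt (- z) = c"
    using DERIV_zero_imp_constant[OF conn open_Compl[OF closed_periods] D] by blast
  have "((\<lambda>z. (zt z - 1 / z) + (zt (- z) - 1 / (- z))) \<longlongrightarrow> 0 + 0) (at 0)"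
  proof (intro tendsto_add zt_lim filterlim_compose[OF zt_lim])
    show "filterlim uminus (at 0) (at (0::complex))"
      using filterlim_at_isCont[where g=uminus and p="0::complex"] by simp
  qed
  hence "((\<lambda>z. zt z + zt (- z)) \<longlongrightarrow> 0) (at 0)" by simp
  moreover have "((\<lambda>z. zt z + zt (- z)) \<longlongrightarrow> c) (at 0)"
    by (rule tendsto_eventually) (use eventually_not_period c in \<open>auto elim: eventually_mono\<close>)
  ultimately have "c = 0" by (metis LIM_unique)
  thus ?thesis using c[of z] z by (simp add: add_eq_0_iff)
qed

text \<open>The function \<open>z^2 * wp z\<close> is even, so its holomorphic extension
  \<open>h\<close> has derivative 0 at 0 and the quotient is \<open>- 1 / z\<close> plus a term
  tending to 0. In the addition law \<open>A\<close> and \<open>B\<close> are the values of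
  \<open>deriv wp\<close> and \<open>wp\<close> at \<open>k - z\<close>.\<close>

lemma quotient_limit:
  assumes A: "isCont A 0" and B: "isCont B 0"
  shows "((\<lambda>z. zt z + (deriv wp z - A z) / (wp z - B z) / 2) \<longlongrightarrow> 0) (at 0)"
proof -
  have lim: "((\<lambda>z. z^2 * wp z) \<longlongrightarrow> 1) (at 0)" using weierstrass by (simp add: weierstrass_functions_def)
  define h where "h = (\<lambda>z. if z = 0 then 1 else z^2 * wp z)"
  obtain r where r: "r > 0" "\<And>z. z \<in> ball 0 r - {0} \<Longrightarrow> z \<notin> periods"
    using eventually_not_period unfolding eventually_at by (force simp: dist_commute)
  have hlim: "(h \<longlongrightarrow> h 0) (at 0)"
    using Lim_transform_eventually[OF lim, of h] by (simp add: h_def eventually_at_filter)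
  have "(\<lambda>z. z^2 * wp z) holomorphic_on ball 0 r - {0}"
  proof (intro holomorphic_intros holomorphic_on_subset[OF holomorphic])
    show "ball 0 r - {0} \<subseteq> reg" using r(2) is_pole_iff mem_reg by blast
  qed
  hence "h holomorphic_on ball 0 r - {0}"
    by (rule holomorphic_transform) (auto simp: h_def)
  hence h: "h holomorphic_on ball 0 r"
    by (rule no_isolated_singularity'[rotated]) (use hlim in \<open>auto intro: tendsto_within_subset\<close>)
  have Dh: "(h has_field_derivative deriv h z) (at z)" if "z \<in> ball 0 r" for z
    using holomorphic_derivI[OF h _ that] by simp
  have "deriv h 0 = 0"
  proof -
    have "h (- z) = h z" for z by (simp add: h_def even)
    moreover have "((\<lambda>z. h (- z)) has_field_derivative deriv h 0 * (-1)) (at 0)"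
      by (rule DERIV_chain2[where f=h]) (use r(1) Dh[of 0] in \<open>auto intro!: derivative_eq_intros\<close>)
    ultimately have "(h has_field_derivative - deriv h 0) (at 0)" by simp
    from DERIV_unique[OF this Dh[of 0]] r(1) show ?thesis by simp
  qed
  moreover have "isCont (deriv h) 0"
    using holomorphic_on_imp_continuous_on[OF holomorphic_deriv[OF h open_ball]] r(1)
    by (meson centre_in_ball continuous_on_eq_continuous_at open_ball)
  ultimately have dh: "(deriv h \<longlongrightarrow> 0) (at 0)" by (simp add: isCont_def)
  have h1: "(h \<longlongrightarrow> 1) (at 0)" using hlim by (simp add: h_def)
  have A': "(A \<longlongrightarrow> A 0) (at 0)" and B': "(B \<longlongrightarrow> B 0) (at 0)" using A B by (simp_all add: isCont_def)
  have den: "((\<lambda>z. h z - B z * z^2) \<longlongrightarrow> 1) (at 0)" by (auto intro!: tendsto_eq_intros h1 B')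
  have "((\<lambda>z. (deriv h z / 2 - A z * z^2 / 2 - B z * z) / (h z - B z * z^2)) \<longlongrightarrow> 0) (at 0)"
    by (rule tendsto_eq_rhs[OF tendsto_divide[OF _ den]]) (auto intro!: tendsto_eq_intros dh A' B')
  hence "((\<lambda>z. (zt z - 1 / z) + (deriv h z / 2 - A z * z^2 / 2 - B z * z) / (h z - B z * z^2)) \<longlongrightarrow> 0 + 0) (at 0)"
    by (intro tendsto_add zt_lim)
  moreover have "eventually (\<lambda>z. (zt z - 1 / z) + (deriv h z / 2 - A z * z^2 / 2 - B z * z) / (h z - B z * z^2)
        = zt z + (deriv wp z - A z) / (wp z - B z) / 2) (at 0)"
  proof -
    have "eventually (\<lambda>z. z \<in> ball 0 r - {0}) (at (0::complex))"
      using eventually_at_ball'[OF r(1), of 0 UNIV] by eventually_elim auto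
    moreover have "eventually (\<lambda>z. h z - B z * z^2 \<noteq> 0) (at 0)"
      by (rule tendsto_imp_eventually_ne[OF den]) simp
    ultimately show ?thesis
    proof eventually_elim
      case (elim z)
      have z: "z \<noteq> 0" "z \<notin> periods" using elim r(2) by auto
      have hz: "h z = z^2 * wp z" using z by (simp add: h_def)
      have "((\<lambda>z. z^2 * wp z) has_field_derivative 2 * z * wp z + z^2 * deriv wp z) (at z)"
        by (auto intro!: derivative_eq_intros D1 z)
      hence "(h has_field_derivative 2 * z * wp z + z^2 * deriv wp z) (at z)"
        by (rule has_field_derivative_transform_within_open[of _ _ _ "-{0}"]) (use z in \<open>auto simp: h_def\<close>)
      hence dhz: "deriv h z = 2 * z * wp z + z^2 * deriv wp z" by (rule DERIV_imp_deriv)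
      have nz: "wp z - B z \<noteq> 0" using elim z by (auto simp: hz)
      have den: "h z - B z * z^2 = z^2 * (wp z - B z)" by (simp add: hz algebra_simps)
      show ?case unfolding den dhz using z nz
        by (simp add: divide_simps) (simp add: algebra_simps power2_eq_square)
    qed
  qed
  ultimately show ?thesis using Lim_transform_eventually by fastforce
qed

theorem zt_add:
  assumes "u \<notin> periods" "v \<notin> periods" "wp u \<noteq> wp v"
  shows "zt (u + v) = zt u + zt v + (deriv wp u - deriv wp v) / (wp u - wp v) / 2"
proof -
  define k where "k = u + v"
  have k: "k \<notin> periods"
  proof
    assume "k \<in> periods"
    hence "wp (- u + k) = wp (- u)" unfolding periods_def by blast
    thus False using assms by (simp add: k_def even)
  qed
  \<comment> \<open>Points with \<open>wp z = wp (k - z)\<close> would spoil the quotient; by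
    \<open>eq_cases\<close> they satisfy \<open>2 * z - k \<in> periods\<close>, the other
    alternative being \<open>k \<in> periods\<close>. Only countable closed sets are removed, so
    \<open>D\<close> is open and connected.\<close>
  define D where "D = {z. z \<notin> periods \<and> k - z \<notin> periods \<and> 2 * z - k \<notin> periods}"
  have D_eq: "D = UNIV - (periods \<union> {z. k - z \<in> periods} \<union> {z. 2 * z - k \<in> periods})" by (auto simp: D_def)
  have "closed {z. k - z \<in> periods}" "closed {z. 2 * z - k \<in> periods}"
    using continuous_closed_vimage[OF closed_periods, of "\<lambda>z. k - z"]
      continuous_closed_vimage[OF closed_periods, of "\<lambda>z. 2 * z - k"] by (simp_all add: vimage_def)
  hence "open D" unfolding D_eq using closed_periods by (intro open_Diff closed_Un) auto
  have "countable {z. k - z \<in> periods}" "countable {z. 2 * z - k \<in> periods}"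
    by (intro countable_image_inj countable_periods; simp add: inj_def)+
  hence "connected D" unfolding D_eq using countable_periods
    by (intro connected_open_diff_countable) (auto simp: connected_UNIV)
  define G where "G = (\<lambda>z. zt z + zt (k - z) + (deriv wp z - deriv wp (k - z)) / (wp z - wp (k - z)) / 2)"
  have ne: "wp z \<noteq> wp (k - z)" if "z \<in> D" for z
    using that eq_cases[of z "k - z"] k by (auto simp: D_def algebra_simps)
  have DG: "(G has_field_derivative 0) (at z)" if z: "z \<in> D" for z
  proof -
    define p q p' q' where "p = wp z" "q = wp (k - z)" "p' = deriv wp z" "q' = deriv wp (k - z)"
    note defs = p_q_p'_q'_def
    have np: "z \<notin> periods" "k - z \<notin> periods" using z by (auto simp: D_def)
    have lin: "((\<lambda>z. k - z) has_field_derivative - 1) (at z)" by (auto intro!: derivative_eq_intros)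
    have 1: "((\<lambda>z. zt (k - z)) has_field_derivative q) (at z)"
      using DERIV_chain2[where f="zt" and g="\<lambda>z. k - z", OF DZ[OF np(2)] lin] by (simp add: defs)
    have 2: "((\<lambda>z. wp (k - z)) has_field_derivative - q') (at z)"
      using DERIV_chain2[where f="wp" and g="\<lambda>z. k - z", OF D1[OF np(2)] lin] by (simp add: defs)
    have 3: "((\<lambda>z. deriv wp (k - z)) has_field_derivative - (6 * q^2 - g2 / 2)) (at z)"
      using DERIV_chain2[where f="deriv wp" and g="\<lambda>z. k - z", OF D2[OF np(2)] lin] by (simp add: defs)
    have pq: "p - q \<noteq> 0" using ne[OF z] by (simp add: defs)
    have "((\<lambda>z. (deriv wp z - deriv wp (k - z)) / (wp z - wp (k - z))) has_field_derivative
            (((6 * p^2 - g2 / 2) + (6 * q^2 - g2 / 2)) * (p - q) - (p' - q') * (p' + q')) / ((p - q) * (p - q))) (at z)"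
      using np pq by (auto intro!: derivative_eq_intros D1 D2 2 3 simp: defs)
    from DERIV_add[OF DERIV_add[OF DZ[OF np(1)] 1] DERIV_cdivide[OF this, of 2]]
    have "(G has_field_derivative - p + q + (((6 * p^2 - g2 / 2) + (6 * q^2 - g2 / 2)) * (p - q)
            - (p' - q') * (p' + q')) / ((p - q) * (p - q)) / 2) (at z)"
      unfolding G_def by (simp only: defs)
    \<comment> \<open>In the difference of the two first order equations \<open>g3\<close> cancels
      and \<open>p - q\<close> splits off.\<close>
    moreover have "(p' - q') * (p' + q') = (4 * (p^2 + p * q + q^2) - g2) * (p - q)"
    proof -
      have "p'^2 - q'^2 = (4 * p^3 - g2 * p - g3) - (4 * q^3 - g2 * q - g3)"
        using ode[of z] ode[of "k - z"] np by (simp add: defs is_pole_iff)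
      thus ?thesis by (simp add: algebra_simps power2_eq_square power3_eq_cube)
    qed
    hence "((6 * p^2 - g2 / 2) + (6 * q^2 - g2 / 2)) * (p - q) - (p' - q') * (p' + q') = 2 * (p - q) * ((p - q) * (p - q))"
      by (simp only:) (simp add: algebra_simps power2_eq_square)
    ultimately have "(G has_field_derivative - p + q + 2 * (p - q) / 2) (at z)" using pq by simp
    moreover have "- p + q + 2 * (p - q) / 2 = 0" by (simp add: field_simps)
    ultimately show ?thesis by (simp only:)
  qed
  obtain c where c: "\<And>z. z \<in> D \<Longrightarrow> G z = c"
    using DERIV_zero_imp_constant[OF \<open>connected D\<close> \<open>open D\<close> DG] by blast
  have cont: "isCont (\<lambda>z. F (k - z)) 0" if "isCont F k" for F :: "complex \<Rightarrow> complex"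
    using isCont_o2[where f="\<lambda>z. k - z" and a=0 and g=F] that by simp
  \<comment> \<open>As \<open>z\<close> tends to 0 the polar parts cancel by
    \<open>quotient_limit\<close> and only \<open>zt k\<close> is left, which identifies the
    constant.\<close>
  have "((\<lambda>z. (zt z + (deriv wp z - deriv wp (k - z)) / (wp z - wp (k - z)) / 2) + zt (k - z)) \<longlongrightarrow> 0 + zt k) (at 0)"
    using cont[of zt] DERIV_isCont[OF DZ[OF k]]
    by (intro tendsto_add quotient_limit cont DERIV_isCont[OF D1[OF k]] DERIV_isCont[OF D2[OF k]]) (simp add: isCont_def)
  hence "(G \<longlongrightarrow> zt k) (at 0)" by (simp add: G_def add_ac)
  moreover have "(G \<longlongrightarrow> c) (at 0)"
  proof (rule tendsto_eventually)
    have o: "open (- periods)" using closed_periods by (simp add: open_Compl)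
    have "eventually (\<lambda>z. k - z \<in> - periods) (at 0)"
      by (rule topological_tendstoD[OF _ o, of _ k]) (auto intro!: tendsto_eq_intros simp: k)
    moreover have "eventually (\<lambda>z. 2 * z - k \<in> - periods) (at 0)"
      by (rule topological_tendstoD[OF _ o, of _ "-k"]) (auto intro!: tendsto_eq_intros simp: k)
    ultimately show "eventually (\<lambda>z. G z = c) (at 0)"
      using eventually_not_period by eventually_elim (auto intro!: c simp: D_def)
  qed
  ultimately have "c = zt k" by (metis LIM_unique)
  moreover have "u \<in> D"
    using assms k by (auto simp: D_def k_def periods_def) (metis add.commute diff_add_cancel)
  ultimately have "G u = zt k" using c by blast
  thus ?thesis by (simp add: G_def k_def algebra_simps)
qed

end

section \<open>Lame's equation and the real structure\<close>

text \<open>A continuous coefficient is bounded on each compact interval, which reduces the claim to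
  \<open>second_order_gronwall_zero\<close>; negative times are reflected.\<close>

lemma second_order_linear_zero:
  fixes u v r :: "real \<Rightarrow> complex"
  assumes u: "\<And>t. (u has_vector_derivative v t) (at t)"
    and v: "\<And>t. (v has_vector_derivative r t * u t) (at t)"
    and r: "continuous_on UNIV r" and "u 0 = 0" "v 0 = 0"
  shows "u t = 0"
proof -
  have pos: "u t = 0"
    if u: "\<And>t. (u has_vector_derivative v t) (at t)"
      and v: "\<And>t. (v has_vector_derivative r t * u t) (at t)"
      and r: "continuous_on UNIV r" and 0: "u 0 = 0" "v 0 = 0" and t: "0 \<le> t" for u v r :: "real \<Rightarrow> complex" and t
  proof -
    have "compact (r ` {0..t})"
      by (intro compact_continuous_image continuous_on_subset[OF r]) auto
    then obtain M where M: "\<And>s. s \<in> {0..t} \<Longrightarrow> norm (r s) \<le> M"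
      by (meson bounded_iff compact_imp_bounded imageI)
    show ?thesis
    proof (rule second_order_gronwall_zero[where T=t and M=M and u=u and v=v and v'="\<lambda>t. r t * u t"])
      show "norm (r s * u s) \<le> M * norm (u s)" if "0 \<le> s" "s \<le> t" for s
        using M[of s] that by (simp add: norm_mult mult_right_mono)
    qed (use u v 0 t in \<open>auto intro: has_vector_derivative_at_within\<close>)
  qed
  have refl: "((\<lambda>t. f (- t)) has_vector_derivative - f') (at t)"
    if "(f has_vector_derivative f') (at (- t))" for f :: "real \<Rightarrow> complex" and f' t
    using vector_diff_chain_at[OF has_vector_derivative_minus[OF has_vector_derivative_id], of f f' t] that
    by (simp add: o_def)
  show ?thesis
  proof (cases "t \<ge> 0")
    case False
    have "u (- (- t)) = 0"
    proof (rule pos[of "\<lambda>t. u (- t)" "\<lambda>t. - v (- t)" "\<lambda>t. r (- t)"])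
      show "((\<lambda>t. u (- t)) has_vector_derivative - v (- t)) (at t)" for t by (rule refl[OF u])
      show "((\<lambda>t. - v (- t)) has_vector_derivative r (- t) * u (- t)) (at t)" for t
        using has_vector_derivative_minus[OF refl[OF v[of "- t"]]] by simp
      show "continuous_on UNIV (\<lambda>t. r (- t))" by (intro continuous_on_compose2[OF r] continuous_intros) auto
    qed (use assms False in auto)
    thus ?thesis by simp
  qed (use pos assms in blast)
qed

lemma has_vector_derivative_affine:
  fixes f :: "complex \<Rightarrow> complex"
  assumes "(f has_field_derivative D) (at (of_real (\<kappa> * t) + x))"
  shows "((\<lambda>t. f (of_real (\<kappa> * t) + x)) has_vector_derivative of_real \<kappa> * D) (at t)"
proof -
  have "((\<lambda>w. f (of_real \<kappa> * w + x)) has_field_derivative D * of_real \<kappa>) (at (of_real t))"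
    by (rule DERIV_chain2[where f=f and g="\<lambda>w. of_real \<kappa> * w + x"])
       (use assms in \<open>auto intro!: derivative_eq_intros\<close>)
  from has_vector_derivative_real_field[OF this] show ?thesis by (simp add: mult.commute)
qed

section \<open>Solutions of Lame's equation\<close>

context weierstrass
begin

lemma wp_period: "w \<in> periods \<Longrightarrow> wp (z + w) = wp z"
  by (simp add: periods_def)

text \<open>This is the logarithmic derivative of \<open>lame_y\<close> in \<open>z\<close>, namely
  \<open>zt (z + x + s * \<mu>) - zt (z + x) - s * zt \<mu>\<close>, as collapsed by the addition
  law of zeta.\<close>

definition lame_phi :: "complex \<Rightarrow> complex \<Rightarrow> complex \<Rightarrow> complex \<Rightarrow> complex" where
  "lame_phi x s \<mu> z = (deriv wp (z + x) - s * deriv wp \<mu>) / (wp (z + x) - wp \<mu>) / 2"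

lemma DERIV_lame_y:
  assumes s: "s = 1 \<or> s = - 1" and "\<mu> \<notin> periods" "z + x \<notin> periods" "wp (z + x) \<noteq> wp \<mu>"
  shows "((\<lambda>z. lame_y zt sg x s z \<mu>) has_field_derivative lame_phi x s \<mu> z * lame_y zt sg x s z \<mu>) (at z)"
proof -
  have s\<mu>: "s * \<mu> \<notin> periods" "wp (s * \<mu>) = wp \<mu>" "zt (s * \<mu>) = s * zt \<mu>" "deriv wp (s * \<mu>) = s * deriv wp \<mu>"
    using s assms(2) even zt_odd odd_deriv by auto
  have np: "z + x + s * \<mu> \<notin> periods"
  proof
    assume "z + x + s * \<mu> \<in> periods"
    from wp_period[OF this, of "- (s * \<mu>)"]
    show False using assms s\<mu> by (simp add: even)
  qed
  have eq: "- s * zt \<mu> + zt (z + x + s * \<mu>) - zt (z + x) = lame_phi x s \<mu> z"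
    using zt_add[OF assms(3) s\<mu>(1)] assms(4) s\<mu> by (simp add: lame_phi_def)
  have 1: "((\<lambda>z. sg (z + x + s * \<mu>)) has_field_derivative zt (z + x + s * \<mu>) * sg (z + x + s * \<mu>)) (at z)"
    using DERIV_shift[of sg _ z "x + s * \<mu>"] DS[OF np] by (simp only: add.assoc)
  have 2: "((\<lambda>z. sg (z + x)) has_field_derivative zt (z + x) * sg (z + x)) (at z)"
    using DERIV_shift[of sg _ z x] DS[OF assms(3)] by (simp only:)
  have 3: "((\<lambda>z. exp (- s * z * zt \<mu>)) has_field_derivative (- s * zt \<mu>) * exp (- s * z * zt \<mu>)) (at z)"
    by (auto intro!: derivative_eq_intros)
  have nz: "sg (z + x) \<noteq> 0" using sg_nz assms by blast
  define K where "K = sg x / sg (x + s * \<mu>)"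
  have y: "lame_y zt sg x s z \<mu> = exp (- s * z * zt \<mu>) * sg (z + x + s * \<mu>) / sg (z + x) * K" for z
    by (simp add: lame_y_def K_def)
  have "((\<lambda>z. lame_y zt sg x s z \<mu>) has_field_derivative
      (- s * zt \<mu> + zt (z + x + s * \<mu>) - zt (z + x)) * lame_y zt sg x s z \<mu>) (at z)"
    unfolding y
    by (rule DERIV_cong[OF DERIV_cmult_right[OF DERIV_divide[OF DERIV_mult[OF 3 1] 2 nz], of K]])
       (use nz in \<open>simp add: field_simps\<close>)
  thus ?thesis unfolding eq .
qed

text \<open>The Riccati equation that Lame's equation imposes on a logarithmic derivative. It holds
  because \<open>wp (z + x)\<close> and \<open>wp \<mu>\<close> both obey the first order equation;
  the sign \<open>s\<close> disappears in the square of \<open>deriv wp \<mu>\<close>.\<close>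

lemma DERIV_lame_phi:
  assumes s: "s = 1 \<or> s = - 1" and "\<mu> \<notin> periods" "z + x \<notin> periods" "wp (z + x) \<noteq> wp \<mu>"
  shows "(lame_phi x s \<mu> has_field_derivative 2 * wp (z + x) + wp \<mu> - (lame_phi x s \<mu> z)^2) (at z)"
proof -
  define p m p' m' where "p = wp (z + x)" "m = wp \<mu>" "p' = deriv wp (z + x)" "m' = s * deriv wp \<mu>"
  note defs = p_m_p'_m'_def
  have pm: "p - m \<noteq> 0" using assms by (simp add: defs)
  have 1: "((\<lambda>z. wp (z + x)) has_field_derivative p') (at z)" using D1_shift[OF assms(3)] by (simp add: defs)
  have 2: "((\<lambda>z. deriv wp (z + x)) has_field_derivative 6 * p^2 - g2 / 2) (at z)"
    using DERIV_shift[of "deriv wp" _ z x] D2[OF assms(3)] by (simp only: defs)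
  have "((\<lambda>z. (deriv wp (z + x) - m') / (wp (z + x) - m)) has_field_derivative
      ((6 * p^2 - g2 / 2) * (p - m) - (p' - m') * p') / ((p - m) * (p - m))) (at z)"
    using pm by (auto intro!: derivative_eq_intros 1 2 simp: defs)
  from DERIV_cdivide[OF this, of 2]
  have "(lame_phi x s \<mu> has_field_derivative ((6 * p^2 - g2 / 2) * (p - m) - (p' - m') * p') / ((p - m) * (p - m)) / 2) (at z)"
    unfolding lame_phi_def by (simp only: defs)
  moreover have "((6 * p^2 - g2 / 2) * (p - m) - (p' - m') * p') / ((p - m) * (p - m)) / 2
      = 2 * p + m - ((p' - m') / (p - m) / 2)^2"
  proof -
    have o: "p'^2 = 4 * p^3 - g2 * p - g3" "m'^2 = 4 * m^3 - g2 * m - g3"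
      using ode[of "z + x"] ode[of \<mu>] assms by (auto simp: defs is_pole_iff)
    have "2 * ((6 * p^2 - g2 / 2) * (p - m) - (p' - m') * p') + (p' - m')^2 = 4 * (2 * p + m) * ((p - m) * (p - m))"
    proof -
      have "2 * ((6 * p^2 - g2 / 2) * (p - m) - (p' - m') * p') + (p' - m')^2
          = 2 * (6 * p^2 - g2 / 2) * (p - m) - p'^2 + m'^2"
        by (simp add: algebra_simps power2_eq_square diff_divide_distrib)
      also have "\<dots> = 4 * (2 * p + m) * ((p - m) * (p - m))"
        unfolding o by (simp add: algebra_simps diff_divide_distrib power2_eq_square power3_eq_cube)
      finally show ?thesis .
    qed
    moreover have "X / (d * d) / 2 = k - (q / d / 2)^2" if "2 * X + q^2 = 4 * k * (d * d)" "d \<noteq> 0" for X d k q :: complex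
    proof -
      have X: "X = (4 * k * (d * d) - q^2) / 2" using that(1) by (simp add: field_simps)
      show ?thesis unfolding X using that(2) by (simp add: divide_simps power2_eq_square)
    qed
    ultimately show ?thesis using pm by blast
  qed
  ultimately show ?thesis by (simp only: lame_phi_def defs)
qed

text \<open>Both Lame functions are 1 at time 0, and their logarithmic derivatives there differ by
  \<open>- deriv wp \<mu> / (wp x - wp \<mu>)\<close>, so the condition
  \<open>deriv wp \<mu> \<noteq> 0\<close> makes them independent. Solving the two initial
  conditions for the coefficients gives \<open>C\<close>; uniqueness for the linear equation
  concludes.\<close>

theorem lame_solution:
  fixes u u1 :: "real \<Rightarrow> complex" and \<kappa> :: real
  assumes \<kappa>: "\<kappa> \<noteq> 0"
    and u: "\<And>t. (u has_vector_derivative u1 t) (at t)"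
    and u1: "\<And>t. (u1 has_vector_derivative of_real (\<kappa>^2) * (2 * wp (of_real (\<kappa> * t) + x) + wp \<mu>) * u t) (at t)"
    and np: "\<And>t. of_real (\<kappa> * t) + x \<notin> periods" and ne: "\<And>t. wp (of_real (\<kappa> * t) + x) \<noteq> wp \<mu>"
    and \<mu>: "\<mu> \<notin> periods" "deriv wp \<mu> \<noteq> 0"
  defines "C \<equiv> \<lambda>s. 1/2 * lame_M wp x s \<mu> * u 0 - s * lame_N wp x \<mu> * (u1 0 / of_real \<kappa>)"
  shows "u t = C 1 * lame_y zt sg x 1 (of_real (\<kappa> * t)) \<mu> + C (- 1) * lame_y zt sg x (- 1) (of_real (\<kappa> * t)) \<mu>"
proof -
  define y where "y = (\<lambda>s t. lame_y zt sg x s (of_real (\<kappa> * t)) \<mu>)"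
  define \<phi> where "\<phi> = (\<lambda>s t. lame_phi x s \<mu> (of_real (\<kappa> * t)))"
  define R where "R = (\<lambda>t. of_real (\<kappa>^2) * (2 * wp (of_real (\<kappa> * t) + x) + wp \<mu>))"
  have y': "(y s has_vector_derivative of_real \<kappa> * (\<phi> s t * y s t)) (at t)" if "s = 1 \<or> s = - 1" for s t
    using has_vector_derivative_affine[where x=0, OF DERIV_lame_y[OF that \<mu>(1)]] np ne by (simp add: y_def \<phi>_def)
  have \<phi>': "(\<phi> s has_vector_derivative of_real \<kappa> * (2 * wp (of_real (\<kappa> * t) + x) + wp \<mu> - (\<phi> s t)^2)) (at t)"
    if "s = 1 \<or> s = - 1" for s t
    using has_vector_derivative_affine[where x=0, OF DERIV_lame_phi[OF that \<mu>(1)]] np ne by (simp add: \<phi>_def)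
  have y'': "((\<lambda>t. of_real \<kappa> * (\<phi> s t * y s t)) has_vector_derivative R t * y s t) (at t)" if "s = 1 \<or> s = - 1" for s t
    by (rule has_vector_derivative_eq_rhs,
        rule has_vector_derivative_mult[OF has_vector_derivative_const has_vector_derivative_mult[OF \<phi>'[OF that] y'[OF that]]])
       (simp add: R_def algebra_simps power2_eq_square)
  define w where "w = (\<lambda>t. u t - (C 1 * y 1 t + C (- 1) * y (- 1) t))"
  define w1 where "w1 = (\<lambda>t. u1 t - (C 1 * (of_real \<kappa> * (\<phi> 1 t * y 1 t)) + C (- 1) * (of_real \<kappa> * (\<phi> (- 1) t * y (- 1) t))))"
  have "w t = 0"
  proof (rule second_order_linear_zero[where u=w and v=w1 and r=R])
    show "(w has_vector_derivative w1 t) (at t)" for t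
      unfolding w_def w1_def by (auto intro!: derivative_eq_intros u y')
    show "(w1 has_vector_derivative R t * w t) (at t)" for t
    proof -
      have 1: "(u1 has_vector_derivative R t * u t) (at t)" using u1 by (simp add: R_def)
      show ?thesis unfolding w_def w1_def
        by (rule has_vector_derivative_eq_rhs,
            rule has_vector_derivative_diff[OF 1 has_vector_derivative_add[OF
              has_vector_derivative_mult[OF has_vector_derivative_const y''[of 1]]
              has_vector_derivative_mult[OF has_vector_derivative_const y''[of "- 1"]]]])
           (auto simp: algebra_simps)
    qed
    have "continuous_on UNIV (\<lambda>t. wp (of_real (\<kappa> * t) + x))"
      by (rule continuous_on_vector_derivative[OF has_vector_derivative_affine[OF D1[OF np]]])
    thus "continuous_on UNIV R" unfolding R_def by (intro continuous_intros)
    have x: "x \<notin> periods" "wp x \<noteq> wp \<mu>" using np[of 0] ne[of 0] by auto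
    have nz: "sg x \<noteq> 0" "sg (x + s * \<mu>) \<noteq> 0" if "s = 1 \<or> s = - 1" for s
    proof -
      show "sg x \<noteq> 0" using sg_nz x by blast
      have "x + s * \<mu> \<notin> periods"
      proof
        assume "x + s * \<mu> \<in> periods"
        from wp_period[OF this, of "- (s * \<mu>)"] show False using x that by (auto simp: even)
      qed
      thus "sg (x + s * \<mu>) \<noteq> 0" by (rule sg_nz)
    qed
    have y0: "y 1 0 = 1" "y (- 1) 0 = 1" using nz[of 1] nz[of "-1"] by (simp_all add: y_def lame_y_def)
    define p p' m' where "p = wp x - wp \<mu>" and "p' = deriv wp x" and "m' = deriv wp \<mu>"
    have nz': "p \<noteq> 0" "m' \<noteq> 0" using x \<mu> by (simp_all add: p_def m'_def)
    have \<phi>0: "\<phi> 1 0 = (p' - m') / p / 2" "\<phi> (- 1) 0 = (p' + m') / p / 2"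
      by (simp_all add: \<phi>_def lame_phi_def p_def p'_def m'_def)
    have C: "C 1 = 1/2 * (1 + p' / m') * u 0 - p / m' * (u1 0 / of_real \<kappa>)"
      "C (- 1) = 1/2 * (1 - p' / m') * u 0 + p / m' * (u1 0 / of_real \<kappa>)"
      by (simp_all add: C_def lame_M_def lame_N_def p_def p'_def m'_def algebra_simps diff_divide_distrib)
    show "w 0 = 0" by (simp add: w_def y0 C algebra_simps add_divide_distrib diff_divide_distrib)
    show "w1 0 = 0" unfolding w1_def y0 \<phi>0 C using nz' \<kappa> by (simp add: field_simps)
  qed
  thus ?thesis by (simp add: w_def y_def)
qed

end

section \<open>Real invariants: values on the real axis and on the line through
  \<open>\<omega>2\<close>\<close>

lemma Im_vector_derivative_0:
  assumes "(f has_vector_derivative D) (at t)" "\<And>s::real. Im (f s) = 0"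
  shows "Im D = 0"
proof -
  have "((\<lambda>s. Im (f s)) has_vector_derivative Im D) (at t)"
    using bounded_linear.has_vector_derivative[OF bounded_linear_Im assms(1)] .
  moreover have "((\<lambda>s. Im (f s)) has_vector_derivative 0) (at t)" using assms(2) by simp
  ultimately show ?thesis using vector_derivative_unique_at by blast
qed

locale weierstrass_real = weierstrass "of_real g2" "of_real g3" wp zt sg
  for g2 g3 :: real and wp zt sg +
  fixes \<omega>1 \<omega>2 :: complex and e1 e2 e3 :: real
  assumes roots: "{Y::complex. 4 * Y^3 - of_real g2 * Y - of_real g3 = 0} = {of_real e1, of_real e2, of_real e3}"
    and order: "e1 > e2" "e2 > e3"
    and half_periods: "fundamental_half_periods wp \<omega>1 \<omega>2"
    and \<omega>: "Re \<omega>1 > 0" "Im \<omega>1 = 0" "Re \<omega>2 = 0" "Im \<omega>2 > 0"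
begin

lemma periods_iff: "z \<in> periods \<longleftrightarrow> (\<exists>m n. Re z = real_of_int m * (2 * Re \<omega>1) \<and> Im z = real_of_int n * (2 * Im \<omega>2))"
proof -
  have "periods = {of_int m * (2 * \<omega>1) + of_int n * (2 * \<omega>2) | m n. True}"
    using half_periods by (simp add: fundamental_half_periods_def periods_def)
  thus ?thesis using \<omega> by (auto simp: complex_eq_iff)
qed

lemma not_period: "0 < \<bar>Re z\<bar> \<and> \<bar>Re z\<bar> < 2 * Re \<omega>1 \<or> 0 < \<bar>Im z\<bar> \<and> \<bar>Im z\<bar> < 2 * Im \<omega>2 \<Longrightarrow> z \<notin> periods"
proof -
  have *: "\<not> (0 < \<bar>real_of_int m * p\<bar> \<and> \<bar>real_of_int m * p\<bar> < p)" if "p > 0" for m p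
  proof
    assume a: "0 < \<bar>real_of_int m * p\<bar> \<and> \<bar>real_of_int m * p\<bar> < p"
    hence "m \<noteq> 0" by auto
    hence "1 * p \<le> \<bar>real_of_int m\<bar> * p" using that by (intro mult_right_mono) linarith+
    thus False using a that by (simp add: abs_mult)
  qed
  show "0 < \<bar>Re z\<bar> \<and> \<bar>Re z\<bar> < 2 * Re \<omega>1 \<or> 0 < \<bar>Im z\<bar> \<and> \<bar>Im z\<bar> < 2 * Im \<omega>2 \<Longrightarrow> z \<notin> periods"
    unfolding periods_iff using *[of "2 * Re \<omega>1"] *[of "2 * Im \<omega>2"] \<omega> by fastforce
qed

lemma twice_half_periods: "2 * \<omega>1 \<in> periods" "2 * \<omega>2 \<in> periods"
proof -
  show "2 * \<omega>1 \<in> periods" unfolding periods_iff by (rule exI[of _ 1], rule exI[of _ 0]) (simp add: \<omega>)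
  show "2 * \<omega>2 \<in> periods" unfolding periods_iff by (rule exI[of _ 0], rule exI[of _ 1]) (simp add: \<omega>)
qed

lemma wp_cnj: "wp (cnj z) = cnj (wp z)"
proof -
  have "(\<lambda>z. cnj (wp (cnj z))) = wp"
    by (rule weierstrass_ode_unique_pole[OF _ ode_locale])
       (use weierstrass_ode_cnj[OF ode_locale] pole_0 in \<open>auto simp: is_pole_cnj\<close>)
  from fun_cong[OF this, of z] show ?thesis by (metis complex_cnj_cnj)
qed

lemma Im_wp_real: "Im (wp (of_real s)) = 0"
  using arg_cong[OF wp_cnj[of "of_real s"], of Im] by simp

text \<open>Conjugation carries the line to its mirror image, which is its translate by the period
  \<open>- 2 * \<omega>2\<close>.\<close>

lemma Im_wp_line: "Im (wp (of_real s + \<omega>2)) = 0"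
proof -
  have "cnj (of_real s + \<omega>2) = of_real s - \<omega>2" using \<omega> by (simp add: complex_eq_iff)
  hence "cnj (wp (of_real s + \<omega>2)) = wp (of_real s - \<omega>2)" by (metis wp_cnj)
  also have "\<dots> = wp (of_real s - \<omega>2 + 2 * \<omega>2)" by (rule wp_period[OF twice_half_periods(2), symmetric])
  also have "of_real s - \<omega>2 + 2 * \<omega>2 = of_real s + \<omega>2" by simp
  finally show ?thesis by (simp add: complex_eq_iff)
qed

lemma line_not_period: "of_real s + \<omega>2 \<notin> periods"
  by (rule not_period) (use \<omega> in auto)

text \<open>The hypothesis gives only the set of roots. Subtracting the equations of two distinct
  roots and dividing by their difference gives Vieta's relations, and these give the
  factorization.\<close>

lemma factor: "4 * Y^3 - g2 * Y - g3 = 4 * (Y - e1) * (Y - e2) * (Y - e3)"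
proof -
  have r: "4 * e^3 - g2 * e - g3 = 0" if "e \<in> {e1, e2, e3}" for e
  proof -
    have "complex_of_real e \<in> {Y::complex. 4 * Y^3 - of_real g2 * Y - of_real g3 = 0}"
      unfolding roots using that by auto
    hence "complex_of_real (4 * e^3 - g2 * e - g3) = 0" by simp
    thus ?thesis by (simp only: of_real_eq_0_iff)
  qed
  have r1: "4 * e1^3 - g2 * e1 - g3 = 0" and r2: "4 * e2^3 - g2 * e2 - g3 = 0" and r3: "4 * e3^3 - g2 * e3 - g3 = 0"
    by (rule r; simp)+
  have g2a: "g2 = 4 * (e1^2 + e1 * e2 + e2^2)"
  proof -
    have "(e1 - e2) * (4 * (e1^2 + e1 * e2 + e2^2) - g2) = 0"
      using r1 r2 by (simp add: algebra_simps power2_eq_square power3_eq_cube)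
    thus ?thesis using order by simp
  qed
  have g2b: "g2 = 4 * (e2^2 + e2 * e3 + e3^2)"
  proof -
    have "(e2 - e3) * (4 * (e2^2 + e2 * e3 + e3^2) - g2) = 0"
      using r3 r2 by (simp add: algebra_simps power2_eq_square power3_eq_cube)
    thus ?thesis using order by simp
  qed
  have s: "e3 = - e1 - e2"
  proof -
    have "(e1 - e3) * (e1 + e2 + e3) = 0"
      using g2a g2b by (simp add: algebra_simps power2_eq_square)
    thus ?thesis using order by simp
  qed
  have g3: "g3 = 4 * e1^3 - g2 * e1" using r1 by simp
  show ?thesis unfolding g3 g2a s by (simp add: algebra_simps power2_eq_square power3_eq_cube)
qed

text \<open>A half period is congruent to its negative, where the odd derivative changes sign; so
  the derivative vanishes and the first order equation becomes the cubic.\<close>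

lemma wp_half_period:
  assumes "w \<notin> periods" "2 * w \<in> periods"
  shows "deriv wp w = 0" "wp w \<in> {of_real e1, of_real e2, of_real e3}"
proof -
  have "deriv wp w = deriv wp (- w + 2 * w)" by simp
  also have "\<dots> = deriv wp (- w)" using assms by (intro deriv_periodic) auto
  also have "\<dots> = - deriv wp w" using odd_deriv assms by blast
  finally show *: "deriv wp w = 0" by simp
  show "wp w \<in> {of_real e1, of_real e2, of_real e3}"
    using ode[of w] assms * unfolding roots[symmetric] by (simp add: is_pole_iff)
qed

lemma half_periods_not_period: "\<omega>1 \<notin> periods" "\<omega>2 \<notin> periods" "\<omega>1 + \<omega>2 \<notin> periods"
  by (rule not_period; use \<omega> in simp)+

text \<open>Between 0 and \<open>2 * \<omega>1\<close> the derivative is real, so the cubic is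
  nonnegative and \<open>wp\<close> avoids the gap between \<open>e2\<close> and \<open>e1\<close>.
  Near the pole the value is at least \<open>e1\<close>, and by continuity it cannot cross the gap
  on the way to \<open>\<omega>1\<close>.\<close>

lemma wp_\<omega>1: "wp \<omega>1 = of_real e1"
proof -
  define W where "W = (\<lambda>s::real. Re (wp (of_real s)))"
  define T where "T = Re \<omega>1"
  have wpW: "wp (of_real s) = of_real (W s)" for s using Im_wp_real by (simp add: W_def complex_eq_iff)
  have T: "\<omega>1 = of_real T" "T > 0" using \<omega> by (simp_all add: T_def complex_eq_iff)
  have np: "of_real s \<notin> periods" if "0 < s" "s < 2 * T" for s using that by (intro not_period) (simp add: T_def)
  have cont: "continuous_on {s0..T} W" if "s0 > 0" for s0
  proof (intro continuous_at_imp_continuous_on ballI)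
    fix s assume "s \<in> {s0..T}"
    hence "of_real s \<notin> periods" using that T by (intro np) auto
    from has_vector_derivative_continuous[OF has_vector_derivative_real_field[OF D1[OF this]]]
    show "isCont W s" unfolding W_def by (rule continuous_Re)
  qed
  have nonneg: "(W s - e1) * (W s - e2) * (W s - e3) \<ge> 0" if s: "0 < s" "s < 2 * T" for s
  proof -
    have "Im (deriv wp (of_real s)) = 0"
      by (rule Im_vector_derivative_0[OF has_vector_derivative_real_field[OF D1[OF np[OF s]]] Im_wp_real])
    then obtain d where d: "deriv wp (of_real s) = of_real d" by (metis complex_is_Real_iff Reals_cases)
    have "of_real (d^2) = (of_real (4 * W s ^ 3 - g2 * W s - g3) :: complex)"
      using ode[of "of_real s"] np[OF s] by (simp add: is_pole_iff d wpW)
    hence "d^2 = 4 * W s ^ 3 - g2 * W s - g3" by (simp only: of_real_eq_iff)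
    hence "0 \<le> 4 * ((W s - e1) * (W s - e2) * (W s - e3))" unfolding factor by (metis mult.assoc zero_le_power2)
    thus ?thesis by simp
  qed
  have "wp \<omega>1 \<in> {of_real e1, of_real e2, of_real e3}"
    using wp_half_period half_periods_not_period twice_half_periods by blast
  hence WT: "W T \<in> {e1, e2, e3}" unfolding T wpW by auto
  show ?thesis
  proof (rule ccontr)
    assume "wp \<omega>1 \<noteq> of_real e1"
    hence le: "W T \<le> e2" using WT order unfolding T wpW by auto
    \<comment> \<open>A real number of larger modulus than this lies above \<open>e2\<close> or
      below \<open>e3\<close>, hence outside the interval \<open>[e3, e2]\<close>, where the cubic
      is nonnegative as well.\<close>
    have "eventually (\<lambda>z. norm (wp z) > \<bar>e2\<bar> + \<bar>e3\<bar> \<and> z \<in> reg) (at 0)"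
      by (rule eventually_large[OF pole_0])
    then obtain d where d: "d > 0" "\<And>z. z \<noteq> 0 \<Longrightarrow> dist z 0 < d \<Longrightarrow> norm (wp z) > \<bar>e2\<bar> + \<bar>e3\<bar>"
      unfolding eventually_at by auto
    define s0 where "s0 = min (d / 2) (T / 2)"
    have s0: "0 < s0" "s0 < T" "s0 < d" using d T by (auto simp: s0_def)
    have large: "\<bar>W s0\<bar> > \<bar>e2\<bar> + \<bar>e3\<bar>" using d(2)[of "of_real s0"] s0 by (simp add: wpW)
    have "W s0 \<ge> e1"
    proof (rule ccontr)
      assume "\<not> W s0 \<ge> e1"
      moreover have "W s0 > e2 \<or> W s0 < e3" using large by linarith
      ultimately have "(W s0 - e1) * (W s0 - e2) * (W s0 - e3) < 0"
        using order by (auto simp: mult_less_0_iff zero_less_mult_iff)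
      thus False using nonneg[of s0] s0 by simp
    qed
    hence "\<exists>s. s0 \<le> s \<and> s \<le> T \<and> W s = (e1 + e2) / 2"
      using IVT2'[of W T "(e1 + e2) / 2" s0] le order s0 cont[of s0] by simp
    then obtain s where s: "s0 \<le> s" "s \<le> T" "W s = (e1 + e2) / 2" by blast
    have "(W s - e1) * (W s - e2) * (W s - e3) < 0"
      unfolding s(3) using order by (intro mult_neg_pos) (auto intro!: mult_neg_pos)
    thus False using nonneg[of s] s s0 T by simp
  qed
qed

text \<open>The derivative vanishes at all three half periods, so by \<open>eq_imp_period\<close>
  their values differ. As \<open>\<omega>1\<close> takes \<open>e1\<close>, the points
  \<open>\<omega>2\<close> and \<open>\<omega>1 + \<omega>2\<close> take \<open>e2\<close> and
  \<open>e3\<close> in one order or the other, and either order suffices for the intermediate value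
  theorem.\<close>

lemma wp_line_surj:
  assumes "e3 \<le> Y" "Y \<le> e2"
  shows "\<exists>s::real. wp (of_real s + \<omega>2) = of_real Y"
proof -
  define W where "W = (\<lambda>s::real. Re (wp (of_real s + \<omega>2)))"
  define T where "T = Re \<omega>1"
  have wpW: "wp (of_real s + \<omega>2) = of_real (W s)" for s using Im_wp_line by (simp add: W_def complex_eq_iff)
  have T: "\<omega>1 = of_real T" "T > 0" using \<omega> by (simp_all add: T_def complex_eq_iff)
  have cont: "continuous_on S W" for S
  proof (intro continuous_at_imp_continuous_on ballI)
    fix s
    have "wp field_differentiable at (of_real (1 * s) + \<omega>2)"
      using D1[OF line_not_period[of s]] by (auto simp: field_differentiable_def)
    then obtain D where "(wp has_field_derivative D) (at (of_real (1 * s) + \<omega>2))"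
      by (auto simp: field_differentiable_def)
    from has_vector_derivative_continuous[OF has_vector_derivative_affine[OF this]]
    show "isCont W s" unfolding W_def by (intro continuous_Re) (simp only: mult_1_left)
  qed
  have 12: "wp \<omega>2 \<noteq> wp \<omega>1" "wp (\<omega>1 + \<omega>2) \<noteq> wp \<omega>1" "wp (\<omega>1 + \<omega>2) \<noteq> wp \<omega>2"
  proof -
    have p3: "2 * (\<omega>1 + \<omega>2) \<in> periods" using periods_add[OF twice_half_periods] by (simp add: algebra_simps)
    note z = wp_half_period(1)[OF half_periods_not_period(1) twice_half_periods(1)]
      wp_half_period(1)[OF half_periods_not_period(2) twice_half_periods(2)]
      wp_half_period(1)[OF half_periods_not_period(3) p3]
    have "\<omega>2 - \<omega>1 \<notin> periods" by (rule not_period) (use \<omega> in simp)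
    thus "wp \<omega>2 \<noteq> wp \<omega>1" using eq_imp_period half_periods_not_period z by metis
    have "(\<omega>1 + \<omega>2) - \<omega>1 \<notin> periods" using half_periods_not_period by simp
    thus "wp (\<omega>1 + \<omega>2) \<noteq> wp \<omega>1" using eq_imp_period half_periods_not_period z by metis
    have "(\<omega>1 + \<omega>2) - \<omega>2 \<notin> periods" using half_periods_not_period by simp
    thus "wp (\<omega>1 + \<omega>2) \<noteq> wp \<omega>2" using eq_imp_period half_periods_not_period z by metis
  qed
  have p3: "2 * (\<omega>1 + \<omega>2) \<in> periods" using periods_add[OF twice_half_periods] by (simp add: algebra_simps)
  have "W 0 \<in> {e1, e2, e3}" "W T \<in> {e1, e2, e3}"
    using wp_half_period(2)[OF half_periods_not_period(2) twice_half_periods(2)]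
      wp_half_period(2)[OF half_periods_not_period(3) p3] wpW[of 0] wpW[of T] T(1) by auto
  moreover have "W 0 \<noteq> e1" "W T \<noteq> e1" "W 0 \<noteq> W T"
    using 12 wp_\<omega>1 wpW[of 0] wpW[of T] T(1) by auto
  ultimately consider "W 0 = e2" "W T = e3" | "W 0 = e3" "W T = e2" by auto
  hence "\<exists>s. W s = Y"
  proof cases
    case 1
    thus ?thesis using IVT2'[of W T Y 0] assms T cont by fastforce
  next
    case 2
    thus ?thesis using IVT'[of W 0 Y T] assms T cont by fastforce
  qed
  thus ?thesis using wpW by metis
qed

text \<open>Surjectivity on the line matches the value \<open>Y 0\<close>; the first order equation
  then matches the velocity up to sign, and a wrong sign is repaired by reflecting the line. From
  there the difference of \<open>Y\<close> and \<open>wp\<close> solves a linear second order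
  equation with zero initial data.\<close>

theorem ex_phase:
  fixes Y Y1 :: "real \<Rightarrow> real"
  assumes Y: "\<And>t. (Y has_real_derivative \<kappa> * Y1 t) (at t)"
    and Y1: "\<And>t. (Y1 has_real_derivative \<kappa> * (6 * Y t ^ 2 - g2 / 2)) (at t)"
    and init: "Y1 0 ^ 2 = 4 * Y 0 ^ 3 - g2 * Y 0 - g3" "e3 \<le> Y 0" "Y 0 \<le> e2"
  shows "\<exists>\<tau>0::real. \<forall>t. of_real (Y t) = wp (of_real (\<kappa> * t - \<tau>0) + \<omega>2)"
proof -
  obtain s where s: "wp (of_real s + \<omega>2) = of_real (Y 0)" using wp_line_surj init by metis
  have "\<exists>\<tau>0::real. wp (of_real (- \<tau>0) + \<omega>2) = of_real (Y 0) \<and> deriv wp (of_real (- \<tau>0) + \<omega>2) = of_real (Y1 0)"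
  proof -
    have "(deriv wp (of_real s + \<omega>2))^2 = (of_real (Y1 0))^2"
      using ode[of "of_real s + \<omega>2"] line_not_period[of s] arg_cong[OF init(1), of complex_of_real]
      by (simp add: is_pole_iff s)
    hence "deriv wp (of_real s + \<omega>2) = of_real (Y1 0) \<or> deriv wp (of_real s + \<omega>2) = - of_real (Y1 0)"
      by (simp add: power2_eq_iff)
    thus ?thesis
    proof
      assume "deriv wp (of_real s + \<omega>2) = - of_real (Y1 0)"
      \<comment> \<open>Reversing \<open>s\<close> is the reflection of the line at
        \<open>\<omega>2\<close>. Modulo the period \<open>2 * \<omega>2\<close> it replaces the
        argument by its negative, which keeps \<open>wp\<close> and flips its derivative.\<close>
      have eq: "of_real (- s) + \<omega>2 = - (of_real s + \<omega>2) + 2 * \<omega>2" by simp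
      have "wp (of_real (- s) + \<omega>2) = wp (- (of_real s + \<omega>2))"
        unfolding eq by (rule wp_period[OF twice_half_periods(2)])
      moreover have "deriv wp (of_real (- s) + \<omega>2) = deriv wp (- (of_real s + \<omega>2))"
        unfolding eq using twice_half_periods(2) line_not_period[of s]
        by (intro deriv_periodic) (simp_all only: minus_periods_iff not_False_eq_True)
      ultimately have "wp (of_real (- s) + \<omega>2) = of_real (Y 0)" "deriv wp (of_real (- s) + \<omega>2) = of_real (Y1 0)"
        by (simp_all only: even s odd_deriv[OF line_not_period[of s]] \<open>deriv wp (of_real s + \<omega>2) = _\<close> minus_minus)
      thus ?thesis by blast
    next
      assume "deriv wp (of_real s + \<omega>2) = of_real (Y1 0)"
      thus ?thesis using s by (intro exI[of _ "- s"]) simp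
    qed
  qed
  then obtain \<tau>0 :: real where \<tau>0: "wp (of_real (- \<tau>0) + \<omega>2) = of_real (Y 0)"
      "deriv wp (of_real (- \<tau>0) + \<omega>2) = of_real (Y1 0)" by blast
  define x where "x = of_real (- \<tau>0) + \<omega>2"
  have np: "of_real (\<kappa> * t) + x \<notin> periods" for t
    using line_not_period[of "\<kappa> * t - \<tau>0"] by (simp add: x_def algebra_simps)
  define p where "p = (\<lambda>t. wp (of_real (\<kappa> * t) + x))"
  have p': "(p has_vector_derivative of_real \<kappa> * deriv wp (of_real (\<kappa> * t) + x)) (at t)" for t
    unfolding p_def by (rule has_vector_derivative_affine[OF D1[OF np]])
  have p'': "((\<lambda>t. deriv wp (of_real (\<kappa> * t) + x)) has_vector_derivative
      of_real \<kappa> * (6 * p t ^ 2 - of_real g2 / 2)) (at t)" for t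
    unfolding p_def by (rule has_vector_derivative_affine[OF D2[OF np]])
  have cY': "((\<lambda>t. of_real (f t) :: complex) has_vector_derivative of_real D) (at t)"
    if "(f has_real_derivative D) (at t)" for f D t
    using has_vector_derivative_of_real that by (simp add: has_real_derivative_iff_has_vector_derivative)
  have "of_real (Y t) - p t = 0" for t
  proof (rule second_order_linear_zero[where u="\<lambda>t. of_real (Y t) - p t" and r="\<lambda>t. of_real \<kappa> ^ 2 * 6 * (of_real (Y t) + p t)"
        and v="\<lambda>t. of_real \<kappa> * (of_real (Y1 t) - deriv wp (of_real (\<kappa> * t) + x))"])
    show "((\<lambda>t. of_real (Y t) - p t) has_vector_derivative
        of_real \<kappa> * (of_real (Y1 t) - deriv wp (of_real (\<kappa> * t) + x))) (at t)" for t
      by (rule has_vector_derivative_eq_rhs, rule has_vector_derivative_diff[OF cY'[OF Y] p']) (simp add: algebra_simps)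
    show "((\<lambda>t. of_real \<kappa> * (of_real (Y1 t) - deriv wp (of_real (\<kappa> * t) + x))) has_vector_derivative
        of_real \<kappa> ^ 2 * 6 * (of_real (Y t) + p t) * (of_real (Y t) - p t)) (at t)" for t
      by (rule has_vector_derivative_eq_rhs, rule has_vector_derivative_mult[OF has_vector_derivative_const
            has_vector_derivative_diff[OF cY'[OF Y1] p'']]) (simp add: algebra_simps power2_eq_square)
    show "continuous_on UNIV (\<lambda>t. of_real \<kappa> ^ 2 * 6 * (of_real (Y t) + p t))"
      by (intro continuous_intros continuous_on_vector_derivative[OF cY'[OF Y]] continuous_on_vector_derivative[OF p'])
  qed (use \<tau>0 in \<open>simp_all add: p_def x_def\<close>)
  thus ?thesis by (intro exI[of _ \<tau>0]) (simp add: p_def x_def algebra_simps)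
qed

end

section \<open>The Euler equations\<close>

lemma gronwall_zero_UNIV:
  fixes d :: "real \<Rightarrow> 'a::real_inner"
  assumes d: "\<And>t. (d has_vector_derivative d' t) (at t)"
    and le: "\<And>t. norm (d' t) \<le> L * norm (d t)" and "d 0 = 0"
  shows "d t = 0"
proof (cases "t \<ge> 0")
  case True
  thus ?thesis
    by (intro gronwall_zero[of t d d' L t]) (use assms in \<open>auto intro: has_vector_derivative_at_within\<close>)
next
  case False
  have "((\<lambda>t. d (- t)) has_vector_derivative - d' (- t)) (at t)" for t
    using vector_diff_chain_at[OF has_vector_derivative_minus[OF has_vector_derivative_id], of d "d' (- t)" t] d
    by (simp add: o_def)
  note D = this
  have "d (- (- t)) = 0"
  proof (rule gronwall_zero[where T="- t" and d="\<lambda>t. d (- t)" and d'="\<lambda>t. - d' (- t)" and L=L])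
    show "((\<lambda>t. d (- t)) has_vector_derivative - d' (- s)) (at s within {0..- t})" for s
      by (rule has_vector_derivative_at_within[OF D])
    show "norm (- d' (- s)) \<le> L * norm (d (- s))" for s using le[of "- s"] by simp
  qed (use False \<open>d 0 = 0\<close> in auto)
  thus ?thesis by simp
qed

lemma vector_derivative_zero_imp_const:
  fixes f :: "real \<Rightarrow> 'a::real_inner"
  assumes "\<And>t. (f has_vector_derivative 0) (at t)"
  shows "f t = f 0"
proof -
  have "f t - f 0 = 0"
  proof (rule gronwall_zero_UNIV[where d="\<lambda>t. f t - f 0" and t=t and d'="\<lambda>_. 0" and L=0])
    show "((\<lambda>t. f t - f 0) has_vector_derivative 0) (at t)" for t
      using has_vector_derivative_diff[OF assms has_vector_derivative_const] by simp
  qed auto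
  thus ?thesis by simp
qed

lemma vector_derivative_cnj:
  "(f has_vector_derivative f') F \<Longrightarrow> ((\<lambda>t. cnj (f t)) has_vector_derivative cnj f') F"
  by (rule bounded_linear.has_vector_derivative[OF bounded_linear_cnj])

lemma vector_derivative_cmod_power2:
  assumes "(f has_vector_derivative f') (at t)"
  shows "((\<lambda>t. (cmod (f t))^2) has_real_derivative 2 * Re (cnj (f t) * f')) (at t)"
proof -
  have "((\<lambda>t. Re (cnj (f t) * f t)) has_vector_derivative Re (cnj (f t) * f' + cnj f' * f t)) (at t)"
    by (intro bounded_linear.has_vector_derivative[OF bounded_linear_Re]
        has_vector_derivative_mult vector_derivative_cnj assms)
  moreover have "(\<lambda>t. Re (cnj (f t) * f t)) = (\<lambda>t. (cmod (f t))^2)"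
    by (simp add: fun_eq_iff cmod_power2 flip: power2_eq_square)
  moreover have "Re (cnj (f t) * f' + cnj f' * f t) = 2 * Re (cnj (f t) * f')" by simp
  ultimately show ?thesis by (simp only: has_real_derivative_iff_has_vector_derivative)
qed

text \<open>Radial retraction onto a ball: it truncates a field without changing its direction
  when the field is homogeneous.\<close>

lemma radial_retraction:
  fixes R :: real
  assumes "R > 0"
  obtains l :: "'a::euclidean_space \<Rightarrow> real" where
    "\<And>x. norm (l x *\<^sub>R x) \<le> R" "\<And>x. norm x \<le> R \<Longrightarrow> l x = 1"
    "\<And>x y. norm (l x *\<^sub>R x - l y *\<^sub>R y) \<le> norm (x - y)"
proof -
  define l :: "'a \<Rightarrow> real" where "l = (\<lambda>x. if norm x \<le> R then 1 else R / norm x)"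
  \<comment> \<open>The retraction is the closest point projection onto the ball, and projections
    onto convex sets do not increase distances.\<close>
  have cp: "l x *\<^sub>R x = closest_point (cball 0 R) x" for x
  proof (rule closest_point_unique)
    show "l x *\<^sub>R x \<in> cball 0 R" using assms by (auto simp: l_def)
    show "\<forall>z\<in>cball 0 R. dist x (l x *\<^sub>R x) \<le> dist x z"
    proof
      fix z :: 'a assume z: "z \<in> cball 0 R"
      show "dist x (l x *\<^sub>R x) \<le> dist x z"
      proof (cases "norm x \<le> R")
        case False
        have "x - l x *\<^sub>R x = (1 - R / norm x) *\<^sub>R x" using False by (simp add: l_def algebra_simps)
        hence "dist x (l x *\<^sub>R x) = \<bar>1 - R / norm x\<bar> * norm x" by (simp add: dist_norm)
        also have "\<dots> = (1 - R / norm x) * norm x"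
        proof -
          have "R / norm x \<le> 1" using False assms by (intro divide_le_eq_1[THEN iffD2]) linarith
          thus ?thesis by simp
        qed
        also have "\<dots> = norm x - R"
        proof -
          have "norm x \<noteq> 0" using False assms by linarith
          thus ?thesis by (simp add: field_simps)
        qed
        also have "\<dots> \<le> dist x z" using z norm_triangle_ineq2[of x z] by (simp add: dist_norm)
        finally show ?thesis .
      qed (simp add: l_def)
    qed
  qed auto
  show thesis
  proof (rule that[of l])
    show "norm (l x *\<^sub>R x) \<le> R" for x using assms by (auto simp: l_def)
    show "l x = 1" if "norm x \<le> R" for x using that by (simp add: l_def)
    show "norm (l x *\<^sub>R x - l y *\<^sub>R y) \<le> norm (x - y)" for x y
      unfolding cp using closest_point_lipschitz[of "cball 0 R" x y] assms by (simp add: dist_norm)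
  qed
qed

text \<open>\<open>p\<close>, \<open>q\<close>, \<open>r\<close> stand for
  \<open>\<alpha>23 - \<alpha>13\<close>, \<open>\<alpha>12 - \<alpha>23\<close>,
  \<open>\<alpha>12 - \<alpha>13\<close>: the Euler equations depend on the weights only through
  these differences.\<close>

locale euler_field =
  fixes p q r :: real
  assumes pos: "p > 0" "q > 0" and r: "r = p + q"
begin

lemma r_pos: "r > 0" using pos r by simp

definition field :: "complex \<times> complex \<times> complex \<Rightarrow> complex \<times> complex \<times> complex" where
  "field = (\<lambda>(a, b, c). (- \<i> * of_real p * b * cnj c, \<i> * of_real q * a * c, \<i> * of_real r * cnj a * b))"

lemma field_scaleR: "field (s *\<^sub>R x) = (s^2) *\<^sub>R field x"
  by (cases x) (simp add: field_def scaleR_conv_of_real power2_eq_square)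

text \<open>Each component is a product of two coordinates and changes by at most
  \<open>2 * R\<close> times the distance, up to its weight; the weights add up to
  \<open>p + q + r = 2 * r\<close>.\<close>

lemma field_lipschitz:
  assumes "norm x \<le> R" "norm y \<le> R"
  shows "norm (field x - field y) \<le> (4 * r * R) * norm (x - y)"
proof -
  obtain a b c where x: "x = (a, b, c)" by (cases x)
  obtain a' b' c' where y: "y = (a', b', c')" by (cases y)
  have comp: "cmod u \<le> norm (u, v, w)" "cmod v \<le> norm (u, v, w)" "cmod w \<le> norm (u, v, w)" for u v w
    using norm_fst_le[of u "(v, w)"] norm_snd_le[of "(v, w)" u] norm_fst_le[of v w] norm_snd_le[of w v] by linarith+
  have R: "cmod a \<le> R" "cmod b \<le> R" "cmod c \<le> R" "cmod a' \<le> R" "cmod b' \<le> R" "cmod c' \<le> R"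
    using comp[where u=a and v=b and w=c] comp[where u=a' and v=b' and w=c'] assms unfolding x y by linarith+
  define D where "D = norm (x - y)"
  have D: "cmod (a - a') \<le> D" "cmod (b - b') \<le> D" "cmod (c - c') \<le> D" "D \<ge> 0"
    using comp[where u="a - a'" and v="b - b'" and w="c - c'"] by (simp_all add: D_def x y)
  have prod: "cmod (u * v - u' * v') \<le> 2 * R * D"
    if "cmod u \<le> R" "cmod v' \<le> R" "cmod (u - u') \<le> D" "cmod (v - v') \<le> D" for u v u' v'
  proof -
    have "u * v - u' * v' = u * (v - v') + (u - u') * v'" by (simp add: algebra_simps)
    hence "cmod (u * v - u' * v') \<le> cmod u * cmod (v - v') + cmod (u - u') * cmod v'"
      by (metis norm_mult norm_triangle_ineq)
    also have "\<dots> \<le> R * D + D * R"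
      by (intro add_mono mult_mono that D(4) norm_ge_zero) (use R(1) norm_ge_zero[of a] in linarith)
    finally show ?thesis by (simp add: mult_ac)
  qed
  have e: "norm (field x - field y) \<le> cmod (- \<i> * of_real p * (b * cnj c - b' * cnj c')) +
      cmod (\<i> * of_real q * (a * c - a' * c')) + cmod (\<i> * of_real r * (cnj a * b - cnj a' * b'))"
  proof -
    have eq: "field x - field y = (- \<i> * of_real p * (b * cnj c - b' * cnj c'),
        \<i> * of_real q * (a * c - a' * c'), \<i> * of_real r * (cnj a * b - cnj a' * b'))"
      by (simp add: x y field_def algebra_simps)
    have 3: "norm (u, v, w) \<le> norm u + norm v + norm w" for u v w :: complex
      using norm_Pair_le[of u "(v, w)"] norm_Pair_le[of v w] by linarith
    show ?thesis unfolding eq by (rule 3)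
  qed
  have c1: "cmod (cnj u - cnj v) = cmod (u - v)" for u v by (metis complex_cnj_diff complex_mod_cnj)
  have "cmod (- \<i> * of_real p * (b * cnj c - b' * cnj c')) \<le> p * (2 * R * D)"
    using prod[of b "cnj c'" b' "cnj c"] R D pos by (simp add: norm_mult c1)
  moreover have "cmod (\<i> * of_real q * (a * c - a' * c')) \<le> q * (2 * R * D)"
    using prod[of a c' a' c] R D pos by (simp add: norm_mult)
  moreover have "cmod (\<i> * of_real r * (cnj a * b - cnj a' * b')) \<le> r * (2 * R * D)"
    using prod[of "cnj a" b' "cnj a'" b] R D r_pos by (simp add: norm_mult c1)
  ultimately have "norm (field x - field y) \<le> (p + q + r) * (2 * R * D)"
    using e by (simp add: distrib_right)
  also have "\<dots> = (4 * r * R) * norm (x - y)" by (simp add: D_def r algebra_simps)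
  finally show ?thesis .
qed

definition I2 :: "complex \<times> complex \<times> complex \<Rightarrow> real" where
  "I2 = (\<lambda>(a, b, c). (cmod c)^2 + r / p * (cmod a)^2)"

definition I3 :: "complex \<times> complex \<times> complex \<Rightarrow> real" where
  "I3 = (\<lambda>(a, b, c). (cmod c)^2 + r / q * (cmod b)^2)"

text \<open>\<open>r / p\<close> and \<open>r / q\<close> are at least 1, so the two invariants
  dominate the squared norm; the summand 1 passes from the square to the norm itself.\<close>

lemma norm_bound: "norm x \<le> 2 * I2 x + I3 x + 1"
proof -
  obtain a b c where x: "x = (a, b, c)" by (cases x)
  have "r / p \<ge> 1" "r / q \<ge> 1" using pos r by (simp_all add: field_simps)
  define A B where "A = r / p * (cmod a)^2" and "B = r / q * (cmod b)^2"
  have "(cmod a)^2 \<le> A" "(cmod b)^2 \<le> B" unfolding A_def B_def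
    using mult_right_mono[of 1 "r / p" "(cmod a)^2"] mult_right_mono[of 1 "r / q" "(cmod b)^2"]
      \<open>r / p \<ge> 1\<close> \<open>r / q \<ge> 1\<close> by simp_all
  moreover have "(norm x)^2 = (cmod a)^2 + ((cmod b)^2 + (cmod c)^2)"
    by (simp add: x norm_Pair)
  moreover have "I2 x = (cmod c)^2 + A" "I3 x = (cmod c)^2 + B"
    by (simp_all add: I2_def I3_def x A_def B_def)
  ultimately have n: "(norm x)^2 \<le> 2 * I2 x + I3 x"
    using zero_le_power2[of "cmod c"] zero_le_power2[of "cmod a"] zero_le_power2[of "cmod b"] by linarith
  hence nn: "2 * I2 x + I3 x \<ge> 0" using zero_le_power2[of "norm x"] by linarith
  show ?thesis
  proof (cases "norm x \<le> 1")
    case False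
    hence "norm x * 1 \<le> norm x * norm x" by (intro mult_left_mono) auto
    thus ?thesis using n by (simp add: power2_eq_square)
  qed (use nn in simp)
qed

text \<open>The scalar factor \<open>l t\<close> lets one statement serve both the Euler flow, with
  factor 1, and the truncated flow.\<close>

lemma conserved:
  assumes "\<And>t. ((x :: real \<Rightarrow> _) has_vector_derivative l t *\<^sub>R field (x t)) (at t)"
  shows "I2 (x t) = I2 (x 0)" "I3 (x t) = I3 (x 0)"
proof -
  define a b c where "a = (\<lambda>t. fst (x t))" and "b = (\<lambda>t. fst (snd (x t)))" and "c = (\<lambda>t. snd (snd (x t)))"
  have x: "x t = (a t, b t, c t)" for t by (simp add: a_def b_def c_def)
  have f: "l t *\<^sub>R field (x t) = (l t *\<^sub>R (- \<i> * of_real p * b t * cnj (c t)), l t *\<^sub>R (\<i> * of_real q * a t * c t), l t *\<^sub>R (\<i> * of_real r * cnj (a t) * b t))" for t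
    unfolding x by (simp add: field_def)
  have "(a has_vector_derivative l t *\<^sub>R (- \<i> * of_real p * b t * cnj (c t))) (at t)" for t
    using bounded_linear.has_vector_derivative[OF bounded_linear_fst assms[of t]] unfolding f by (simp add: a_def)
  note a = vector_derivative_cmod_power2[OF this]
  have "(b has_vector_derivative l t *\<^sub>R (\<i> * of_real q * a t * c t)) (at t)" for t
    using bounded_linear.has_vector_derivative[OF bounded_linear_fst
        bounded_linear.has_vector_derivative[OF bounded_linear_snd assms[of t]]] unfolding f by (simp add: b_def)
  note b = vector_derivative_cmod_power2[OF this]
  have "(c has_vector_derivative l t *\<^sub>R (\<i> * of_real r * cnj (a t) * b t)) (at t)" for t
    using bounded_linear.has_vector_derivative[OF bounded_linear_snd
        bounded_linear.has_vector_derivative[OF bounded_linear_snd assms[of t]]] unfolding f by (simp add: c_def)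
  note c = vector_derivative_cmod_power2[OF this]
  have "((\<lambda>t. I2 (x t)) has_real_derivative 0) (at t)" for t
    unfolding x I2_def prod.case
    by (rule DERIV_cong[OF DERIV_add[OF c DERIV_cmult[OF a]]]) (use pos in \<open>simp add: field_simps\<close>)
  thus "I2 (x t) = I2 (x 0)"
    using vector_derivative_zero_imp_const[of "\<lambda>t. I2 (x t)"] by (simp add: has_real_derivative_iff_has_vector_derivative)
  have "((\<lambda>t. I3 (x t)) has_real_derivative 0) (at t)" for t
    unfolding x I3_def prod.case
    by (rule DERIV_cong[OF DERIV_add[OF c DERIV_cmult[OF b]]]) (use pos in \<open>simp add: field_simps\<close>)
  thus "I3 (x t) = I3 (x 0)"
    using vector_derivative_zero_imp_const[of "\<lambda>t. I3 (x t)"] by (simp add: has_real_derivative_iff_has_vector_derivative)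
qed

lemma bounded_solution:
  assumes "\<And>t. ((x :: real \<Rightarrow> _) has_vector_derivative l t *\<^sub>R field (x t)) (at t)"
  shows "norm (x t) \<le> 2 * I2 (x 0) + I3 (x 0) + 1"
  using norm_bound[of "x t"] conserved[OF assms, of t] by simp

theorem ex_solution:
  obtains x where "x 0 = x0" "\<And>t. (x has_vector_derivative field (x t)) (at t)"
proof -
  define R where "R = 2 * I2 x0 + I3 x0 + 1"
  have "R > 0" using norm_bound[of x0] norm_ge_zero[of x0] pos r_pos
    by (auto simp: R_def I2_def I3_def split: prod.split intro!: add_nonneg_pos add_nonneg_nonneg)
  then obtain l :: "complex \<times> complex \<times> complex \<Rightarrow> real" where l: "\<And>x. norm (l x *\<^sub>R x) \<le> R" "\<And>x. norm x \<le> R \<Longrightarrow> l x = 1"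
    "\<And>x y. norm (l x *\<^sub>R x - l y *\<^sub>R y) \<le> norm (x - y)" using radial_retraction by blast
  define F where "F = (\<lambda>x. field (l x *\<^sub>R x))"
  have lip: "norm (F x - F y) \<le> 4 * r * R * norm (x - y)" for x y
    unfolding F_def
    by (rule order_trans[OF field_lipschitz[OF l(1) l(1)] mult_left_mono[OF l(3)]]) (use r_pos \<open>R > 0\<close> in simp)
  have contF: "continuous_on UNIV F"
  proof (rule lipschitz_on_continuous_on)
    show "(4 * r * R)-lipschitz_on UNIV F"
      using lip r_pos \<open>R > 0\<close> by (intro lipschitz_onI) (auto simp: dist_norm)
  qed
  obtain x where x: "x 0 = x0" "\<And>t. (x has_vector_derivative F (x t)) (at t)"
  proof (rule global_ode_existence[of "\<lambda>_. F" "4 * r * R" x0])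
    show "continuous_on UNIV (\<lambda>s. F (x s))" if "continuous_on UNIV x" for x :: "real \<Rightarrow> _"
      by (rule continuous_on_compose2[OF contF that]) auto
  qed (use lip r_pos \<open>R > 0\<close> in auto)
  \<comment> \<open>A truncated solution moves along a multiple of the Euler field, so the bound of
    \<open>bounded_solution\<close> holds for it and the truncation is never active.\<close>
  have "F (x t) = (l (x t))^2 *\<^sub>R field (x t)" for t by (simp add: F_def field_scaleR)
  hence "norm (x t) \<le> R" for t
    using bounded_solution[of x "\<lambda>t. (l (x t))^2" t] x by (simp add: R_def)
  hence "F (x t) = field (x t)" for t by (simp add: F_def l(2))
  thus thesis using that x by simp
qed

theorem unique_solution:
  assumes x: "\<And>t. (x has_vector_derivative field (x t)) (at t)"
    and y: "\<And>t. (y has_vector_derivative field (y t)) (at t)" and "x 0 = y 0"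
  shows "x = y"
proof
  fix t
  have R: "norm (x t) \<le> 2 * I2 (x 0) + I3 (x 0) + 1" "norm (y t) \<le> 2 * I2 (x 0) + I3 (x 0) + 1" for t
    using bounded_solution[of x "\<lambda>_. 1" t] bounded_solution[of y "\<lambda>_. 1" t] x y assms(3) by simp_all
  have "x t - y t = 0"
    by (rule gronwall_zero_UNIV[OF has_vector_derivative_diff[OF x y] field_lipschitz[OF R]]) (simp add: assms)
  thus "x t = y t" by simp
qed

end

lemma euler_solution_iff:
  "euler_solution \<alpha>12 \<alpha>13 \<alpha>23 a0 b0 c0 a b c \<longleftrightarrow>
     a 0 = a0 \<and> b 0 = b0 \<and> c 0 = c0 \<and>
     (\<forall>t. (a has_vector_derivative - \<i> * of_real (\<alpha>23 - \<alpha>13) * b t * cnj (c t)) (at t) \<and>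
          (b has_vector_derivative \<i> * of_real (\<alpha>12 - \<alpha>23) * a t * c t) (at t) \<and>
          (c has_vector_derivative \<i> * of_real (\<alpha>12 - \<alpha>13) * cnj (a t) * b t) (at t))"
proof -
  have i: "\<i> * z = w \<longleftrightarrow> z = - \<i> * w" for z w :: complex
    by (auto simp: complex_eq_iff)
  have 1: "\<i> * z = of_real (\<alpha>23 - \<alpha>13) * b t * cnj (c t) \<longleftrightarrow> z = - \<i> * of_real (\<alpha>23 - \<alpha>13) * b t * cnj (c t)" for z t
    unfolding i by (simp add: mult.assoc)
  have 2: "\<i> * z = of_real (\<alpha>23 - \<alpha>12) * a t * c t \<longleftrightarrow> z = \<i> * of_real (\<alpha>12 - \<alpha>23) * a t * c t" for z t
    unfolding i by (simp add: algebra_simps)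
  have 3: "\<i> * z = of_real (\<alpha>13 - \<alpha>12) * cnj (a t) * b t \<longleftrightarrow> z = \<i> * of_real (\<alpha>12 - \<alpha>13) * cnj (a t) * b t" for z t
    unfolding i by (simp add: algebra_simps)
  show ?thesis unfolding euler_solution_def 1 2 3 by blast
qed

lemma euler_solution_iff_field:
  assumes "\<alpha>12 > \<alpha>23" "\<alpha>23 > \<alpha>13"
  shows "euler_solution \<alpha>12 \<alpha>13 \<alpha>23 a0 b0 c0 a b c \<longleftrightarrow> (a 0, b 0, c 0) = (a0, b0, c0) \<and>
    (\<forall>t. ((\<lambda>t. (a t, b t, c t)) has_vector_derivative
        euler_field.field (\<alpha>23 - \<alpha>13) (\<alpha>12 - \<alpha>23) (\<alpha>12 - \<alpha>13) (a t, b t, c t)) (at t))"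
proof -
  interpret euler_field "\<alpha>23 - \<alpha>13" "\<alpha>12 - \<alpha>23" "\<alpha>12 - \<alpha>13" by unfold_locales (use assms in auto)
  have "((\<lambda>t. (a t, b t, c t)) has_vector_derivative (u, v, w)) (at t) \<longleftrightarrow>
     (a has_vector_derivative u) (at t) \<and> (b has_vector_derivative v) (at t) \<and> (c has_vector_derivative w) (at t)" for t u v w
  proof
    assume 1: "((\<lambda>t. (a t, b t, c t)) has_vector_derivative (u, v, w)) (at t)"
    note 2 = bounded_linear.has_vector_derivative[OF bounded_linear_snd 1]
    show "(a has_vector_derivative u) (at t) \<and> (b has_vector_derivative v) (at t) \<and> (c has_vector_derivative w) (at t)"
      using bounded_linear.has_vector_derivative[OF bounded_linear_fst 1] bounded_linear.has_vector_derivative[OF bounded_linear_fst 2]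
        bounded_linear.has_vector_derivative[OF bounded_linear_snd 2] by simp
  qed (auto intro!: has_vector_derivative_Pair)
  thus ?thesis unfolding euler_solution_iff by (auto simp: field_def)
qed

theorem euler_ex1:
  assumes "\<alpha>12 > \<alpha>23" "\<alpha>23 > \<alpha>13"
  shows "\<exists>!abc. case abc of (a, b, c) \<Rightarrow> euler_solution \<alpha>12 \<alpha>13 \<alpha>23 a0 b0 c0 a b c"
proof -
  interpret euler_field "\<alpha>23 - \<alpha>13" "\<alpha>12 - \<alpha>23" "\<alpha>12 - \<alpha>13" by unfold_locales (use assms in auto)
  note iff = euler_solution_iff_field[OF assms]
  obtain x where x: "x 0 = (a0, b0, c0)" "\<And>t. (x has_vector_derivative field (x t)) (at t)"
    using ex_solution[of "(a0, b0, c0)"] by blast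
  define a b c where "a = (\<lambda>t. fst (x t))" and "b = (\<lambda>t. fst (snd (x t)))" and "c = (\<lambda>t. snd (snd (x t)))"
  have x': "(\<lambda>t. (a t, b t, c t)) = x" by (simp add: a_def b_def c_def)
  have sol: "euler_solution \<alpha>12 \<alpha>13 \<alpha>23 a0 b0 c0 a b c"
    unfolding iff x' using x fun_cong[OF x'] by simp
  show ?thesis
  proof (rule ex1I[of _ "(a, b, c)"])
    fix abc assume "case abc of (a, b, c) \<Rightarrow> euler_solution \<alpha>12 \<alpha>13 \<alpha>23 a0 b0 c0 a b c"
    then obtain a' b' c' where abc: "abc = (a', b', c')" and "euler_solution \<alpha>12 \<alpha>13 \<alpha>23 a0 b0 c0 a' b' c'"
      by (cases abc) auto
    hence "(\<lambda>t. (a' t, b' t, c' t)) = (\<lambda>t. (a t, b t, c t))"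
      using sol unfolding iff by (intro unique_solution) auto
    thus "abc = (a, b, c)" unfolding abc by (auto simp: fun_eq_iff)
  qed (use sol in simp)
qed

section \<open>Conserved quantities of an orbit and the Weierstrass equation for the squared modulus
  of \<open>c\<close>\<close>

locale euler_orbit = euler_field p q r for p q r :: real +
  fixes a b c :: "real \<Rightarrow> complex"
  assumes a': "\<And>t. (a has_vector_derivative - \<i> * of_real p * b t * cnj (c t)) (at t)"
    and b': "\<And>t. (b has_vector_derivative \<i> * of_real q * a t * c t) (at t)"
    and c': "\<And>t. (c has_vector_derivative \<i> * of_real r * cnj (a t) * b t) (at t)"
begin

definition i2 :: real where "i2 = (cmod (c 0))^2 + r / p * (cmod (a 0))^2"
definition i3 :: real where "i3 = (cmod (c 0))^2 + r / q * (cmod (b 0))^2"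
text \<open>The real part of this product is the conserved \<open>h / 2\<close>; its imaginary part
  is \<open>- 1 / (2 * r)\<close> times the time derivative of \<open>w\<close>.\<close>

definition z :: "real \<Rightarrow> complex" where "z = (\<lambda>t. cnj (a t) * b t * cnj (c t))"
definition h :: real where "h = 2 * Re (z 0)"
definition w :: "real \<Rightarrow> real" where "w = (\<lambda>t. (cmod (c t))^2)"
definition \<kappa> :: real where "\<kappa> = sqrt (q * p)"
definition G2 :: real where "G2 = 4/3 * (i2^2 - i2 * i3 + i3^2)"
definition G3 :: real where "G3 = r^2 / (q * p) * h^2 + 4/27 * (i2 + i3) * (2 * i2^2 - 5 * i2 * i3 + 2 * i3^2)"
text \<open>\<open>Y\<close> and \<open>Y1\<close> play the roles of \<open>wp\<close> and its
  derivative in the time \<open>\<kappa> * t\<close>; the shift is by the mean of 0,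
  \<open>i2\<close> and \<open>i3\<close>.\<close>

definition Y :: "real \<Rightarrow> real" where "Y = (\<lambda>t. w t - (i2 + i3) / 3)"
definition Y1 :: "real \<Rightarrow> real" where "Y1 = (\<lambda>t. - 2 * r * Im (z t) / \<kappa>)"

lemma \<kappa>: "\<kappa> > 0" "\<kappa>^2 = q * p" using pos by (simp_all add: \<kappa>_def)

lemma moduli: "(cmod (a t))^2 = (i2 - w t) * p / r" "(cmod (b t))^2 = (i3 - w t) * q / r"
proof -
  have "((\<lambda>t. (a t, b t, c t)) has_vector_derivative 1 *\<^sub>R field (a t, b t, c t)) (at t)" for t
    unfolding field_def prod.case scaleR_one by (intro has_vector_derivative_Pair a' b' c')
  note * = conserved[where x="\<lambda>t. (a t, b t, c t)", OF this, of t]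
  have "w t + r / p * (cmod (a t))^2 = i2" using *(1) by (simp add: I2_def w_def i2_def)
  thus "(cmod (a t))^2 = (i2 - w t) * p / r" using pos r_pos by (auto simp: field_simps)
  have "w t + r / q * (cmod (b t))^2 = i3" using *(2) by (simp add: I3_def w_def i3_def)
  thus "(cmod (b t))^2 = (i3 - w t) * q / r" using pos r_pos by (auto simp: field_simps)
qed

lemma w_bounds: "0 \<le> w t" "w t \<le> i2" "w t \<le> i3"
proof -
  show "0 \<le> w t" by (simp add: w_def)
  have "0 \<le> (i2 - w t) * p / r" "0 \<le> (i3 - w t) * q / r"
    using moduli[of t] zero_le_power2[of "cmod (a t)"] zero_le_power2[of "cmod (b t)"] by simp_all
  thus "w t \<le> i2" "w t \<le> i3" using pos r_pos by (simp_all add: zero_le_divide_iff zero_le_mult_iff)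
qed

text \<open>The derivative is purely imaginary: this is the conservation of
  \<open>h\<close>.\<close>

lemma z': "(z has_vector_derivative
    \<i> * of_real (p * (cmod (b t))^2 * w t + q * (cmod (a t))^2 * w t - r * (cmod (a t))^2 * (cmod (b t))^2)) (at t)"
  unfolding z_def
  by (rule has_vector_derivative_eq_rhs, rule has_vector_derivative_mult[OF has_vector_derivative_mult[OF
        vector_derivative_cnj[OF a'] b'] vector_derivative_cnj[OF c']])
     (simp only: w_def of_real_add of_real_diff of_real_mult complex_norm_square,
      simp add: algebra_simps)

lemma Re_z: "Re (z t) = h / 2"
proof -
  have "((\<lambda>t. Re (z t)) has_vector_derivative 0) (at t)" for t
    using bounded_linear.has_vector_derivative[OF bounded_linear_Re z'[of t]] by simp
  from vector_derivative_zero_imp_const[OF this, of t] show ?thesis by (simp add: h_def)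
qed

lemma Im_z': "((\<lambda>t. Im (z t)) has_real_derivative
    p * q / r * (- 3 * w t ^ 2 + 2 * (i2 + i3) * w t - i2 * i3)) (at t)"
proof -
  have "((\<lambda>t. Im (z t)) has_real_derivative
      p * (cmod (b t))^2 * w t + q * (cmod (a t))^2 * w t - r * (cmod (a t))^2 * (cmod (b t))^2) (at t)"
    using bounded_linear.has_vector_derivative[OF bounded_linear_Im z'[of t]]
    by (simp add: has_real_derivative_iff_has_vector_derivative)
  also have "p * (cmod (b t))^2 * w t + q * (cmod (a t))^2 * w t - r * (cmod (a t))^2 * (cmod (b t))^2
      = p * q / r * (- 3 * w t ^ 2 + 2 * (i2 + i3) * w t - i2 * i3)"
    unfolding moduli using r_pos by (simp add: field_simps power2_eq_square)
  finally show ?thesis .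
qed

lemma Y': "(Y has_real_derivative \<kappa> * Y1 t) (at t)"
proof -
  have "(w has_real_derivative 2 * Re (cnj (c t) * (\<i> * of_real r * cnj (a t) * b t))) (at t)"
    unfolding w_def by (rule vector_derivative_cmod_power2[OF c'])
  also have "2 * Re (cnj (c t) * (\<i> * of_real r * cnj (a t) * b t)) = - 2 * r * Im (z t)"
  proof -
    have eq: "cnj (c t) * (\<i> * of_real r * cnj (a t) * b t) = \<i> * of_real r * z t" by (simp add: z_def mult_ac)
    show ?thesis unfolding eq by simp
  qed
  also have "\<dots> = \<kappa> * Y1 t" using \<kappa> by (simp add: Y1_def)
  finally have "(w has_real_derivative \<kappa> * Y1 t) (at t)" .
  from DERIV_diff[OF this DERIV_const[of "(i2 + i3) / 3"]] show ?thesis by (simp add: Y_def)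
qed

lemma Y1': "(Y1 has_real_derivative \<kappa> * (6 * Y t ^ 2 - G2 / 2)) (at t)"
proof -
  have gen: "(- 2 * r) * (p * q / r * E) / \<kappa> = (q * p) / \<kappa> * (- 2 * E)" for E
    using r_pos by simp
  have "(Y1 has_real_derivative (- 2 * r) * (p * q / r * (- 3 * w t ^ 2 + 2 * (i2 + i3) * w t - i2 * i3)) / \<kappa>) (at t)"
    unfolding Y1_def by (intro DERIV_cdivide DERIV_cmult Im_z')
  also have "(- 2 * r) * (p * q / r * (- 3 * w t ^ 2 + 2 * (i2 + i3) * w t - i2 * i3)) / \<kappa>
      = (q * p) / \<kappa> * (- 2 * (- 3 * w t ^ 2 + 2 * (i2 + i3) * w t - i2 * i3))"
    by (rule gen)
  also have "(q * p) / \<kappa> = \<kappa>" using \<kappa> by (simp add: field_simps power2_eq_square)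
  also have "- 2 * (- 3 * w t ^ 2 + 2 * (i2 + i3) * w t - i2 * i3) = 6 * Y t ^ 2 - G2 / 2"
    by (simp add: Y_def G2_def field_simps power2_eq_square)
  finally show ?thesis .
qed

text \<open>The source of \<open>G2\<close> and \<open>G3\<close>: they are the coefficients left
  when \<open>4 * v * (v - I) * (v - J) - K\<close> is centred so as to lose its quadratic term. The
  generic field serves the real orbit as well as the complex roots.\<close>

lemma shifted_cubic:
  fixes v I J K :: "'a::field_char_0"
  shows "4 * (v - (I + J) / 3)^3 - 4/3 * (I^2 - I * J + J^2) * (v - (I + J) / 3)
      - (K + 4/27 * (I + J) * (2 * I^2 - 5 * I * J + 2 * J^2)) = 4 * v * (v - I) * (v - J) - K"
  by (simp add: field_simps power2_eq_square power3_eq_cube)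

lemma cubic_real: "4 * (v - (i2 + i3) / 3)^3 - G2 * (v - (i2 + i3) / 3) - G3
    = 4 * v * (v - i2) * (v - i3) - r^2 / (q * p) * h^2"
  unfolding G2_def G3_def by (rule shifted_cubic)

lemma cubic: "4 * (v - of_real ((i2 + i3) / 3))^3 - of_real G2 * (v - of_real ((i2 + i3) / 3)) - of_real G3
    = 4 * v * (v - of_real i2) * (v - of_real i3) - of_real (r^2 / (q * p) * h^2)" for v :: complex
proof -
  define K where "K = r^2 / (q * p) * h^2"
  have G3: "G3 = K + 4/27 * (i2 + i3) * (2 * i2^2 - 5 * i2 * i3 + 2 * i3^2)" by (simp only: G3_def K_def)
  show ?thesis
    unfolding K_def[symmetric] G2_def G3
    using shifted_cubic[of v "of_real i2" "of_real i3" "of_real K"]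
    by (simp only: of_real_add of_real_mult of_real_divide of_real_power of_real_diff of_real_numeral)
qed

text \<open>The squared modulus of \<open>z\<close> is a product of three factors affine in
  \<open>w\<close>, and its real part is constant; the square of the imaginary part is what
  remains.\<close>

lemma w_cubic: "4 * w t * (w t - i2) * (w t - i3) - r^2 / (q * p) * h^2 = (2 * r * Im (z t) / \<kappa>)^2"
proof -
  have "(cmod (z t))^2 = (cmod (a t))^2 * (cmod (b t))^2 * w t"
    by (simp add: z_def w_def norm_mult power_mult_distrib)
  moreover have "(Im (z t))^2 = (cmod (z t))^2 - (Re (z t))^2" by (simp add: cmod_power2)
  ultimately have "(Im (z t))^2 = (i2 - w t) * p / r * ((i3 - w t) * q / r) * w t - (h / 2)^2"
    by (simp only: moduli Re_z)
  hence "(2 * r * Im (z t) / \<kappa>)^2 = 4 * r^2 / (q * p) * ((i2 - w t) * p / r * ((i3 - w t) * q / r) * w t - (h / 2)^2)"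
    by (simp add: power_mult_distrib power_divide \<kappa>)
  also have "\<dots> = 4 * w t * (w t - i2) * (w t - i3) - r^2 / (q * p) * h^2"
    using pos r_pos by (simp add: field_simps power2_eq_square)
  finally show ?thesis ..
qed

lemma Y1_square: "Y1 t ^ 2 = 4 * Y t ^ 3 - G2 * Y t - G3"
  using cubic_real[of "w t"] w_cubic[of t] by (simp add: Y_def Y1_def)

lemma zero_imp_h: "a t = 0 \<or> b t = 0 \<or> c t = 0 \<Longrightarrow> h = 0"
  using Re_z[of t] by (auto simp: z_def)

text \<open>With a nonreal pair of roots the cubic would change sign only once on the real line,
  from negative to positive. But it is negative at \<open>i2\<close> and, by \<open>w_cubic\<close>,
  nonnegative at \<open>w 0 \<le> i2\<close>.\<close>

lemma roots_real:
  fixes V :: complex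
  assumes "4 * V^3 - of_real G2 * V - of_real G3 = 0"
  shows "V \<in> \<real>"
proof -
  define v where "v = V + of_real ((i2 + i3) / 3)"
  have V: "V = v - of_real ((i2 + i3) / 3)" by (simp add: v_def)
  define K where "K = r^2 / (q * p) * h^2"
  have K: "K \<ge> 0" using pos by (simp add: K_def)
  have 0: "4 * v * (v - of_real i2) * (v - of_real i3) = of_real K"
    using assms unfolding V cubic K_def by simp
  have "v \<in> \<real>"
  proof (rule ccontr)
    assume "v \<notin> \<real>"
    define x y where "x = Re v" and "y = Im v"
    have y: "y \<noteq> 0" using \<open>v \<notin> \<real>\<close> by (simp add: y_def complex_is_Real_iff)
    have v: "v = Complex x y" by (simp add: x_def y_def)
    have re: "4 * (x * (x - i2) * (x - i3) - y^2 * (3 * x - i2 - i3)) = K"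
      using arg_cong[OF 0, of Re] by (simp add: v algebra_simps power2_eq_square)
    have im: "y^2 = 3 * x^2 - 2 * (i2 + i3) * x + i2 * i3"
    proof -
      have "y * (3 * x^2 - 2 * (i2 + i3) * x + i2 * i3 - y^2) = 0"
        using arg_cong[OF 0, of Im] by (simp add: v algebra_simps power2_eq_square)
      thus ?thesis using y by simp
    qed
    have K0: "K \<noteq> 0"
    proof
      assume "K = 0"
      hence "v = 0 \<or> v = of_real i2 \<or> v = of_real i3" using 0 by simp
      thus False using \<open>v \<notin> \<real>\<close> by auto
    qed
    \<comment> \<open>The third root, determined by the sum \<open>i2 + i3\<close> of all three. The
      remaining quadratic factor is positive on the real line, so the sign of the cubic is that of
      \<open>u - \<rho>\<close>.\<close>
    define \<rho> where "\<rho> = i2 + i3 - 2 * x"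
    have P: "4 * u * (u - i2) * (u - i3) - K = 4 * (u - \<rho>) * ((u - x)^2 + y^2)" for u
    proof -
      have e: "(v - i2) * (v - i3) = v^2 - (i2 + i3) * v + (y^2 - 3 * x^2 + 2 * (i2 + i3) * x)" for v
        using im by (simp add: algebra_simps power2_eq_square)
      show ?thesis unfolding re[symmetric] mult.assoc e \<rho>_def
        by (simp add: algebra_simps power2_eq_square)
    qed
    have sq: "(u - x)^2 + y^2 > 0" for u using y by (simp add: add_nonneg_pos)
    have "4 * (i2 - \<rho>) * ((i2 - x)^2 + y^2) < 0" using P[of i2] K K0 by simp
    hence "i2 < \<rho>" using sq[of i2] by (simp add: mult_less_0_iff)
    moreover have "4 * (w 0 - \<rho>) * ((w 0 - x)^2 + y^2) \<ge> 0"
      using P[of "w 0"] w_cubic[of 0] by (simp add: K_def)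
    hence "w 0 \<ge> \<rho>" using sq[of "w 0"] by (simp add: zero_le_mult_iff)
    ultimately show False using w_bounds(2)[of 0] by simp
  qed
  thus ?thesis unfolding V by simp
qed

text \<open>The cubic is a square at \<open>Y 0\<close>, which allows the interval
  \<open>[e3, e2]\<close> and values from \<open>e1\<close> upwards. The latter are excluded by the
  bounds of \<open>w\<close> by \<open>i2\<close> and \<open>i3\<close> and by the distinctness of
  the roots.\<close>

lemma Y0_range:
  assumes f: "\<And>v. 4 * v^3 - G2 * v - G3 = 4 * (v - e1) * (v - e2) * (v - e3)" and e: "e1 > e2" "e2 > e3"
  shows "e3 \<le> Y 0" "Y 0 \<le> e2"
proof -
  have P: "4 * v * (v - i2) * (v - i3) - r^2 / (q * p) * h^2
      = 4 * ((v - (i2 + i3) / 3) - e1) * ((v - (i2 + i3) / 3) - e2) * ((v - (i2 + i3) / 3) - e3)" for v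
    using f[of "v - (i2 + i3) / 3"] cubic_real[of v] by simp
  define K where "K = r^2 / (q * p) * h^2"
  have K: "K \<ge> 0" using pos by (simp add: K_def)
  have "4 * ((Y 0 - e1) * (Y 0 - e2) * (Y 0 - e3)) = (2 * r * Im (z 0) / \<kappa>)^2"
    unfolding w_cubic[symmetric] P by (simp only: Y_def mult.assoc)
  hence nonneg: "(Y 0 - e1) * (Y 0 - e2) * (Y 0 - e3) \<ge> 0"
    using zero_le_power2[of "2 * r * Im (z 0) / \<kappa>"] by linarith
  have "Y 0 < e1"
  proof (rule ccontr)
    assume ge: "\<not> Y 0 < e1"
    have neg: "((i - (i2 + i3) / 3) - e1) * ((i - (i2 + i3) / 3) - e2) * ((i - (i2 + i3) / 3) - e3) \<le> 0"
      if "i = i2 \<or> i = i3" for i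
    proof -
      have "4 * i * (i - i2) * (i - i3) = 0" using that by auto
      hence "4 * (((i - (i2 + i3) / 3) - e1) * ((i - (i2 + i3) / 3) - e2) * ((i - (i2 + i3) / 3) - e3)) = - K"
        using P[of i] by (simp only: K_def mult.assoc diff_0)
      thus ?thesis using K by linarith
    qed
    have le: "i - (i2 + i3) / 3 \<le> e1" if "i = i2 \<or> i = i3" for i
    proof (rule ccontr)
      assume "\<not> i - (i2 + i3) / 3 \<le> e1"
      hence "((i - (i2 + i3) / 3) - e1) * ((i - (i2 + i3) / 3) - e2) * ((i - (i2 + i3) / 3) - e3) > 0"
        using e by (intro mult_pos_pos) auto
      thus False using neg[OF that] by simp
    qed
    \<comment> \<open>\<open>w 0\<close> is at most \<open>i2\<close> and \<open>i3\<close>, whose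
      shifts are at most \<open>e1\<close>; a value \<open>Y 0 \<ge> e1\<close> makes all these
      inequalities equalities.\<close>
    have eq: "w 0 = i2" "w 0 = i3" "e1 = w 0 - (i2 + i3) / 3"
      using le[of i2] le[of i3] w_bounds[of 0] ge by (auto simp: Y_def)
    have "c 0 = 0 \<or> a 0 = 0" using moduli(1)[of 0] eq(1) by simp
    hence h: "h = 0" using zero_imp_h[of 0] by blast
    have f1: "v - (i2 + i3) / 3 - e1 = v - i2" for v using eq by simp
    have i32: "i3 = i2" using eq by simp
    have "v * (v - i2) = (v - (i2 + i3) / 3 - e2) * (v - (i2 + i3) / 3 - e3)" if "v \<noteq> i2" for v
    proof -
      have "4 * ((v - i2) * (v * (v - i2) - b)) = 4 * v * (v - i2) * (v - i3) - r^2 / (q * p) * h^2 - 4 * (v - i2) * b" for b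
        by (simp add: h i32 algebra_simps)
      from this[of "(v - (i2 + i3) / 3 - e2) * (v - (i2 + i3) / 3 - e3)"]
      have "4 * ((v - i2) * (v * (v - i2) - (v - (i2 + i3) / 3 - e2) * (v - (i2 + i3) / 3 - e3))) = 0"
        using P[of v] unfolding f1 by (simp only: mult.assoc diff_self)
      thus ?thesis using that by (simp only: mult_eq_0_iff right_minus_eq) simp
    qed
    note * = this
    \<comment> \<open>The cubic is now \<open>4 * v * (v - i2)^2\<close>, so both \<open>e2\<close>
      and \<open>e3\<close> would have to be the shift of its remaining root 0.\<close>
    have "e + (i2 + i3) / 3 = 0" if "e = e2 \<or> e = e3" for e
    proof -
      have ne: "e + (i2 + i3) / 3 \<noteq> i2" using eq e that by auto
      from *[OF this] have "(e + (i2 + i3) / 3) * (e + (i2 + i3) / 3 - i2) = 0" using that by auto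
      thus ?thesis using ne by simp
    qed
    from this[of e2] this[of e3] have "e2 = e3" by simp
    thus False using e by simp
  qed
  hence *: "(Y 0 - e2) * (Y 0 - e3) \<le> 0" using nonneg
    by (metis (no_types) mult.assoc mult_le_0_iff zero_le_mult_iff diff_less_0_iff_less less_le_not_le)
  show "e3 \<le> Y 0" "Y 0 \<le> e2" using * e by (auto simp: mult_le_0_iff)
qed

definition a1 :: "real \<Rightarrow> complex" where "a1 = (\<lambda>t. - \<i> * of_real p * b t * cnj (c t))"
definition b1 :: "real \<Rightarrow> complex" where "b1 = (\<lambda>t. \<i> * of_real q * a t * c t)"
definition c1 :: "real \<Rightarrow> complex" where "c1 = (\<lambda>t. \<i> * of_real r * cnj (a t) * b t)"

lemma aa: "a t * cnj (a t) = of_real ((i2 - w t) * p / r)"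
  and bb: "b t * cnj (b t) = of_real ((i3 - w t) * q / r)" and cc: "c t * cnj (c t) = of_real (w t)"
  by (simp_all only: complex_norm_square[symmetric] moduli w_def)

text \<open>Substituting the squared moduli makes the second derivative linear in \<open>a\<close>.
  Since \<open>2 * w - i3 = 2 * Y + (2/3 * i2 - 1/3 * i3)\<close>, this is Lame's equation with the
  parameter prescribed for \<open>\<mu>1\<close>; the same computation gives those of
  \<open>\<mu>2\<close> and \<open>\<mu>3\<close> for \<open>b\<close> and \<open>c\<close>.\<close>

lemma a1': "(a1 has_vector_derivative of_real (\<kappa>^2) * of_real (2 * w t - i3) * a t) (at t)"
proof -
  have "(a1 has_vector_derivative - \<i> * of_real p * (b t * cnj (\<i> * of_real r * cnj (a t) * b t)
      + (\<i> * of_real q * a t * c t) * cnj (c t))) (at t)"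
    unfolding a1_def mult.assoc[of _ "b _"]
    by (rule has_vector_derivative_eq_rhs, rule has_vector_derivative_mult[OF has_vector_derivative_const
          has_vector_derivative_mult[OF b' vector_derivative_cnj[OF c']]]) simp
  also have "- \<i> * of_real p * (b t * cnj (\<i> * of_real r * cnj (a t) * b t) + (\<i> * of_real q * a t * c t) * cnj (c t))
     = (of_real (p * q) * (c t * cnj (c t)) - of_real (p * r) * (b t * cnj (b t))) * a t"
    by (simp add: algebra_simps)
  also have "\<dots> = of_real (p * q * w t - p * r * ((i3 - w t) * q / r)) * a t"
    unfolding bb cc by simp
  also have "p * q * w t - p * r * ((i3 - w t) * q / r) = \<kappa>^2 * (2 * w t - i3)"
    using r_pos by (simp add: \<kappa> field_simps)
  finally show ?thesis by simp
qed

lemma b1': "(b1 has_vector_derivative of_real (\<kappa>^2) * of_real (2 * w t - i2) * b t) (at t)"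
proof -
  have "(b1 has_vector_derivative \<i> * of_real q * (a t * (\<i> * of_real r * cnj (a t) * b t)
      + (- \<i> * of_real p * b t * cnj (c t)) * c t)) (at t)"
    unfolding b1_def mult.assoc[of _ "a _"]
    by (rule has_vector_derivative_eq_rhs, rule has_vector_derivative_mult[OF has_vector_derivative_const
          has_vector_derivative_mult[OF a' c']]) simp
  also have "\<i> * of_real q * (a t * (\<i> * of_real r * cnj (a t) * b t) + (- \<i> * of_real p * b t * cnj (c t)) * c t)
     = (of_real (p * q) * (c t * cnj (c t)) - of_real (q * r) * (a t * cnj (a t))) * b t"
    by (simp add: algebra_simps)
  also have "\<dots> = of_real (p * q * w t - q * r * ((i2 - w t) * p / r)) * b t"
    unfolding aa cc by simp
  also have "p * q * w t - q * r * ((i2 - w t) * p / r) = \<kappa>^2 * (2 * w t - i2)"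
    using r_pos by (simp add: \<kappa> field_simps)
  finally show ?thesis by simp
qed

lemma c1': "(c1 has_vector_derivative of_real (\<kappa>^2) * of_real (2 * w t - i2 - i3) * c t) (at t)"
proof -
  have "(c1 has_vector_derivative \<i> * of_real r * (cnj (a t) * (\<i> * of_real q * a t * c t)
      + cnj (- \<i> * of_real p * b t * cnj (c t)) * b t)) (at t)"
    unfolding c1_def mult.assoc[of _ "cnj (a _)"]
    by (rule has_vector_derivative_eq_rhs, rule has_vector_derivative_mult[OF has_vector_derivative_const
          has_vector_derivative_mult[OF vector_derivative_cnj[OF a'] b']]) simp
  also have "\<i> * of_real r * (cnj (a t) * (\<i> * of_real q * a t * c t) + cnj (- \<i> * of_real p * b t * cnj (c t)) * b t)
     = - (of_real (r * q) * (a t * cnj (a t)) + of_real (r * p) * (b t * cnj (b t))) * c t"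
    by (simp add: algebra_simps)
  also have "\<dots> = of_real (- (r * q * ((i2 - w t) * p / r)) - r * p * ((i3 - w t) * q / r)) * c t"
    unfolding aa bb by simp
  also have "- (r * q * ((i2 - w t) * p / r)) - r * p * ((i3 - w t) * q / r) = \<kappa>^2 * (2 * w t - i2 - i3)"
    using r_pos by (simp add: \<kappa> field_simps)
  finally show ?thesis by simp
qed

end

section \<open>The orbit in terms of Weierstrass functions\<close>

locale euler_weierstrass = euler_orbit p q r a b c + weierstrass_real G2 G3 wp zt sg \<omega>1 \<omega>2 e1 e2 e3
  for p q r :: real and a b c :: "real \<Rightarrow> complex" and wp zt sg \<omega>1 \<omega>2 e1 e2 e3
begin

lemma ex_tau0: "\<exists>\<tau>0::real. \<forall>t. of_real (Y t) = wp (of_real (\<kappa> * t - \<tau>0) + \<omega>2)"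
  using ex_phase[OF Y' Y1' Y1_square] Y0_range[OF factor order] by blast

context
  fixes \<tau>0 :: real and x :: complex
  assumes Y_wp: "\<And>t. of_real (Y t) = wp (of_real (\<kappa> * t - \<tau>0) + \<omega>2)" and x: "x = - of_real \<tau>0 + \<omega>2"
begin

lemma argument: "of_real (\<kappa> * t - \<tau>0) + \<omega>2 = of_real (\<kappa> * t) + x"
  by (simp add: x)

lemma wp_argument: "wp (of_real (\<kappa> * t) + x) = of_real (Y t)"
  using Y_wp[of t] unfolding argument by simp

lemma argument_not_period: "of_real (\<kappa> * t) + x \<notin> periods"
  using line_not_period[of "\<kappa> * t - \<tau>0"] unfolding argument .

text \<open>At 0, \<open>i2\<close> and \<open>i3\<close> the cubic reduces to a multiple of
  \<open>h^2\<close>, so \<open>h = 0\<close> would turn \<open>\<mu>\<close> into a zero of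
  \<open>deriv wp\<close>, where the coefficients of the Lame functions have vanishing
  denominators.\<close>

lemma h_nonzero:
  assumes "\<not> is_pole wp \<mu>" "deriv wp \<mu> \<noteq> 0" "wp \<mu> = of_real (v - (i2 + i3) / 3)" "v * (v - i2) * (v - i3) = 0"
  shows "h \<noteq> 0"
proof
  assume "h = 0"
  have "(deriv wp \<mu>)^2 = of_real (4 * (v - (i2 + i3) / 3)^3 - G2 * (v - (i2 + i3) / 3) - G3)"
    using ode[OF assms(1)] by (simp add: assms(3))
  also have "\<dots> = 0" unfolding cubic_real using assms(4) \<open>h = 0\<close> by auto
  finally show False using assms(2) by simp
qed

text \<open>If \<open>wp\<close> took the value \<open>wp \<mu>\<close> on the orbit, then one of \<open>a\<close>, \<open>b\<close>, \<open>c\<close> would vanish there,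
  so that \<open>h = 0\<close> and \<open>\<mu>\<close> would be a half period.\<close>

lemma solution_component:
  assumes \<mu>: "\<not> is_pole wp \<mu>" "deriv wp \<mu> \<noteq> 0" "wp \<mu> = of_real (v - (i2 + i3) / 3)"
    and v: "v = i2 \<or> v = i3 \<or> v = 0"
    and u: "\<And>t. (u has_vector_derivative u1 t) (at t)"
    and u1: "\<And>t. (u1 has_vector_derivative of_real (\<kappa>^2) * of_real (2 * w t + v - i2 - i3) * u t) (at t)"
  shows "u t = (1/2 * lame_M wp x 1 \<mu> * u 0 - lame_N wp x \<mu> * (u1 0 / of_real \<kappa>)) * lame_y zt sg x 1 (of_real (\<kappa> * t)) \<mu>
    + (1/2 * lame_M wp x (- 1) \<mu> * u 0 + lame_N wp x \<mu> * (u1 0 / of_real \<kappa>)) * lame_y zt sg x (- 1) (of_real (\<kappa> * t)) \<mu>"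
proof -
  have h: "h \<noteq> 0" by (rule h_nonzero[OF \<mu>]) (use v in auto)
  have ne: "w t \<noteq> v" for t
  proof
    assume "w t = v"
    hence "a t = 0 \<or> b t = 0 \<or> c t = 0" using v moduli[of t] by (auto simp: w_def)
    thus False using zero_imp_h h by blast
  qed
  have "u t = (1/2 * lame_M wp x 1 \<mu> * u 0 - 1 * lame_N wp x \<mu> * (u1 0 / of_real \<kappa>)) * lame_y zt sg x 1 (of_real (\<kappa> * t)) \<mu>
    + (1/2 * lame_M wp x (- 1) \<mu> * u 0 - (- 1) * lame_N wp x \<mu> * (u1 0 / of_real \<kappa>)) * lame_y zt sg x (- 1) (of_real (\<kappa> * t)) \<mu>"
  proof (rule lame_solution)
    show "\<kappa> \<noteq> 0" using \<kappa> by simp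
    show "(u1 has_vector_derivative of_real (\<kappa>^2) * (2 * wp (of_real (\<kappa> * t) + x) + wp \<mu>) * u t) (at t)" for t
    proof -
      have "of_real (2 * w t + v - i2 - i3) = 2 * wp (of_real (\<kappa> * t) + x) + wp \<mu>"
        unfolding wp_argument \<mu>(3) Y_def by (simp add: field_simps)
      thus ?thesis using u1[of t] by simp
    qed
    show "wp (of_real (\<kappa> * t) + x) \<noteq> wp \<mu>" for t
      unfolding wp_argument \<mu>(3) Y_def using ne[of t] by (simp only: of_real_eq_iff)
  qed (use u \<mu> argument_not_period is_pole_iff in auto)
  thus ?thesis by simp
qed

theorem solution_a:
  assumes "\<not> is_pole wp \<mu>" "deriv wp \<mu> \<noteq> 0" "wp \<mu> = of_real (2/3 * i2 - 1/3 * i3)"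
  defines "A \<equiv> \<lambda>s. 1/2 * lame_M wp x s \<mu> * a 0 + s * \<i> * lame_N wp x \<mu> * of_real (sqrt (p / q)) * b 0 * cnj (c 0)"
  shows "a t = A 1 * lame_y zt sg x 1 (of_real (\<kappa> * t)) \<mu> + A (- 1) * lame_y zt sg x (- 1) (of_real (\<kappa> * t)) \<mu>"
proof -
  \<comment> \<open>Lame's equation runs in the time \<open>\<kappa> * t\<close>, so the initial
    velocity enters divided by \<open>\<kappa>\<close>; this is the origin of the square root in the
    coefficient, and the factor \<open>- \<i>\<close> of \<open>a1\<close> gives its sign.\<close>
  have "p / \<kappa> = sqrt (p / q)"
    using pos by (simp add: \<kappa>_def real_sqrt_mult real_sqrt_divide field_simps)
  hence k: "of_real p / of_real \<kappa> = (of_real (sqrt (p / q)) :: complex)" by (metis of_real_divide)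
  have e: "a1 0 / of_real \<kappa> = - \<i> * of_real (sqrt (p / q)) * b 0 * cnj (c 0)"
    unfolding k[symmetric] a1_def by simp
  have m: "wp \<mu> = of_real (i2 - (i2 + i3) / 3)" unfolding assms(3) by (simp add: field_simps)
  have d: "(a has_vector_derivative a1 t) (at t)" for t using a' by (simp only: a1_def)
  have d1: "(a1 has_vector_derivative of_real (\<kappa>^2) * of_real (2 * w t + i2 - i2 - i3) * a t) (at t)" for t
    using a1'[of t] by simp
  show ?thesis unfolding A_def
    by (rule trans[OF solution_component[OF assms(1,2) m disjI1[OF refl] d d1, of t, unfolded e]]) (simp add: algebra_simps)
qed

theorem solution_b:
  assumes "\<not> is_pole wp \<mu>" "deriv wp \<mu> \<noteq> 0" "wp \<mu> = of_real (- 1/3 * i2 + 2/3 * i3)"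
  defines "A \<equiv> \<lambda>s. 1/2 * lame_M wp x s \<mu> * b 0 - s * \<i> * lame_N wp x \<mu> * of_real (sqrt (q / p)) * a 0 * c 0"
  shows "b t = A 1 * lame_y zt sg x 1 (of_real (\<kappa> * t)) \<mu> + A (- 1) * lame_y zt sg x (- 1) (of_real (\<kappa> * t)) \<mu>"
proof -
  have "q / \<kappa> = sqrt (q / p)"
    using pos by (simp add: \<kappa>_def real_sqrt_mult real_sqrt_divide field_simps)
  hence k: "of_real q / of_real \<kappa> = (of_real (sqrt (q / p)) :: complex)" by (metis of_real_divide)
  have e: "b1 0 / of_real \<kappa> = \<i> * of_real (sqrt (q / p)) * a 0 * c 0"
    unfolding k[symmetric] b1_def by simp
  have m: "wp \<mu> = of_real (i3 - (i2 + i3) / 3)" unfolding assms(3) by (simp add: field_simps)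
  have d: "(b has_vector_derivative b1 t) (at t)" for t using b' by (simp only: b1_def)
  have d1: "(b1 has_vector_derivative of_real (\<kappa>^2) * of_real (2 * w t + i3 - i2 - i3) * b t) (at t)" for t
    using b1'[of t] by simp
  show ?thesis unfolding A_def
    by (rule trans[OF solution_component[OF assms(1,2) m disjI2[OF disjI1[OF refl]] d d1, of t, unfolded e]]) (simp add: algebra_simps)
qed

theorem solution_c:
  assumes "\<not> is_pole wp \<mu>" "deriv wp \<mu> \<noteq> 0" "wp \<mu> = of_real (- 1/3 * i2 - 1/3 * i3)"
  defines "A \<equiv> \<lambda>s. 1/2 * lame_M wp x s \<mu> * c 0 - s * \<i> * lame_N wp x \<mu> * of_real (r / sqrt (q * p)) * cnj (a 0) * b 0"
  shows "c t = A 1 * lame_y zt sg x 1 (of_real (\<kappa> * t)) \<mu> + A (- 1) * lame_y zt sg x (- 1) (of_real (\<kappa> * t)) \<mu>"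
proof -
  have "r / \<kappa> = r / sqrt (q * p)" by (simp add: \<kappa>_def)
  hence k: "of_real r / of_real \<kappa> = (of_real (r / sqrt (q * p)) :: complex)" by (metis of_real_divide)
  have e: "c1 0 / of_real \<kappa> = \<i> * of_real (r / sqrt (q * p)) * cnj (a 0) * b 0"
    unfolding k[symmetric] c1_def by simp
  have m: "wp \<mu> = of_real (0 - (i2 + i3) / 3)" unfolding assms(3) by (simp add: field_simps)
  have d: "(c has_vector_derivative c1 t) (at t)" for t using c' by (simp only: c1_def)
  have d1: "(c1 has_vector_derivative of_real (\<kappa>^2) * of_real (2 * w t + 0 - i2 - i3) * c t) (at t)" for t
    using c1'[of t] by simp
  show ?thesis unfolding A_def
    by (rule trans[OF solution_component[OF assms(1,2) m disjI2[OF disjI2[OF refl]] d d1, of t, unfolded e]]) (simp add: algebra_simps)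
qed

end

end

section \<open>Lifts and moving eigenframes\<close>

lemma has_vector_derivative_vecI:
  fixes f :: "real \<Rightarrow> 'a::real_normed_vector^'n"
  assumes "\<And>i. ((\<lambda>t. f t $ i) has_vector_derivative f' $ i) (at t within S)"
  shows "(f has_vector_derivative f') (at t within S)"
proof -
  have "((\<lambda>s. (1 / norm (s - t)) *\<^sub>R (f s - (f t + (s - t) *\<^sub>R f'))) \<longlongrightarrow> 0) (at t within S)"
    using assms unfolding has_vector_derivative_def has_derivative_within
    by (intro vec_tendstoI) simp
  thus ?thesis unfolding has_vector_derivative_def has_derivative_within
    by (simp add: bounded_linear_scaleR_left)
qed

lemma has_vector_derivative_matrixI:
  fixes f :: "real \<Rightarrow> complex^'n^'m"
  shows "(\<And>i j. ((\<lambda>t. f t $ i $ j) has_vector_derivative f' $ i $ j) (at t within S)) \<Longrightarrow>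
    (f has_vector_derivative f') (at t within S)"
  by (intro has_vector_derivative_vecI) auto

lemma has_vector_derivative_entry:
  fixes f :: "real \<Rightarrow> complex^'n^'m"
  assumes "(f has_vector_derivative f') F"
  shows "((\<lambda>t. f t $ i $ j) has_vector_derivative f' $ i $ j) F"
  by (intro bounded_linear.has_vector_derivative[OF bounded_linear_vec_nth] assms)

lemma bounded_bilinear_matrix_mult:
  "bounded_bilinear ((**) :: complex^'n^'m \<Rightarrow> complex^'l^'n \<Rightarrow> complex^'l^'m)"
  unfolding bilinear_conv_bounded_bilinear[symmetric] bilinear_def
  by (auto intro!: linearI simp: matrix_matrix_mult_def vec_eq_iff sum.distrib algebra_simps scaleR_sum_right)

lemmas has_vector_derivative_matrix_mult = bounded_bilinear.has_vector_derivative[OF bounded_bilinear_matrix_mult]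

lemma bounded_linear_dagger: "bounded_linear (dagger :: complex^'n^'m \<Rightarrow> _)"
  unfolding linear_conv_bounded_linear[symmetric]
  by (auto intro!: linearI simp: dagger_def transpose_def vec_eq_iff)

lemmas has_vector_derivative_dagger = bounded_linear.has_vector_derivative[OF bounded_linear_dagger]

lemma bounded_linear_matrix_scale: "bounded_linear (matrix_scale z :: complex^'n^'m \<Rightarrow> _)"
  unfolding linear_conv_bounded_linear[symmetric]
  by (auto intro!: linearI simp: matrix_scale_def vec_eq_iff algebra_simps)

lemmas has_vector_derivative_matrix_scale = bounded_linear.has_vector_derivative[OF bounded_linear_matrix_scale]

lemma dagger_nth [simp]: "dagger A $ i $ j = cnj (A $ j $ i)"
  by (simp add: dagger_def transpose_def)

lemma matrix_scale_nth [simp]: "matrix_scale z A $ i $ j = z * A $ i $ j"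
  by (simp add: matrix_scale_def)

lemma dagger_dagger [simp]: "dagger (dagger A) = A"
  by (simp add: vec_eq_iff)

lemma dagger_mat_1 [simp]: "dagger (mat 1) = mat 1"
  by (simp add: vec_eq_iff mat_def)

lemma dagger_mult: "dagger (A ** B) = dagger B ** dagger A"
  by (simp add: vec_eq_iff matrix_matrix_mult_def mult.commute)

lemma dagger_diff: "dagger (A - B) = dagger A - dagger B"
  and dagger_scale: "dagger (matrix_scale z A) = matrix_scale (cnj z) (dagger A)"
  by (simp_all add: vec_eq_iff)

lemma scale_mult_left: "matrix_scale z A ** B = matrix_scale z (A ** B)"
  and scale_mult_right: "A ** matrix_scale z B = matrix_scale z (A ** B)"
  by (simp_all add: vec_eq_iff matrix_matrix_mult_def sum_distrib_left mult_ac)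

lemma scale_scale: "matrix_scale z (matrix_scale u A) = matrix_scale (z * u) A"
  and scale_one: "matrix_scale 1 A = A"
  and scale_diff: "matrix_scale z (A - B) = matrix_scale z A - matrix_scale z B"
  and scale_minus: "matrix_scale (- z) A = - matrix_scale z A"
  by (simp_all add: vec_eq_iff algebra_simps)

lemma mult_diff_left: "(A - B) ** C = A ** C - B ** C" for A B :: "complex^'n^'m" and C :: "complex^'l^'n"
  by (simp add: vec_eq_iff matrix_matrix_mult_def left_diff_distrib sum_subtractf)

lemma mult_diff_right: "A ** (B - C) = A ** B - A ** C" for A :: "complex^'n^'m" and B C :: "complex^'l^'n"
  by (simp add: vec_eq_iff matrix_matrix_mult_def right_diff_distrib sum_subtractf)

lemma unitary_mult_dagger: "unitary_matrix U \<Longrightarrow> U ** dagger U = mat 1"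
  unfolding unitary_matrix_def by (rule matrix_left_right_inverse[THEN iffD1])

lemma unitary_cancel:
  assumes "unitary_matrix U"
  shows "dagger U ** (U ** A) = A" "U ** (dagger U ** A) = A" "(A ** U) ** dagger U = A" "(A ** dagger U) ** U = A"
  using assms unitary_mult_dagger[OF assms] unfolding unitary_matrix_def
  by (simp_all add: matrix_mul_assoc) (simp_all flip: matrix_mul_assoc)

lemma unitary_mult: "unitary_matrix U \<Longrightarrow> unitary_matrix V \<Longrightarrow> unitary_matrix (U ** V)"
  unfolding unitary_matrix_def dagger_mult by (metis matrix_mul_assoc matrix_mul_lid)

text \<open>The coefficient \<open>- \<i> J\<close> is skew-Hermitian, so the two terms of the
  product rule cancel. Applied to one curve twice this gives unitarity, applied to two curves it
  gives uniqueness of lifts.\<close>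

lemma lift_quotient_const:
  assumes U: "\<And>t. (U has_vector_derivative matrix_scale (- \<i>) (U t ** J t)) (at t)"
    and V: "\<And>t. (V has_vector_derivative matrix_scale (- \<i>) (V t ** J t)) (at t)"
    and J: "\<And>t. dagger (J t) = (J t :: complex^'n^'n)"
  shows "U t ** dagger (V t) = U 0 ** dagger (V 0)"
proof (rule vector_derivative_zero_imp_const[of "\<lambda>t. U t ** dagger (V t)"])
  fix t
  have "U t ** dagger (matrix_scale (- \<i>) (V t ** J t)) + matrix_scale (- \<i>) (U t ** J t) ** dagger (V t) = 0"
    by (simp only: dagger_scale dagger_mult J scale_mult_left scale_mult_right matrix_mul_assoc
        complex_cnj_minus complex_cnj_i minus_minus) (simp add: scale_minus)
  with has_vector_derivative_matrix_mult[OF U[of t] has_vector_derivative_dagger[OF V[of t]]]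
  show "((\<lambda>t. U t ** dagger (V t)) has_vector_derivative 0) (at t)" by simp
qed

text \<open>The bound on \<open>J\<close> provides the global Lipschitz constant for
  \<open>global_ode_existence\<close>; unitarity follows from
  \<open>lift_quotient_const\<close>.\<close>

lemma ex_unitary_lift:
  fixes J :: "real \<Rightarrow> complex^'n^'n"
  assumes J: "\<And>t. dagger (J t) = J t" and cont: "continuous_on UNIV J" and B: "\<And>t. norm (J t) \<le> B"
  obtains V where "V 0 = mat 1" "\<And>t. (V has_vector_derivative matrix_scale (- \<i>) (V t ** J t)) (at t)"
    "\<And>t. unitary_matrix (V t)"
proof -
  interpret mult: bounded_bilinear "(**) :: complex^'n^'n \<Rightarrow> complex^'n^'n \<Rightarrow> complex^'n^'n"
    by (rule bounded_bilinear_matrix_mult)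
  obtain K where K: "K > 0" "\<And>A C. norm (A ** C) \<le> norm (A :: complex^'n^'n) * norm (C :: complex^'n^'n) * K"
    using mult.pos_bounded by blast
  define J' where "J' = (\<lambda>t. matrix_scale (- \<i>) (J t))"
  obtain M where M: "M > 0" "\<And>A. norm (matrix_scale (- \<i>) A) \<le> norm (A :: complex^'n^'n) * M"
    using bounded_linear.pos_bounded[OF bounded_linear_matrix_scale] by blast
  have "B \<ge> 0" using B[of 0] norm_ge_zero order_trans by blast
  have B': "norm (J' t) \<le> B * M" for t
    unfolding J'_def by (rule order_trans[OF M(2) mult_right_mono[OF B]]) (use M in simp)
  obtain V where V0: "V 0 = mat 1" and V': "\<And>t. (V has_vector_derivative V t ** J' t) (at t)"
  proof (rule global_ode_existence[of "\<lambda>t V. V ** J' t" "B * M * K" "mat 1"])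
    show "continuous_on UNIV (\<lambda>s. x s ** J' s)" if "continuous_on UNIV x"
      for x :: "real \<Rightarrow> complex^'n^'n"
      unfolding J'_def
      by (rule mult.continuous_on[OF that bounded_linear.continuous_on[OF bounded_linear_matrix_scale cont]])
    show "norm (u ** J' s - v ** J' s) \<le> B * M * K * norm (u - v)" for s and u v :: "complex^'n^'n"
    proof -
      have "norm (u ** J' s - v ** J' s) \<le> norm (u - v) * norm (J' s) * K"
        using K(2)[of "u - v" "J' s"] by (simp only: mult.diff_left)
      also have "\<dots> \<le> norm (u - v) * (B * M) * K"
        using B'[of s] K(1) by (intro mult_right_mono mult_left_mono) auto
      finally show ?thesis by (simp add: mult_ac)
    qed
    show "0 \<le> B * M * K" using \<open>B \<ge> 0\<close> K M by simp
  qed blast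
  have V: "V 0 = mat 1" "\<And>t. (V has_vector_derivative matrix_scale (- \<i>) (V t ** J t)) (at t)"
    using V0 V' by (simp_all only: J'_def scale_mult_right)
  have "V t ** dagger (V t) = mat 1" for t
    using lift_quotient_const[OF V(2) V(2) J, of t] by (simp add: V(1))
  hence "unitary_matrix (V t)" for t
    unfolding unitary_matrix_def by (rule matrix_left_right_inverse[THEN iffD1])
  thus thesis using that V by blast
qed

lemma lifts_geodesic_of_iff:
  fixes J :: "real \<Rightarrow> complex^3^3"
  assumes J: "\<And>t. dagger (J t) = J t"
    and V: "V 0 = mat 1" "\<And>t. (V has_vector_derivative matrix_scale (- \<i>) (V t ** J t)) (at t)"
      "\<And>t. unitary_matrix (V t)"
    and U0: "unitary_matrix (U 0)"
  shows "lifts_geodesic_of J U \<longleftrightarrow> (\<forall>t. U t = U 0 ** V t)"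
proof
  assume L: "lifts_geodesic_of J U"
  have U: "(U has_vector_derivative matrix_scale (- \<i>) (U t ** J t)) (at t)" for t
  proof -
    obtain U' where U': "(U has_vector_derivative U') (at t)" "dagger (U t) ** U' = matrix_scale (- \<i>) (J t)" "unitary_matrix (U t)"
      using L unfolding lifts_geodesic_of_def by blast
    have "U' = U t ** (dagger (U t) ** U')" using unitary_cancel[OF U'(3)] by simp
    also have "\<dots> = matrix_scale (- \<i>) (U t ** J t)" by (simp add: U'(2) scale_mult_right)
    finally show ?thesis using U'(1) by simp
  qed
  have q: "U t ** dagger (V t) = U 0" for t using lift_quotient_const[OF U V(2) J, of t] by (simp add: V(1))
  show "\<forall>t. U t = U 0 ** V t"
  proof
    show "U t = U 0 ** V t" for t using unitary_cancel(4)[OF V(3), of "U t" t] by (simp add: q)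
  qed
next
  assume eq: "\<forall>t. U t = U 0 ** V t"
  hence U_eq: "U = (\<lambda>t. U 0 ** V t)" by blast
  show "lifts_geodesic_of J U"
    unfolding lifts_geodesic_of_def
  proof (intro allI conjI exI)
    fix t
    show un: "unitary_matrix (U t)" using eq[rule_format, of t] unitary_mult[OF U0 V(3), of t] by simp
    have "(U has_vector_derivative U 0 ** matrix_scale (- \<i>) (V t ** J t)) (at t)"
      by (subst U_eq) (rule bounded_linear.has_vector_derivative[OF bounded_bilinear.bounded_linear_right[OF bounded_bilinear_matrix_mult] V(2)])
    moreover have "U 0 ** matrix_scale (- \<i>) (V t ** J t) = matrix_scale (- \<i>) (U t ** J t)"
      by (simp add: eq[rule_format, of t] scale_mult_right matrix_mul_assoc)
    ultimately show "(U has_vector_derivative matrix_scale (- \<i>) (U t ** J t)) (at t)" by simp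
    show "dagger (U t) ** matrix_scale (- \<i>) (U t ** J t) = matrix_scale (- \<i>) (J t)"
      using unitary_cancel(1)[OF un] by (simp add: scale_mult_right)
  qed
qed

section \<open>Diagonal matrices, phases and moving eigenframes\<close>

definition diag :: "('n \<Rightarrow> complex) \<Rightarrow> complex^'n^'n" where
  "diag d = (\<chi> i j. if i = j then d i else 0)"

lemma diag_nth [simp]: "diag d $ i $ j = (if i = j then d i else 0)"
  by (simp add: diag_def)

lemma mult_diag_nth [simp]: "(A ** diag d) $ i $ j = A $ i $ j * d j"
  by (simp add: matrix_matrix_mult_def if_distrib[of "(*) _"] cong: if_cong)

lemma diag_mult_nth [simp]: "(diag d ** A) $ i $ j = d i * A $ i $ j"
  by (simp add: matrix_matrix_mult_def if_distrib[of "\<lambda>x. x * _"] cong: if_cong)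

lemma matrix_pow_diag: "matrix_pow (diag d) k = diag (\<lambda>i. d i ^ k)"
  by (induction k) (simp_all add: vec_eq_iff mat_def)

lemma matrix_exp_diag: "matrix_exp (diag d) = diag (\<lambda>i. exp (d i))"
proof -
  have "(\<lambda>k. (1 / fact k) *\<^sub>R matrix_pow (diag d) k) sums diag (\<lambda>i. exp (d i))"
    unfolding sums_def
  proof (intro vec_tendstoI)
    fix i j
    have "(\<lambda>k. (1 / fact k) *\<^sub>R (d i ^ k)) sums exp (d i)"
      using exp_converges[of "d i"] by (simp add: divide_inverse)
    thus "(\<lambda>n. (\<Sum>k<n. (1 / fact k) *\<^sub>R matrix_pow (diag d) k) $ i $ j) \<longlonglongrightarrow> diag (\<lambda>i. exp (d i)) $ i $ j"
      by (auto simp: matrix_pow_diag sums_def)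
  qed
  thus ?thesis unfolding matrix_exp_def by (rule sums_unique[symmetric])
qed

text \<open>A phase that is differentiable everywhere has a differentiable argument, even though its
  derivative need not be continuous.\<close>

lemma phase_lift:
  fixes u :: "real \<Rightarrow> complex" and q :: "real \<Rightarrow> real"
  assumes u: "\<And>t. (u has_vector_derivative \<i> * of_real (q t) * u t) (at t)" and nz: "\<And>t. u t \<noteq> 0" and "u 0 = 1"
  obtains \<theta> where "\<theta> 0 = 0" "\<And>t. (\<theta> has_vector_derivative of_real (q t)) (at t)" "\<And>t. u t = exp (\<i> * \<theta> t)"
proof -
  have "continuous_on UNIV u" by (rule continuous_on_vector_derivative[OF u])
  then obtain g where g: "continuous_on UNIV g" "\<And>t. u t = exp (g t)"
    using continuous_logarithm_on_contractible[of UNIV u] nz convex_imp_contractible[of "UNIV :: real set"] by auto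
  have g': "(g has_vector_derivative \<i> * of_real (q t)) (at t)" for t
  proof -
    have "isCont g t" using g(1) by (simp add: continuous_on_eq_continuous_at)
    \<comment> \<open>Within distance \<open>pi\<close> of \<open>g t\<close> the principal
      logarithm inverts the exponential, so near \<open>t\<close> the continuous \<open>g\<close>
      equals a constant plus the logarithm of \<open>u s / u t\<close> and inherits its
      derivative.\<close>
    then obtain d where d: "d > 0" "\<And>s. dist s t < d \<Longrightarrow> dist (g s) (g t) < pi"
      unfolding continuous_at_eps_delta using pi_gt_zero by blast
    have eq: "g t + Ln (u s / u t) = g s" if "s \<in> ball t d" for s
    proof -
      have "\<bar>Im (g s - g t)\<bar> \<le> cmod (g s - g t)" by (rule abs_Im_le_cmod)
      also have "\<dots> < pi" using d(2)[of s] that by (simp add: dist_norm dist_commute)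
      finally have "Ln (exp (g s - g t)) = g s - g t" by (intro Ln_exp) auto
      thus ?thesis by (simp add: g(2) exp_diff)
    qed
    have ut: "u t \<noteq> 0" using nz by simp
    have "((\<lambda>s. u s / u t) has_vector_derivative (\<i> * of_real (q t) * u t) / u t) (at t)"
      by (rule has_vector_derivative_divide[OF u])
    hence 1: "((\<lambda>s. u s / u t) has_vector_derivative \<i> * of_real (q t)) (at t)" using ut by simp
    have 2: "(Ln has_field_derivative 1) (at (u t / u t))"
      using has_field_derivative_Ln[of 1] ut by simp
    have "((\<lambda>s. Ln (u s / u t)) has_vector_derivative \<i> * of_real (q t)) (at t)"
      using field_vector_diff_chain_at[OF 1 2] by (simp add: o_def)
    hence "((\<lambda>s. g t + Ln (u s / u t)) has_vector_derivative \<i> * of_real (q t)) (at t)"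
      using has_vector_derivative_add[OF has_vector_derivative_const] by fastforce
    thus ?thesis
      by (rule has_vector_derivative_transform_within_open[where S="ball t d"]) (use d eq in auto)
  qed
  \<comment> \<open>The condition \<open>u 0 = 1\<close> gives \<open>exp (g 0) = 1\<close>, so
    subtracting \<open>g 0\<close> normalizes the argument without changing its exponential.\<close>
  show thesis
  proof (rule that[of "\<lambda>t. - \<i> * (g t - g 0)"])
    show "((\<lambda>t. - \<i> * (g t - g 0)) has_vector_derivative of_real (q t)) (at t)" for t
      by (rule has_vector_derivative_eq_rhs, rule has_vector_derivative_mult[OF has_vector_derivative_const
            has_vector_derivative_diff[OF g' has_vector_derivative_const]]) simp
    have "exp (g 0) = 1" using g(2)[of 0] \<open>u 0 = 1\<close> by simp
    thus "u t = exp (\<i> * (- \<i> * (g t - g 0)))" for t by (simp add: g(2) exp_diff)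
  qed simp
qed

text \<open>The gauge integral recovers a function from its everywhere defined derivative; this
  covers \<open>frame_Q\<close>, whose regularity is that of the derivative of a differentiable
  frame.\<close>

lemma oriented_integral_derivative:
  fixes F :: "real \<Rightarrow> 'a::euclidean_space"
  assumes "\<And>t. (F has_vector_derivative f t) (at t)"
  shows "oriented_integral s t f = F t - F s"
proof -
  have "integral {x..y} f = F y - F x" if "x \<le> y" for x y
    by (rule integral_unique, rule fundamental_theorem_of_calculus[OF that])
       (rule has_vector_derivative_at_within[OF assms])
  thus ?thesis by (auto simp: oriented_integral_def)
qed

text \<open>Every eigenvalue is one of the diagonal entries, so as many distinct eigenvalues as rows
  leave no room for a repeated entry.\<close>

lemma simple_spectrum_diag_inj:
  assumes "simple_spectrum A" and A: "A = E ** diag d ** dagger E" and E: "unitary_matrix E"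
  shows "inj d"
proof -
  have sub: "{z. \<exists>v. v \<noteq> 0 \<and> A *v v = z *s v} \<subseteq> range d"
  proof clarify
    fix z v assume v: "v \<noteq> 0" "A *v v = z *s v"
    define w where "w = dagger E *v v"
    have Ew: "E *v w = v"
      by (simp add: w_def matrix_vector_mul_assoc unitary_mult_dagger[OF E])
    hence "w \<noteq> 0" using v(1) by auto
    then obtain i where i: "w $ i \<noteq> 0" by (auto simp: vec_eq_iff)
    have "diag d *v w = dagger E *v (A *v v)"
      unfolding A w_def matrix_vector_mul_assoc by (simp add: unitary_cancel[OF E] flip: matrix_mul_assoc)
    also have "\<dots> = z *s w" unfolding v(2) w_def
      by (simp add: vec_eq_iff matrix_vector_mult_def sum_distrib_left mult_ac)
    finally have "(diag d *v w) $ i = z * w $ i" by simp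
    moreover have "(diag d *v w) $ i = d i * w $ i"
      by (simp add: matrix_vector_mult_def if_distrib[of "\<lambda>x. x * _"] cong: if_cong)
    ultimately have "z = d i" using i by simp
    thus "z \<in> range d" by simp
  qed
  have "CARD('a) = card {z. \<exists>v. v \<noteq> 0 \<and> A *v v = z *s v}"
    using assms(1) by (simp add: simple_spectrum_def)
  also have "\<dots> \<le> card (range d)" by (rule card_mono[OF _ sub]) simp
  finally have "card (range d) = CARD('a)" using card_image_le[of UNIV d] by simp
  thus "inj d" by (simp add: eq_card_imp_inj_on)
qed

text \<open>In the moving frame the Lax equation reads \<open>D' = D X - X D\<close> with
  \<open>X = \<i> Q\<close>. As \<open>D\<close> is diagonal, the diagonal of this identity says
  that the eigenvalues are constant, and the rest says that \<open>X\<close> is diagonal.\<close>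

theorem eigenframe_flow:
  fixes L J E V :: "real \<Rightarrow> complex^3^3"
  assumes Lh: "\<And>t. dagger (L t) = L t" and Jh: "\<And>t. dagger (J t) = J t"
    and L': "\<And>t. (L has_vector_derivative matrix_scale \<i> (J t ** L t - L t ** J t)) (at t)"
    and simple: "\<And>t. simple_spectrum (L t)" and E: "eigenframe L E"
    and V: "V 0 = mat 1" "\<And>t. (V has_vector_derivative matrix_scale (- \<i>) (V t ** J t)) (at t)"
  shows "\<exists>\<Lambda>. diagonal_matrix \<Lambda> \<and> (\<forall>t. L t = E t ** \<Lambda> ** dagger (E t))"
    and "frame_V J E t = V t"
proof -
  have un: "unitary_matrix (E t)" for t using E by (simp add: eigenframe_def)
  note cancel = unitary_cancel[OF un]
  define E' where "E' = (\<lambda>t. vector_derivative E (at t))"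
  have E': "(E has_vector_derivative E' t) (at t)" for t
    using E by (simp add: eigenframe_def E'_def vector_derivative_works)
  have "\<forall>t. \<exists>d. L t ** E t = E t ** diag d"
  proof
    fix t
    have "\<forall>j. \<exists>z. L t *v column j (E t) = z *s column j (E t)" using E by (simp add: eigenframe_def)
    then obtain d where d: "\<And>j. L t *v column j (E t) = d j *s column j (E t)" by metis
    have "(L t ** E t) $ i $ j = (E t ** diag d) $ i $ j" for i j
    proof -
      have "(L t ** E t) $ i $ j = (L t *v column j (E t)) $ i"
        by (simp add: matrix_matrix_mult_def matrix_vector_mult_def column_def)
      also have "\<dots> = d j * E t $ i $ j" unfolding d by (simp add: column_def)
      finally show ?thesis by (simp add: mult.commute)
    qed
    thus "\<exists>d. L t ** E t = E t ** diag d" by (auto simp: vec_eq_iff)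
  qed
  \<comment> \<open>The eigenvalues are chosen separately at each time; they depend differentiably
    on \<open>t\<close> because they form the diagonal of \<open>D t\<close>.\<close>
  then obtain d where LE: "\<And>t. L t ** E t = E t ** diag (d t)" by metis
  define D where "D = (\<lambda>t. dagger (E t) ** (L t ** E t))"
  have D: "D t = diag (d t)" for t by (simp add: D_def LE cancel)
  have EL: "dagger (E t) ** L t = D t ** dagger (E t)" for t
    by (simp add: D_def matrix_mul_assoc cancel)
  define K Jt X where "K = (\<lambda>t. dagger (E t) ** E' t)" and "Jt = (\<lambda>t. dagger (E t) ** (J t ** E t))"
    and "X = (\<lambda>t. K t - matrix_scale \<i> (Jt t))"
  have skew: "dagger (E' t) ** E t = - K t" for t
  proof -
    have "((\<lambda>t. dagger (E t) ** E t) has_vector_derivative dagger (E t) ** E' t + dagger (E' t) ** E t) (at t)"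
      by (rule has_vector_derivative_matrix_mult[OF has_vector_derivative_dagger[OF E'] E'])
    moreover have "(\<lambda>t. dagger (E t) ** E t) = (\<lambda>_. mat 1)" using un by (simp add: unitary_matrix_def)
    ultimately have "dagger (E t) ** E' t + dagger (E' t) ** E t = 0"
      by (metis has_vector_derivative_const vector_derivative_unique_at)
    thus ?thesis by (simp add: K_def add_eq_0_iff)
  qed
  have D': "(D has_vector_derivative D t ** X t - X t ** D t) (at t)" for t
  proof -
    have "(D has_vector_derivative dagger (E t) ** (L t ** E' t + matrix_scale \<i> (J t ** L t - L t ** J t) ** E t)
        + dagger (E' t) ** (L t ** E t)) (at t)"
      unfolding D_def
      by (intro has_vector_derivative_matrix_mult has_vector_derivative_dagger E' L')
    also have "dagger (E' t) ** (L t ** E t) = - (K t ** D t)"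
      by (simp add: LE D matrix_mul_assoc skew) (simp add: vec_eq_iff)
    also have "dagger (E t) ** (L t ** E' t + matrix_scale \<i> (J t ** L t - L t ** J t) ** E t)
        = D t ** K t + matrix_scale \<i> (Jt t ** D t - D t ** Jt t)"
    proof -
      have "dagger (E t) ** (L t ** E' t) = D t ** K t"
        unfolding K_def matrix_mul_assoc EL by (simp flip: matrix_mul_assoc)
      moreover have "dagger (E t) ** ((J t ** L t) ** E t) = Jt t ** D t"
        by (simp only: Jt_def D matrix_mul_assoc[symmetric] LE)
      moreover have "dagger (E t) ** ((L t ** J t) ** E t) = D t ** Jt t"
        unfolding Jt_def matrix_mul_assoc EL by (simp flip: matrix_mul_assoc)
      ultimately show ?thesis
        by (simp add: scale_mult_left scale_mult_right matrix_add_ldistrib mult_diff_left mult_diff_right)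
    qed
    also have "D t ** K t + matrix_scale \<i> (Jt t ** D t - D t ** Jt t) + - (K t ** D t) = D t ** X t - X t ** D t"
      by (simp add: X_def mult_diff_left mult_diff_right scale_mult_left scale_mult_right scale_diff)
    finally show ?thesis .
  qed
  have entry: "(D t ** X t - X t ** D t) $ i $ j = (d t i - d t j) * X t $ i $ j" for t i j
    by (simp add: D algebra_simps)
  have d_const: "d t j = d 0 j" for t j
  proof (rule vector_derivative_zero_imp_const[of "\<lambda>t. d t j"])
    fix t
    show "((\<lambda>t. d t j) has_vector_derivative 0) (at t)"
      using has_vector_derivative_entry[OF D'[of t], of j j] unfolding entry by (simp add: D)
  qed
  have L_eq: "L t = E t ** diag (d t) ** dagger (E t)" for t
    by (simp add: LE[symmetric] cancel)
  show "\<exists>\<Lambda>. diagonal_matrix \<Lambda> \<and> (\<forall>t. L t = E t ** \<Lambda> ** dagger (E t))"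
  proof (intro exI conjI allI)
    show "diagonal_matrix (diag (d 0))" by (simp add: diagonal_matrix_def)
    show "L t = E t ** diag (d 0) ** dagger (E t)" for t
    proof -
      have e: "d t = d 0" using d_const by blast
      show ?thesis using L_eq[of t] by (simp only: e)
    qed
  qed
  have X_off: "X t $ i $ j = 0" if "i \<noteq> j" for t i j
  proof -
    have "(\<lambda>t. D t $ i $ j) = (\<lambda>_. 0)" using that by (simp add: D)
    hence "((\<lambda>t. D t $ i $ j) has_vector_derivative 0) (at t)" by simp
    from vector_derivative_unique_at[OF this has_vector_derivative_entry[OF D'[of t], of i j]]
    have "(d t i - d t j) * X t $ i $ j = 0" by (simp only: entry)
    moreover have "d t i \<noteq> d t j"
      using simple_spectrum_diag_inj[OF simple L_eq un, of t] that by (auto dest: injD)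
    ultimately show ?thesis by simp
  qed
  define q where "q = (\<lambda>j t. Im (X t $ j $ j))"
  have X_skew: "dagger (X t) = - X t" for t
  proof -
    have "dagger (K t) = - K t" using skew[of t] by (simp add: K_def dagger_mult)
    moreover have "dagger (Jt t) = Jt t" by (simp add: Jt_def dagger_mult Jh matrix_mul_assoc)
    ultimately show ?thesis by (simp add: X_def dagger_diff dagger_scale scale_minus)
  qed
  have X_diag: "X t = diag (\<lambda>j. \<i> * of_real (q j t))" for t
  proof -
    have "X t $ j $ j = \<i> * of_real (q j t)" for j
      using arg_cong[OF X_skew[of t], of "\<lambda>A. A $ j $ j"] by (simp add: q_def complex_eq_iff)
    thus ?thesis using X_off by (simp add: vec_eq_iff)
  qed
  have Q: "frame_Q J E t = diag (\<lambda>j. of_real (q j t))" for t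
  proof -
    have "frame_Q J E t = matrix_scale (- \<i>) (X t)"
      by (simp add: frame_Q_def X_def K_def Jt_def E'_def scale_diff scale_scale scale_one matrix_mul_assoc)
    thus ?thesis unfolding X_diag by (simp add: vec_eq_iff)
  qed
  define M where "M = (\<lambda>t. dagger (E 0) ** (V t ** E t))"
  have M': "(M has_vector_derivative M t ** X t) (at t)" for t
  proof -
    have "(M has_vector_derivative dagger (E 0) ** (V t ** E' t + matrix_scale (- \<i>) (V t ** J t) ** E t)) (at t)"
      unfolding M_def
      by (intro bounded_linear.has_vector_derivative[OF bounded_bilinear.bounded_linear_right[OF bounded_bilinear_matrix_mult]]
          has_vector_derivative_matrix_mult V(2) E')
    also have "dagger (E 0) ** (V t ** E' t + matrix_scale (- \<i>) (V t ** J t) ** E t) = M t ** X t"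
    proof -
      have 1: "matrix_scale (- \<i>) (V t ** J t) ** E t = - matrix_scale \<i> (V t ** (J t ** E t))"
        by (subst scale_mult_left) (simp add: scale_minus matrix_mul_assoc)
      have "(V t ** E t) ** X t = V t ** E' t + matrix_scale (- \<i>) (V t ** J t) ** E t"
        unfolding X_def K_def Jt_def 1
        by (simp add: mult_diff_right scale_mult_right cancel flip: matrix_mul_assoc)
      thus ?thesis unfolding M_def by (simp flip: matrix_mul_assoc)
    qed
    finally show ?thesis .
  qed
  have M_entry: "((\<lambda>t. M t $ i $ j) has_vector_derivative \<i> * of_real (q j t) * M t $ i $ j) (at t)" for i j t
    using has_vector_derivative_entry[OF M'[of t], of i j] unfolding X_diag by (simp add: mult.commute)
  have M0: "M 0 = mat 1" by (simp add: M_def V(1) cancel) (use un unitary_matrix_def in blast)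
  \<comment> \<open>Each entry only rotates its phase, so off-diagonal entries stay 0 and diagonal
    ones stay nonzero, as \<open>phase_lift\<close> requires.\<close>
  have cmod_M: "(cmod (M t $ i $ j))^2 = (cmod (M 0 $ i $ j))^2" for t i j
  proof (rule vector_derivative_zero_imp_const[of "\<lambda>t. (cmod (M t $ i $ j))^2"])
    fix t
    have "cnj (M t $ i $ j) * (\<i> * of_real (q j t) * M t $ i $ j) = \<i> * of_real (q j t * (cmod (M t $ i $ j))^2)"
      unfolding of_real_mult complex_norm_square by (simp add: mult_ac)
    hence "Re (cnj (M t $ i $ j) * (\<i> * of_real (q j t) * M t $ i $ j)) = 0" by simp
    thus "((\<lambda>t. (cmod (M t $ i $ j))^2) has_vector_derivative 0) (at t)"
      using vector_derivative_cmod_power2[OF M_entry[of i j t]]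
      by (simp only: has_real_derivative_iff_has_vector_derivative mult_zero_right)
  qed
  have "\<forall>j. \<exists>\<theta>. \<theta> 0 = 0 \<and> (\<forall>t. (\<theta> has_vector_derivative of_real (q j t)) (at t)) \<and> (\<forall>t. M t $ j $ j = exp (\<i> * \<theta> t))"
  proof
    fix j
    have "M t $ j $ j \<noteq> 0" for t using cmod_M[of t j j] by (auto simp: M0 mat_def)
    moreover have "M 0 $ j $ j = 1" by (simp add: M0 mat_def)
    ultimately show "\<exists>\<theta>. \<theta> 0 = 0 \<and> (\<forall>t. (\<theta> has_vector_derivative of_real (q j t)) (at t)) \<and> (\<forall>t. M t $ j $ j = exp (\<i> * \<theta> t))"
      using phase_lift[OF M_entry[of j j]] by metis
  qed
  then obtain \<theta> where \<theta>: "\<And>j. \<theta> j 0 = 0" "\<And>j t. (\<theta> j has_vector_derivative of_real (q j t)) (at t)"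
    "\<And>j t. M t $ j $ j = exp (\<i> * \<theta> j t)" by metis
  have M_diag: "M t = diag (\<lambda>j. exp (\<i> * \<theta> j t))" for t
  proof -
    have "M t $ i $ j = 0" if "i \<noteq> j" for i j using cmod_M[of t i j] that by (simp add: M0 mat_def)
    thus ?thesis using \<theta>(3) by (simp add: vec_eq_iff)
  qed
  have "((\<lambda>t. diag (\<lambda>j. \<theta> j t)) has_vector_derivative frame_Q J E t) (at t)" for t
    unfolding Q
  proof (rule has_vector_derivative_matrixI)
    fix i j
    show "((\<lambda>t. diag (\<lambda>j. \<theta> j t) $ i $ j) has_vector_derivative diag (\<lambda>j. of_real (q j t)) $ i $ j) (at t)"
      by (cases "i = j") (simp_all add: \<theta>(2))
  qed
  from oriented_integral_derivative[OF this]
  have "oriented_integral 0 t (frame_Q J E) = diag (\<lambda>j. \<theta> j t)" by (simp add: \<theta>(1) vec_eq_iff)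
  moreover have "matrix_scale \<i> (diag (\<lambda>j. \<theta> j t)) = diag (\<lambda>j. \<i> * \<theta> j t)" by (simp add: vec_eq_iff)
  ultimately have "matrix_exp (matrix_scale \<i> (oriented_integral 0 t (frame_Q J E))) = M t"
    by (simp add: matrix_exp_diag M_diag)
  thus "frame_V J E t = V t"
    unfolding frame_V_def M_def by (simp add: cancel matrix_mul_assoc unitary_mult_dagger[OF un])
qed

section \<open>First variation of the energy\<close>

text \<open>A variation is only assumed to be separately differentiable; a continuous partial derivative
  makes it jointly continuous.\<close>

lemma continuous_on_partial_derivative:
  fixes f :: "real \<Rightarrow> real \<Rightarrow> 'a::real_normed_vector"
  assumes t: "\<And>s t. t \<in> {t0..t1} \<Longrightarrow> (f s has_vector_derivative ft s t) (at t within {t0..t1})"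
    and s: "\<And>s t. t \<in> {t0..t1} \<Longrightarrow> isCont (\<lambda>s. f s t) s"
    and ft: "continuous_on (UNIV \<times> {t0..t1}) (\<lambda>(s, t). ft s t)"
  shows "continuous_on (UNIV \<times> {t0..t1}) (\<lambda>(s, t). f s t)"
  unfolding continuous_on_iff
proof (intro ballI allI impI)
  fix z :: "real \<times> real" and e :: real assume z: "z \<in> UNIV \<times> {t0..t1}" and e: "e > 0"
  obtain s t where st: "z = (s, t)" "t \<in> {t0..t1}" using z by auto
  have "bounded ((\<lambda>(s, t). ft s t) ` ({s - 1..s + 1} \<times> {t0..t1}))"
    by (intro compact_imp_bounded compact_continuous_image continuous_on_subset[OF ft] compact_Times) auto
  then obtain M where "\<forall>x\<in>(\<lambda>(s, t). ft s t) ` ({s - 1..s + 1} \<times> {t0..t1}). norm x \<le> M"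
    unfolding bounded_iff by blast
  hence M: "norm (ft s' t') \<le> M" if "s' \<in> {s - 1..s + 1}" "t' \<in> {t0..t1}" for s' t'
    using that by force
  have lip: "norm (f s' t' - f s' t) \<le> M * \<bar>t' - t\<bar>" if "s' \<in> {s - 1..s + 1}" "t' \<in> {t0..t1}" for s' t'
  proof -
    have "norm (f s' t' - f s' t) \<le> M * norm (t' - t)"
    proof (rule differentiable_bound[of "{t0..t1}"])
      show "(f s' has_derivative (\<lambda>h. h *\<^sub>R ft s' x)) (at x within {t0..t1})" if "x \<in> {t0..t1}" for x
        using t[OF that] by (simp add: has_vector_derivative_def)
      show "onorm (\<lambda>h. h *\<^sub>R ft s' x) \<le> M" if "x \<in> {t0..t1}" for x
      proof (rule onorm_le)
        show "norm (h *\<^sub>R ft s' x) \<le> M * norm h" for h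
          using mult_left_mono[OF M[OF \<open>s' \<in> _\<close> that], of "\<bar>h\<bar>"] by (simp add: mult.commute)
      qed
    qed (use that st in auto)
    thus ?thesis by simp
  qed
  obtain d where d: "d > 0" "\<And>s'. dist s' s < d \<Longrightarrow> dist (f s' t) (f s t) < e / 2"
    using s[OF st(2), of s] e unfolding continuous_at_eps_delta by (metis half_gt_zero)
  \<comment> \<open>The bound 1 keeps \<open>s'\<close> in the box on which \<open>M\<close> bounds
    \<open>ft\<close>; the last term makes the move in \<open>t\<close> cost less than
    \<open>e / 2\<close>.\<close>
  define d' where "d' = min (min d 1) (e / 2 / (\<bar>M\<bar> + 1))"
  have d': "d' > 0" using d(1) e by (simp add: d'_def)
  show "\<exists>d>0. \<forall>z'\<in>UNIV \<times> {t0..t1}. dist z' z < d \<longrightarrow> dist (case z' of (s, t) \<Rightarrow> f s t) (case z of (s, t) \<Rightarrow> f s t) < e"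
  proof (intro exI[of _ d'] conjI d' ballI impI)
    fix z' :: "real \<times> real" assume z': "z' \<in> UNIV \<times> {t0..t1}" "dist z' z < d'"
    obtain s' t' where st': "z' = (s', t')" "t' \<in> {t0..t1}" using z'(1) by auto
    have "dist s' s < d'" "dist t' t < d'"
      using z'(2) dist_fst_le[of z' z] dist_snd_le[of z' z] by (simp_all add: st st')
    hence ds: "dist s' s < d" "\<bar>s' - s\<bar> < 1" and dt: "\<bar>t' - t\<bar> < e / 2 / (\<bar>M\<bar> + 1)"
      by (simp_all add: d'_def dist_real_def)
    have "s' \<in> {s - 1..s + 1}" using ds(2) by (auto simp: abs_if split: if_splits)
    hence "norm (f s' t' - f s' t) \<le> M * \<bar>t' - t\<bar>" using lip st' by blast
    also have "\<dots> \<le> (\<bar>M\<bar> + 1) * \<bar>t' - t\<bar>" by (intro mult_right_mono) auto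
    also have "\<dots> < (\<bar>M\<bar> + 1) * (e / 2 / (\<bar>M\<bar> + 1))" using dt by (intro mult_strict_left_mono) auto
    also have "\<dots> = e / 2"
    proof -
      have "\<bar>M\<bar> + 1 \<noteq> 0" by linarith
      from nonzero_mult_div_cancel_left[OF this, of "e / 2"] show ?thesis by (simp only: times_divide_eq_right)
    qed
    finally have "dist (f s' t') (f s' t) < e / 2" by (simp add: dist_norm)
    moreover have "dist (f s' t) (f s t) < e / 2" by (rule d(2)[OF ds(1)])
    ultimately have "dist (f s' t') (f s t) < e" using dist_triangle[of "f s' t'" "f s t" "f s' t"] by linarith
    thus "dist (case z' of (s, t) \<Rightarrow> f s t) (case z of (s, t) \<Rightarrow> f s t) < e" by (simp add: st st')
  qed
qed

section \<open>The real trace form on complex matrices and the flag metric\<close>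

lemma matrix_minus_mult: "(- A) ** B = - (A ** B)" for A :: "complex^'n^'m" and B :: "complex^'l^'n"
  by (simp add: vec_eq_iff matrix_matrix_mult_def sum_negf)

lemma matrix_mult_minus: "A ** (- B) = - (A ** B)" for A :: "complex^'n^'m" and B :: "complex^'l^'n"
  by (simp add: vec_eq_iff matrix_matrix_mult_def sum_negf)

lemma inner_matrix: "A \<bullet> B = Re (\<Sum>i\<in>UNIV. \<Sum>j\<in>UNIV. cnj (A $ i $ j) * B $ i $ j)" for A B :: "complex^'n^'m"
  by (simp add: inner_vec_def inner_complex_def)

lemma inner_mult_left: "A \<bullet> (B ** C) = (dagger B ** A) \<bullet> C" for A :: "complex^'n^'m"
proof -
  have "(\<Sum>i\<in>UNIV. \<Sum>j\<in>UNIV. \<Sum>k\<in>UNIV. cnj (A $ i $ j) * (B $ i $ k * C $ k $ j))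
      = (\<Sum>k\<in>UNIV. \<Sum>j\<in>UNIV. \<Sum>i\<in>UNIV. cnj (A $ i $ j) * (B $ i $ k * C $ k $ j))"
    by (subst sum.swap, subst (2) sum.swap, subst sum.swap, rule refl)
  thus ?thesis
    unfolding inner_matrix matrix_matrix_mult_def
    by (simp add: sum_distrib_left sum_distrib_right mult_ac)
qed

lemma inner_mult_right: "A \<bullet> (B ** C) = (A ** dagger C) \<bullet> B" for A :: "complex^'n^'m"
proof -
  have "(\<Sum>i\<in>UNIV. \<Sum>j\<in>UNIV. \<Sum>k\<in>UNIV. cnj (A $ i $ j) * (B $ i $ k * C $ k $ j))
      = (\<Sum>i\<in>UNIV. \<Sum>k\<in>UNIV. \<Sum>j\<in>UNIV. cnj (A $ i $ j) * (B $ i $ k * C $ k $ j))"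
    by (intro sum.cong refl sum.swap)
  thus ?thesis
    unfolding inner_matrix matrix_matrix_mult_def
    by (simp add: sum_distrib_left sum_distrib_right mult_ac)
qed

text \<open>For skew-Hermitian matrices an entry and its mirror image contribute equally, whence the
  factor 2. The zero diagonal of \<open>P\<close> hides that of \<open>M\<close>, the part of a
  velocity that only changes the phases of the columns.\<close>

lemma inner_skew_hollow:
  fixes P M :: "complex^3^3"
  assumes "dagger P = - P" "dagger M = - M" "\<And>i. P $ i $ i = 0"
  shows "P \<bullet> M = 2 * Re (cnj (P $ 1 $ 2) * M $ 1 $ 2) + 2 * Re (cnj (P $ 1 $ 3) * M $ 1 $ 3)
    + 2 * Re (cnj (P $ 2 $ 3) * M $ 2 $ 3)"
proof -
  have "cnj (P $ j $ i) = - P $ i $ j" "cnj (M $ j $ i) = - M $ i $ j" for i j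
    using arg_cong[OF assms(1), of "\<lambda>A. A $ i $ j"] arg_cong[OF assms(2), of "\<lambda>A. A $ i $ j"] by simp_all
  hence "P $ j $ i = - cnj (P $ i $ j)" "M $ j $ i = - cnj (M $ i $ j)" for i j
    by (metis complex_cnj_cnj complex_cnj_minus)+
  note this[of 2 1] this[of 3 1] this[of 3 2]
  thus ?thesis using assms(3) unfolding inner_matrix sum_3 by simp
qed

lemma cdot_column: "cdot (column i A) (column j B) = (dagger A ** B) $ i $ j"
  by (simp add: cdot_def column_def matrix_matrix_mult_def)

lemma flag_metric_eq: "flag_metric \<alpha>12 \<alpha>13 \<alpha>23 U X =
   1 / \<alpha>12 * (cmod ((dagger U ** X) $ 1 $ 2))^2 + 1 / \<alpha>13 * (cmod ((dagger U ** X) $ 1 $ 3))^2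
   + 1 / \<alpha>23 * (cmod ((dagger U ** X) $ 2 $ 3))^2"
  unfolding flag_metric_def cdot_column ..

text \<open>Each column of \<open>W\<close> is a multiple of the corresponding column of
  \<open>U\<close>, hence orthogonal to the other columns of \<open>U\<close>.\<close>

lemma flag_of_eq_imp:
  assumes "flag_of W = flag_of U" and U: "unitary_matrix U" and "i \<noteq> j"
  shows "(dagger U ** W) $ i $ j = 0"
proof -
  have "column j W \<in> flag_of W j" by (simp add: flag_of_def vec.span_base)
  hence "column j W \<in> flag_of U j" using assms(1) by simp
  then obtain k where k: "column j W = k *s column j U" by (auto simp: flag_of_def vec.span_singleton)
  have "(dagger U ** W) $ i $ j = cdot (column i U) (k *s column j U)" by (simp add: cdot_column[symmetric] k)
  also have "\<dots> = k * (dagger U ** U) $ i $ j"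
    unfolding cdot_column[symmetric] by (simp add: cdot_def sum_distrib_left mult_ac)
  also have "\<dots> = 0" using U \<open>i \<noteq> j\<close> by (simp add: unitary_matrix_def mat_def)
  finally show ?thesis .
qed


lemma unitary_velocity_skew:
  assumes t: "t0 < t1" "t \<in> {t0..t1}" and W: "\<And>t. t \<in> {t0..t1} \<Longrightarrow> unitary_matrix (W t)"
    and W': "(W has_vector_derivative X) (at t within {t0..t1})"
  shows "dagger (dagger (W t) ** X) = - (dagger (W t) ** X)"
proof -
  have 1: "((\<lambda>t. dagger (W t) ** W t) has_vector_derivative dagger (W t) ** X + dagger X ** W t) (at t within {t0..t1})"
    by (rule has_vector_derivative_matrix_mult[OF has_vector_derivative_dagger[OF W'] W'])
  have 2: "((\<lambda>t. dagger (W t) ** W t) has_vector_derivative 0) (at t within {t0..t1})"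
    by (rule has_vector_derivative_transform[OF t(2) _ has_vector_derivative_const[of "mat 1"]])
       (use W in \<open>simp add: unitary_matrix_def\<close>)
  have "dagger (W t) ** X + dagger X ** W t = 0"
    using vector_derivative_unique_within_closed_interval[of t0 t1 t, OF t(1) _ 1[folded cbox_interval] 2[folded cbox_interval]] t(2)
    by (simp add: cbox_interval)
  thus ?thesis by (simp add: dagger_mult add_eq_0_iff)
qed

text \<open>\<open>M\<close> is the velocity in the moving frame and \<open>P\<close> the momentum:
  the weights \<open>1 / \<alpha>\<close> of the metric cancel those in \<open>M\<close>. Up to a
  constant factor the energy varies by the pairing of \<open>P\<close> with the variation of the
  velocity, and \<open>P' = P M - M P\<close> makes this pairing an exact derivative.\<close>

lemma flag_energy_derivative:
  fixes P P' M U :: "real \<Rightarrow> complex^3^3"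
  assumes "t0 < t1" and "\<alpha>12 > 0" "\<alpha>13 > 0" "\<alpha>23 > 0"
    and P: "\<And>t. (P has_vector_derivative P' t) (at t)" "\<And>t. dagger (P t) = - P t" "\<And>t i. P t $ i $ i = 0"
    and M: "\<And>t. dagger (M t) = - (M t :: complex^3^3)" "\<And>t. M t $ 1 $ 2 = of_real \<alpha>12 * P t $ 1 $ 2"
      "\<And>t. M t $ 1 $ 3 = of_real \<alpha>13 * P t $ 1 $ 3" "\<And>t. M t $ 2 $ 3 = of_real \<alpha>23 * P t $ 2 $ 3"
    and PM: "\<And>t. P' t = P t ** M t - M t ** P t"
    and U: "\<And>t. unitary_matrix (U t)" "\<And>t. (U has_vector_derivative U t ** M t) (at t)"
    and W: "proper_flag_variation U t0 t1 W"
  shows "((\<lambda>s. flag_energy \<alpha>12 \<alpha>13 \<alpha>23 t0 t1 (W s)) has_real_derivative 0) (at 0)"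
proof -
  obtain Ws Wt Wst where
    W0: "\<And>t. t \<in> {t0..t1} \<Longrightarrow> W 0 t = U t" and
    Wu: "\<And>s t. t \<in> {t0..t1} \<Longrightarrow> unitary_matrix (W s t)" and
    ends: "\<And>s. flag_of (W s t0) = flag_of (U t0)" "\<And>s. flag_of (W s t1) = flag_of (U t1)" and
    cont: "continuous_on (UNIV \<times> {t0..t1}) (\<lambda>(s, t). Ws s t)" "continuous_on (UNIV \<times> {t0..t1}) (\<lambda>(s, t). Wt s t)"
      "continuous_on (UNIV \<times> {t0..t1}) (\<lambda>(s, t). Wst s t)" and
    Ws: "\<And>s t. t \<in> {t0..t1} \<Longrightarrow> ((\<lambda>s. W s t) has_vector_derivative Ws s t) (at s)" and
    Wt: "\<And>s t. t \<in> {t0..t1} \<Longrightarrow> (W s has_vector_derivative Wt s t) (at t within {t0..t1})" and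
    Wst: "\<And>s t. t \<in> {t0..t1} \<Longrightarrow> (Ws s has_vector_derivative Wst s t) (at t within {t0..t1})" and
    Wts: "\<And>s t. t \<in> {t0..t1} \<Longrightarrow> ((\<lambda>s. Wt s t) has_vector_derivative Wst s t) (at s)"
    using W unfolding proper_flag_variation_def by blast
  have contW: "continuous_on (UNIV \<times> {t0..t1}) (\<lambda>(s, t). W s t)"
    by (rule continuous_on_partial_derivative[OF Wt has_vector_derivative_continuous[OF Ws] cont(2)])
  define m where "m = (\<lambda>s t. dagger (W s t) ** Wt s t)"
  define ms where "ms = (\<lambda>s t. dagger (W s t) ** Wst s t + dagger (Ws s t) ** Wt s t)"
  have m': "((\<lambda>s. m s t) has_vector_derivative ms s t) (at s)" if "t \<in> {t0..t1}" for s t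
    unfolding m_def ms_def
    by (rule has_vector_derivative_matrix_mult[OF has_vector_derivative_dagger[OF Ws[OF that]] Wts[OF that]])
  have contm: "continuous_on (UNIV \<times> {t0..t1}) (\<lambda>(s, t). m s t)" and contms: "continuous_on (UNIV \<times> {t0..t1}) (\<lambda>(s, t). ms s t)"
    using contW cont unfolding m_def ms_def case_prod_beta
    by (intro continuous_on_add bounded_bilinear.continuous_on[OF bounded_bilinear_matrix_mult]
        bounded_linear.continuous_on[OF bounded_linear_dagger]; simp add: case_prod_beta)+
  define e where "e = (\<lambda>s t i j. (cmod (m s t $ i $ j))^2)"
  define e' where "e' = (\<lambda>s t i j. 2 * Re (cnj (m s t $ i $ j) * ms s t $ i $ j))"
  define G where "G = (\<lambda>s t. 1 / \<alpha>12 * e s t 1 2 + 1 / \<alpha>13 * e s t 1 3 + 1 / \<alpha>23 * e s t 2 3)"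
  define G' where "G' = (\<lambda>s t. 1 / \<alpha>12 * e' s t 1 2 + 1 / \<alpha>13 * e' s t 1 3 + 1 / \<alpha>23 * e' s t 2 3)"
  have energy: "flag_energy \<alpha>12 \<alpha>13 \<alpha>23 t0 t1 (W s) = 1 / 2 * integral {t0..t1} (G s)" for s
  proof -
    have "flag_metric \<alpha>12 \<alpha>13 \<alpha>23 (W s t) (vector_derivative (W s) (at t within {t0..t1})) = G s t"
      if "t \<in> {t0..t1}" for t
      unfolding vector_derivative_within_closed_interval[OF \<open>t0 < t1\<close> that Wt[OF that]] flag_metric_eq G_def e_def m_def ..
    thus ?thesis unfolding flag_energy_def by (intro arg_cong[of _ _ "(*) (1/2)"] integral_cong) auto
  qed
  have entry: "((\<lambda>s. e s t i j) has_vector_derivative e' s t i j) (at s)" if "t \<in> {t0..t1}" for s t i j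
    using vector_derivative_cmod_power2[OF has_vector_derivative_entry[OF m'[OF that]]]
    unfolding e_def e'_def has_real_derivative_iff_has_vector_derivative .
  have GG': "((\<lambda>s. G s t) has_vector_derivative G' s t) (at s)" if "t \<in> {t0..t1}" for s t
    unfolding G_def G'_def
    by (intro has_vector_derivative_add bounded_linear.has_vector_derivative[OF bounded_linear_mult_right] entry that)
  note comp = bounded_linear.continuous_on[OF bounded_linear_vec_nth bounded_linear.continuous_on[OF bounded_linear_vec_nth]]
  have ce: "continuous_on (UNIV \<times> {t0..t1}) (\<lambda>z. e (fst z) (snd z) i j)" for i j
    unfolding e_def by (intro continuous_on_power continuous_on_norm comp[OF contm[unfolded case_prod_beta]])
  have ce': "continuous_on (UNIV \<times> {t0..t1}) (\<lambda>z. e' (fst z) (snd z) i j)" for i j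
    unfolding e'_def by (intro continuous_on_mult continuous_on_const continuous_on_Re continuous_on_cnj
        comp[OF contm[unfolded case_prod_beta]] comp[OF contms[unfolded case_prod_beta]])
  have contG: "continuous_on (UNIV \<times> {t0..t1}) (\<lambda>(s, t). G s t)"
    unfolding G_def case_prod_beta by (intro continuous_on_add continuous_on_mult continuous_on_const ce)
  have contG': "continuous_on (UNIV \<times> {t0..t1}) (\<lambda>(s, t). G' s t)"
    unfolding G'_def case_prod_beta by (intro continuous_on_add continuous_on_mult continuous_on_const ce')
  have "G s integrable_on {t0..t1}" for s
    by (rule integrable_continuous_real, rule continuous_on_compose2[OF contG[unfolded case_prod_beta], of _ "\<lambda>t. (s, t)", unfolded fst_conv snd_conv])
       (auto intro!: continuous_intros)
  hence "((\<lambda>s. integral (cbox t0 t1) (G s)) has_vector_derivative integral (cbox t0 t1) (G' 0)) (at 0 within UNIV)"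
    using GG' contG' by (intro leibniz_rule_vector_derivative) (auto simp: cbox_interval)
  hence deriv: "((\<lambda>s. flag_energy \<alpha>12 \<alpha>13 \<alpha>23 t0 t1 (W s)) has_real_derivative 1 / 2 * integral {t0..t1} (G' 0)) (at 0)"
    unfolding energy cbox_interval has_real_derivative_iff_has_vector_derivative
    by (rule bounded_linear.has_vector_derivative[OF bounded_linear_mult_right])
  \<comment> \<open>The variation field seen in the moving frame; its pairing with the momentum is
    the boundary term.\<close>
  define N where "N = (\<lambda>t. dagger (W 0 t) ** Ws 0 t)"
  define N' where "N' = (\<lambda>t. dagger (W 0 t) ** Wst 0 t + dagger (Wt 0 t) ** Ws 0 t)"
  have N': "(N has_vector_derivative N' t) (at t within {t0..t1})" if "t \<in> {t0..t1}" for t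
    unfolding N_def N'_def
    by (rule has_vector_derivative_matrix_mult[OF has_vector_derivative_dagger[OF Wt[OF that]] Wst[OF that]])
  have Wt0: "Wt 0 t = U t ** M t" if t: "t \<in> {t0..t1}" for t
  proof -
    have "(W 0 has_vector_derivative U t ** M t) (at t within {t0..t1})"
      by (rule has_vector_derivative_transform[OF t _ has_vector_derivative_at_within[OF U(2)]]) (simp add: W0)
    thus ?thesis using vector_derivative_unique_within_closed_interval[of t0 t1 t] \<open>t0 < t1\<close> t Wt[OF t]
      by (metis box_real(2))
  qed
  have m0: "m 0 t = M t" if "t \<in> {t0..t1}" for t
    unfolding m_def Wt0[OF that] W0[OF that] by (rule unitary_cancel[OF U(1)])
  have N_skew: "dagger (N t) = - N t" if t: "t \<in> {t0..t1}" for t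
  proof -
    have "((\<lambda>s. dagger (W s t) ** W s t) has_vector_derivative dagger (W 0 t) ** Ws 0 t + dagger (Ws 0 t) ** W 0 t) (at 0)"
      by (rule has_vector_derivative_matrix_mult[OF has_vector_derivative_dagger[OF Ws[OF t]] Ws[OF t]])
    moreover have "(\<lambda>s. dagger (W s t) ** W s t) = (\<lambda>_. mat 1)" using Wu[OF t] by (simp add: unitary_matrix_def)
    ultimately have "dagger (W 0 t) ** Ws 0 t + dagger (Ws 0 t) ** W 0 t = 0"
      by (metis has_vector_derivative_const vector_derivative_unique_at)
    thus ?thesis by (simp add: N_def dagger_mult add_eq_0_iff)
  qed
  \<comment> \<open>The mixed derivative \<open>Wst\<close> serves both orders of differentiation.
    Comparing them gives the structure equation between the variation of the velocity and the
    derivative of the variation field.\<close>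
  have ms0: "ms 0 t = N' t + (M t ** N t - N t ** M t)" if t: "t \<in> {t0..t1}" for t
  proof -
    have "dagger (Wt 0 t) ** Ws 0 t = - (M t ** N t)"
      by (simp only: Wt0[OF t] dagger_mult M(1) N_def W0[OF t] matrix_minus_mult matrix_mul_assoc)
    moreover have "dagger (Ws 0 t) ** Wt 0 t = - (N t ** M t)"
    proof -
      have "dagger (Ws 0 t) ** Wt 0 t = dagger (N t) ** M t"
        unfolding Wt0[OF t] N_def dagger_mult W0[OF t] by (simp add: matrix_mul_assoc)
      thus ?thesis unfolding N_skew[OF t] matrix_minus_mult .
    qed
    ultimately show ?thesis by (simp add: ms_def N'_def)
  qed
  have G'0: "G' 0 t = P t \<bullet> N' t + P' t \<bullet> N t" if t: "t \<in> {t0..t1}" for t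
  proof -
    have ms_skew: "dagger (ms 0 t) = - ms 0 t"
    proof -
      have "((\<lambda>s. dagger (m s t) + m s t) has_vector_derivative dagger (ms 0 t) + ms 0 t) (at 0)"
        by (intro has_vector_derivative_add has_vector_derivative_dagger m' t)
      moreover have "(\<lambda>s. dagger (m s t) + m s t) = (\<lambda>_. 0)"
        using unitary_velocity_skew[OF \<open>t0 < t1\<close> t Wu Wt[OF t]] by (simp add: m_def)
      ultimately have "dagger (ms 0 t) + ms 0 t = 0"
        by (metis has_vector_derivative_const vector_derivative_unique_at)
      thus ?thesis by (simp add: add_eq_0_iff2)
    qed
    have "G' 0 t = P t \<bullet> ms 0 t"
      unfolding inner_skew_hollow[OF P(2) ms_skew P(3)] G'_def e'_def m0[OF t] M(2-4)
      using assms(2-4) by (simp add: mult.assoc)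
    also have "\<dots> = P t \<bullet> N' t + (P t \<bullet> (M t ** N t) - P t \<bullet> (N t ** M t))"
      unfolding ms0[OF t] by (simp add: inner_add_right inner_diff_right)
    \<comment> \<open>Multiplication by the skew-Hermitian \<open>M t\<close> is skew for the trace
      form, so the commutator moves from \<open>N t\<close> to \<open>P t\<close>, where it is
      \<open>P' t\<close>.\<close>
    also have "P t \<bullet> (M t ** N t) - P t \<bullet> (N t ** M t) = P' t \<bullet> N t"
    proof -
      show ?thesis
        unfolding inner_mult_left[of _ "M t"] inner_mult_right[of _ _ "M t"] M(1) PM matrix_minus_mult matrix_mult_minus
        by (simp add: inner_diff_left)
    qed
    finally show ?thesis .
  qed
  have H: "((\<lambda>t. P t \<bullet> N t) has_vector_derivative G' 0 t) (at t within {t0..t1})" if t: "t \<in> {t0..t1}" for t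
    unfolding G'0[OF t]
    by (rule bounded_bilinear.has_vector_derivative[OF bounded_bilinear_inner has_vector_derivative_at_within[OF P(1)] N'[OF t]])
  have "(G' 0 has_integral (P t1 \<bullet> N t1 - P t0 \<bullet> N t0)) {t0..t1}"
    by (rule fundamental_theorem_of_calculus) (use \<open>t0 < t1\<close> H in auto)
  moreover have "P t \<bullet> N t = 0" if t: "t = t0 \<or> t = t1" for t
  proof -
    have t': "t \<in> {t0..t1}" using t \<open>t0 < t1\<close> by auto
    have "N t $ i $ j = 0" if "i \<noteq> j" for i j
    proof -
      have "flag_of (W s t) = flag_of (U t)" for s using t ends by auto
      hence "(\<lambda>s. (dagger (U t) ** W s t) $ i $ j) = (\<lambda>_. 0)"
        using flag_of_eq_imp[OF _ U(1) that] by blast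
      moreover have "((\<lambda>s. (dagger (U t) ** W s t) $ i $ j) has_vector_derivative (dagger (U t) ** Ws 0 t) $ i $ j) (at 0)"
        by (intro has_vector_derivative_entry bounded_linear.has_vector_derivative[OF
              bounded_bilinear.bounded_linear_right[OF bounded_bilinear_matrix_mult]] Ws t')
      ultimately show ?thesis
        unfolding N_def W0[OF t'] by (metis has_vector_derivative_const vector_derivative_unique_at)
    qed
    thus ?thesis using P(3) unfolding inner_matrix by (simp add: sum_3)
  qed
  ultimately have "integral {t0..t1} (G' 0) = 0" by (simp add: integral_unique)
  thus ?thesis using deriv by simp
qed

section \<open>The geodesics attached to a solution\<close>

lemma inertia_nth [simp]:
  "inertia_matrix \<alpha>12 \<alpha>13 \<alpha>23 a b c $ 1 $ 1 = 0" "inertia_matrix \<alpha>12 \<alpha>13 \<alpha>23 a b c $ 1 $ 2 = of_real \<alpha>12 * a"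
  "inertia_matrix \<alpha>12 \<alpha>13 \<alpha>23 a b c $ 1 $ 3 = of_real \<alpha>13 * b" "inertia_matrix \<alpha>12 \<alpha>13 \<alpha>23 a b c $ 2 $ 1 = of_real \<alpha>12 * cnj a"
  "inertia_matrix \<alpha>12 \<alpha>13 \<alpha>23 a b c $ 2 $ 2 = 0" "inertia_matrix \<alpha>12 \<alpha>13 \<alpha>23 a b c $ 2 $ 3 = of_real \<alpha>23 * c"
  "inertia_matrix \<alpha>12 \<alpha>13 \<alpha>23 a b c $ 3 $ 1 = of_real \<alpha>13 * cnj b" "inertia_matrix \<alpha>12 \<alpha>13 \<alpha>23 a b c $ 3 $ 2 = of_real \<alpha>23 * cnj c"
  "inertia_matrix \<alpha>12 \<alpha>13 \<alpha>23 a b c $ 3 $ 3 = 0"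
  by (simp_all add: inertia_matrix_def)

text \<open>As the case of unit weights, \<open>lax_matrix\<close> shares the proofs of Hermiticity
  and differentiability.\<close>

lemma lax_eq_inertia: "lax_matrix a b c = inertia_matrix 1 1 1 a b c"
  by (simp add: lax_matrix_def inertia_matrix_def)

lemma dagger_inertia: "dagger (inertia_matrix \<alpha>12 \<alpha>13 \<alpha>23 a b c) = inertia_matrix \<alpha>12 \<alpha>13 \<alpha>23 a b c"
  by (simp add: vec_eq_iff forall_3)

lemma bounded_linear_inertia: "bounded_linear (\<lambda>(a, b, c). inertia_matrix \<alpha>12 \<alpha>13 \<alpha>23 a b c)"
  unfolding linear_conv_bounded_linear[symmetric]
  by (rule linearI) (auto simp: vec_eq_iff forall_3 algebra_simps)

lemma has_vector_derivative_inertia: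
  assumes "(a has_vector_derivative a') (at t)" "(b has_vector_derivative b') (at t)" "(c has_vector_derivative c') (at t)"
  shows "((\<lambda>t. inertia_matrix \<alpha>12 \<alpha>13 \<alpha>23 (a t) (b t) (c t)) has_vector_derivative inertia_matrix \<alpha>12 \<alpha>13 \<alpha>23 a' b' c') (at t)"
  using bounded_linear.has_vector_derivative[OF bounded_linear_inertia
      has_vector_derivative_Pair[OF assms(1) has_vector_derivative_Pair[OF assms(2,3)]]] by simp

theorem geodesic_of_lift:
  fixes L J J' U :: "real \<Rightarrow> complex^3^3"
  assumes \<alpha>: "\<alpha>12 > 0" "\<alpha>13 > 0" "\<alpha>23 > 0"
    and L: "\<And>t. L t = lax_matrix (a t) (b t) (c t)" and J: "\<And>t. J t = inertia_matrix \<alpha>12 \<alpha>13 \<alpha>23 (a t) (b t) (c t)"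
    and L': "\<And>t. (L has_vector_derivative matrix_scale \<i> (J t ** L t - L t ** J t)) (at t)"
    and J': "\<And>t. (J has_vector_derivative J' t) (at t)" "continuous_on UNIV J'"
    and U: "lifts_geodesic_of J U"
  shows "flag_geodesic \<alpha>12 \<alpha>13 \<alpha>23 (\<lambda>t. flag_of (U t))"
proof -
  have Un: "unitary_matrix (U t)" for t using U by (simp add: lifts_geodesic_of_def)
  define P M M' where "P = (\<lambda>t. matrix_scale (- \<i>) (L t))" and "M = (\<lambda>t. matrix_scale (- \<i>) (J t))"
    and "M' = (\<lambda>t. matrix_scale (- \<i>) (J' t))"
  have U': "(U has_vector_derivative U t ** M t) (at t)" for t
  proof -
    obtain U' where U': "(U has_vector_derivative U') (at t)" "dagger (U t) ** U' = matrix_scale (- \<i>) (J t)"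
      using U unfolding lifts_geodesic_of_def by blast
    have "U' = U t ** M t" unfolding M_def U'(2)[symmetric] by (rule unitary_cancel(2)[OF Un, symmetric])
    thus ?thesis using U'(1) by simp
  qed
  have M': "(M has_vector_derivative M' t) (at t)" for t
    unfolding M_def M'_def by (rule has_vector_derivative_matrix_scale[OF J'(1)])
  have U'': "((\<lambda>t. U t ** M t) has_vector_derivative U t ** M' t + (U t ** M t) ** M t) (at t)" for t
    by (rule has_vector_derivative_matrix_mult[OF U' M'])
  have cont: "continuous_on UNIV (\<lambda>t. U t ** M' t + (U t ** M t) ** M t)"
    by (intro continuous_on_add bounded_bilinear.continuous_on[OF bounded_bilinear_matrix_mult]
        continuous_on_vector_derivative[OF U'] continuous_on_vector_derivative[OF M'])
       (unfold M'_def, rule bounded_linear.continuous_on[OF bounded_linear_matrix_scale J'(2)])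
  have P': "(P has_vector_derivative (P t ** M t - M t ** P t)) (at t)" for t
  proof -
    \<comment> \<open>Both sides are \<open>J L - L J\<close>: on the right the two factors
      \<open>- \<i>\<close> multiply to -1, which reverses the commutator.\<close>
    have "matrix_scale (- \<i>) (matrix_scale \<i> (J t ** L t - L t ** J t)) = P t ** M t - M t ** P t"
      by (simp only: P_def M_def scale_mult_left scale_mult_right scale_scale scale_diff)
         (simp add: scale_one scale_minus)
    with has_vector_derivative_matrix_scale[OF L', of "- \<i>" t] show ?thesis by (simp add: P_def)
  qed
  note dagger_simps = dagger_scale dagger_inertia complex_cnj_minus complex_cnj_i minus_minus
  have P: "dagger (P t) = - P t" "P t $ i $ i = 0" for t i
  proof -
    show "dagger (P t) = - P t"
      by (simp only: P_def L lax_eq_inertia dagger_simps) (simp add: scale_minus)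
    show "P t $ i $ i = 0" using exhaust_3[of i] by (auto simp: P_def L lax_eq_inertia)
  qed
  have M_skew: "dagger (M t) = - M t" for t
    by (simp only: M_def J dagger_simps) (simp add: scale_minus)
  have M: "M t $ 1 $ 2 = of_real \<alpha>12 * P t $ 1 $ 2"
      "M t $ 1 $ 3 = of_real \<alpha>13 * P t $ 1 $ 3" "M t $ 2 $ 3 = of_real \<alpha>23 * P t $ 2 $ 3" for t
    by (simp_all add: P_def M_def L J lax_eq_inertia)
  show ?thesis unfolding flag_geodesic_def
  proof (rule exI[of _ U], rule exI[of _ "\<lambda>t. U t ** M t"],
      rule exI[of _ "\<lambda>t. U t ** M' t + (U t ** M t) ** M t"], intro conjI allI impI)
    fix t0 t1 W assume "t0 < t1 \<and> proper_flag_variation U t0 t1 W"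
    thus "((\<lambda>s. flag_energy \<alpha>12 \<alpha>13 \<alpha>23 t0 t1 (W s)) has_real_derivative 0) (at 0)"
      by (intro flag_energy_derivative[where P=P and M=M and U=U and P'="\<lambda>t. P t ** M t - M t ** P t"]) (auto simp: \<alpha> P P' M M_skew Un U')
  qed (use Un U' U'' cont in auto)
qed

text \<open>In each off-diagonal entry of the commutator one product of two coordinates occurs twice
  with different weights, and the differences of weights are those of the Euler equations; the
  diagonal cancels.\<close>

lemma euler_lax_equation:
  assumes sol: "euler_solution \<alpha>12 \<alpha>13 \<alpha>23 a0 b0 c0 a b c"
  defines "L \<equiv> \<lambda>t. lax_matrix (a t) (b t) (c t)" and "J \<equiv> \<lambda>t. inertia_matrix \<alpha>12 \<alpha>13 \<alpha>23 (a t) (b t) (c t)"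
  shows "(L has_vector_derivative matrix_scale \<i> (J t ** L t - L t ** J t)) (at t)"
proof -
  have d: "(a has_vector_derivative - \<i> * of_real (\<alpha>23 - \<alpha>13) * b t * cnj (c t)) (at t)"
    "(b has_vector_derivative \<i> * of_real (\<alpha>12 - \<alpha>23) * a t * c t) (at t)"
    "(c has_vector_derivative \<i> * of_real (\<alpha>12 - \<alpha>13) * cnj (a t) * b t) (at t)"
    using sol unfolding euler_solution_iff by blast+
  have "inertia_matrix 1 1 1 (- \<i> * of_real (\<alpha>23 - \<alpha>13) * b t * cnj (c t)) (\<i> * of_real (\<alpha>12 - \<alpha>23) * a t * c t)
      (\<i> * of_real (\<alpha>12 - \<alpha>13) * cnj (a t) * b t) = matrix_scale \<i> (J t ** L t - L t ** J t)"
    by (simp add: L_def J_def lax_eq_inertia vec_eq_iff forall_3 matrix_matrix_mult_def sum_3 algebra_simps)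
  with has_vector_derivative_inertia[OF d, of 1 1 1] show ?thesis by (simp add: L_def lax_eq_inertia)
qed

theorem euler_geodesic_lift:
  assumes \<alpha>: "\<alpha>12 > \<alpha>23" "\<alpha>23 > \<alpha>13" "\<alpha>13 > 0"
    and sol: "euler_solution \<alpha>12 \<alpha>13 \<alpha>23 a0 b0 c0 a b c"
  defines "L \<equiv> \<lambda>t. lax_matrix (a t) (b t) (c t)" and "J \<equiv> \<lambda>t. inertia_matrix \<alpha>12 \<alpha>13 \<alpha>23 (a t) (b t) (c t)"
  assumes simple: "\<And>t. simple_spectrum (L t)" and E: "eigenframe L E"
  shows "\<exists>\<Lambda>. diagonal_matrix \<Lambda> \<and> (\<forall>t. L t = E t ** \<Lambda> ** dagger (E t))"
    and "unitary_matrix (U 0) \<Longrightarrow> lifts_geodesic_of J U \<longleftrightarrow> (\<forall>t. U t = U 0 ** frame_V J E t)"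
    and "lifts_geodesic_of J U \<Longrightarrow> flag_geodesic \<alpha>12 \<alpha>13 \<alpha>23 (\<lambda>t. flag_of (U t))"
proof -
  interpret euler_orbit "\<alpha>23 - \<alpha>13" "\<alpha>12 - \<alpha>23" "\<alpha>12 - \<alpha>13" a b c
    by unfold_locales (use \<alpha> sol in \<open>auto simp: euler_solution_iff\<close>)
  have Lh: "dagger (L t) = L t" and Jh: "dagger (J t) = J t" for t
    by (simp_all add: L_def J_def lax_eq_inertia dagger_inertia)
  have L': "(L has_vector_derivative matrix_scale \<i> (J t ** L t - L t ** J t)) (at t)" for t
    unfolding L_def J_def by (rule euler_lax_equation[OF sol])
  define J' where "J' = (\<lambda>t. inertia_matrix \<alpha>12 \<alpha>13 \<alpha>23 (a1 t) (b1 t) (c1 t))"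
  have J': "(J has_vector_derivative J' t) (at t)" for t
    unfolding J_def J'_def
    by (rule has_vector_derivative_inertia) (use a' b' c' in \<open>simp_all only: a1_def b1_def c1_def\<close>)
  have contJ: "continuous_on UNIV J" by (rule continuous_on_vector_derivative[OF J'])
  have contJ': "continuous_on UNIV J'"
    unfolding J'_def by (rule continuous_on_vector_derivative[OF has_vector_derivative_inertia[OF a1' b1' c1']])
  obtain K where K: "K > 0" "\<And>x. norm ((\<lambda>(a, b, c). inertia_matrix \<alpha>12 \<alpha>13 \<alpha>23 a b c) x) \<le> norm x * K"
    using bounded_linear.pos_bounded[OF bounded_linear_inertia] by blast
  \<comment> \<open>The conserved quantities bound the orbit, and hence \<open>J\<close>, for all
    times, as \<open>ex_unitary_lift\<close> requires.\<close>
  define R where "R = 2 * I2 (a 0, b 0, c 0) + I3 (a 0, b 0, c 0) + 1"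
  have R: "norm (a t, b t, c t) \<le> R" for t
    unfolding R_def
    by (rule bounded_solution[of "\<lambda>t. (a t, b t, c t)" "\<lambda>_. 1"])
       (unfold field_def prod.case scaleR_one, intro has_vector_derivative_Pair a' b' c')
  have B: "norm (J t) \<le> R * K" for t
    by (rule order_trans[OF _ mult_right_mono[OF R[of t]]])
       (use K(2)[of "(a t, b t, c t)"] K(1) in \<open>simp_all add: J_def\<close>)
  obtain V where V: "V 0 = mat 1" "\<And>t. (V has_vector_derivative matrix_scale (- \<i>) (V t ** J t)) (at t)"
    "\<And>t. unitary_matrix (V t)" using ex_unitary_lift[OF Jh contJ B] by blast
  note flow = eigenframe_flow[OF Lh Jh L' simple E V(1,2)]
  show "\<exists>\<Lambda>. diagonal_matrix \<Lambda> \<and> (\<forall>t. L t = E t ** \<Lambda> ** dagger (E t))" by (rule flow(1))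
  show "lifts_geodesic_of J U \<longleftrightarrow> (\<forall>t. U t = U 0 ** frame_V J E t)" if "unitary_matrix (U 0)"
    using lifts_geodesic_of_iff[where U=U and V=V, OF Jh V that] by (simp only: flow(2))
  show "flag_geodesic \<alpha>12 \<alpha>13 \<alpha>23 (\<lambda>t. flag_of (U t))" if "lifts_geodesic_of J U"
    by (rule geodesic_of_lift[OF _ _ _ _ _ L' J' contJ' that, of _ _ _ a b c])
       (use \<alpha> in \<open>auto simp: L_def J_def\<close>)
qed

text \<open>The Weierstrass data are quantified universally, so the formulas hold for every choice
  of phase and of \<open>\<mu>1\<close>, \<open>\<mu>2\<close>, \<open>\<mu>3\<close>. The
  conditions on \<open>deriv wp\<close> keep the quotients in \<open>lame_M\<close> and
  \<open>lame_N\<close> genuine, since division by zero has the conventional value 0.\<close>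

theorem proposition5:
  fixes \<alpha>12 \<alpha>13 \<alpha>23 I2 I3 h4 I4 g2 g3 :: real
    and a0 b0 c0 :: complex
    and \<tau> :: "real \<Rightarrow> real"
  assumes "\<alpha>12 > \<alpha>23" and "\<alpha>23 > \<alpha>13" and "\<alpha>13 > 0"
    and "I2 = (cmod c0)^2 + (\<alpha>12 - \<alpha>13) / (\<alpha>23 - \<alpha>13) * (cmod a0)^2"
    and "I3 = (cmod c0)^2 + (\<alpha>12 - \<alpha>13) / (\<alpha>12 - \<alpha>23) * (cmod b0)^2"
    and "complex_of_real h4 = cnj a0 * b0 * cnj c0 + a0 * cnj b0 * c0"
    and "I4 = - ((\<alpha>12 - \<alpha>13)^2 / ((\<alpha>12 - \<alpha>23) * (\<alpha>23 - \<alpha>13)) * h4^2)"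
    and "g2 = 4/3 * (I2^2 - I2 * I3 + I3^2)"
    and "g3 = - I4 + 4/27 * (I2 + I3) * (2 * I2^2 - 5 * I2 * I3 + 2 * I3^2)"
    and "\<And>t. \<tau> t = sqrt ((\<alpha>12 - \<alpha>23) * (\<alpha>23 - \<alpha>13)) * t"
  shows
    "(\<forall>Y::complex. 4 * Y^3 - of_real g2 * Y - of_real g3 = 0 \<longrightarrow> Y \<in> \<real>) \<and>
     (\<exists>!abc. case abc of (a, b, c) \<Rightarrow> euler_solution \<alpha>12 \<alpha>13 \<alpha>23 a0 b0 c0 a b c) \<and>
     (\<forall>a b c. euler_solution \<alpha>12 \<alpha>13 \<alpha>23 a0 b0 c0 a b c \<longrightarrow>
       (\<forall>(e1::real) (e2::real) (e3::real) \<omega>1 \<omega>2 wp \<zeta> \<sigma>.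
          {Y::complex. 4 * Y^3 - of_real g2 * Y - of_real g3 = 0} = {of_real e1, of_real e2, of_real e3} \<and>
          e1 > e2 \<and> e2 > e3 \<and>
          weierstrass_functions (of_real g2) (of_real g3) wp \<zeta> \<sigma> \<and>
          fundamental_half_periods wp \<omega>1 \<omega>2 \<and>
          Re \<omega>1 > 0 \<and> Im \<omega>1 = 0 \<and> Re \<omega>2 = 0 \<and> Im \<omega>2 > 0 \<longrightarrow>
          (\<exists>\<tau>0::real. \<forall>t. of_real ((cmod (c t))^2) = wp (of_real (\<tau> t - \<tau>0) + \<omega>2) + of_real (1/3 * (I2 + I3))) \<and>
          (\<forall>(\<tau>0::real) x \<mu>1 \<mu>2 \<mu>3.
             (\<forall>t. of_real ((cmod (c t))^2) = wp (of_real (\<tau> t - \<tau>0) + \<omega>2) + of_real (1/3 * (I2 + I3))) \<and>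
             x = - of_real \<tau>0 + \<omega>2 \<and>
             \<not> is_pole wp \<mu>1 \<and> wp \<mu>1 = of_real (2/3 * I2 - 1/3 * I3) \<and>
             \<not> is_pole wp \<mu>2 \<and> wp \<mu>2 = of_real (- 1/3 * I2 + 2/3 * I3) \<and>
             \<not> is_pole wp \<mu>3 \<and> wp \<mu>3 = of_real (- 1/3 * I2 - 1/3 * I3) \<and>
             deriv wp \<mu>1 \<noteq> 0 \<and> deriv wp \<mu>2 \<noteq> 0 \<and> deriv wp \<mu>3 \<noteq> 0 \<longrightarrow>
             (let A = (\<lambda>s. 1/2 * lame_M wp x s \<mu>1 * a0
                        + s * \<i> * lame_N wp x \<mu>1 * of_real (sqrt ((\<alpha>23 - \<alpha>13) / (\<alpha>12 - \<alpha>23))) * b0 * cnj c0);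
                  B = (\<lambda>s. 1/2 * lame_M wp x s \<mu>2 * b0
                        - s * \<i> * lame_N wp x \<mu>2 * of_real (sqrt ((\<alpha>12 - \<alpha>23) / (\<alpha>23 - \<alpha>13))) * a0 * c0);
                  C = (\<lambda>s. 1/2 * lame_M wp x s \<mu>3 * c0
                        - s * \<i> * lame_N wp x \<mu>3
                            * of_real ((\<alpha>12 - \<alpha>13) / sqrt ((\<alpha>12 - \<alpha>23) * (\<alpha>23 - \<alpha>13))) * cnj a0 * b0);
                  y = (\<lambda>s t \<mu>. lame_y \<zeta> \<sigma> x s (of_real (\<tau> t)) \<mu>)
              in \<forall>t. a t = A 1 * y 1 t \<mu>1 + A (- 1) * y (- 1) t \<mu>1 \<and>
                     b t = B 1 * y 1 t \<mu>2 + B (- 1) * y (- 1) t \<mu>2 \<and>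
                     c t = C 1 * y 1 t \<mu>3 + C (- 1) * y (- 1) t \<mu>3))) \<and>
       (let L = (\<lambda>t. lax_matrix (a t) (b t) (c t));
            J = (\<lambda>t. inertia_matrix \<alpha>12 \<alpha>13 \<alpha>23 (a t) (b t) (c t))
        in \<forall>E. (\<forall>t. simple_spectrum (L t)) \<and> eigenframe L E \<longrightarrow>
             (\<exists>\<Lambda>. diagonal_matrix \<Lambda> \<and> (\<forall>t. L t = E t ** \<Lambda> ** dagger (E t))) \<and>
             (\<forall>U. unitary_matrix (U 0) \<longrightarrow>
                (lifts_geodesic_of J U \<longleftrightarrow> (\<forall>t. U t = U 0 ** frame_V J E t)) \<and>
                (lifts_geodesic_of J U \<longrightarrow> flag_geodesic \<alpha>12 \<alpha>13 \<alpha>23 (\<lambda>t. flag_of (U t))))))"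
proof -
  define p q r where "p = \<alpha>23 - \<alpha>13" and "q = \<alpha>12 - \<alpha>23" and "r = \<alpha>12 - \<alpha>13"
  note \<alpha> = assms(1-3)
  have orbit: "euler_orbit p q r a b c" "a 0 = a0" "b 0 = b0" "c 0 = c0"
    if "euler_solution \<alpha>12 \<alpha>13 \<alpha>23 a0 b0 c0 a b c" for a b c
  proof -
    show "euler_orbit p q r a b c"
      by unfold_locales (use \<alpha> that in \<open>auto simp: euler_solution_iff p_def q_def r_def\<close>)
    show "a 0 = a0" "b 0 = b0" "c 0 = c0" using that by (auto simp: euler_solution_iff)
  qed
  have params: "euler_orbit.i2 p r a c = I2" "euler_orbit.i3 q r b c = I3" "euler_orbit.h a b c = h4"
    "euler_orbit.G2 p q r a b c = g2" "euler_orbit.G3 p q r a b c = g3" "euler_orbit.\<kappa> p q * t = \<tau> t"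
    "euler_orbit.Y p q r a b c t = (cmod (c t))^2 - (I2 + I3) / 3"
    if "euler_solution \<alpha>12 \<alpha>13 \<alpha>23 a0 b0 c0 a b c" for a b c t
  proof -
    interpret euler_orbit p q r a b c by (rule orbit[OF that])
    show i2: "i2 = I2" and i3: "i3 = I3"
      by (simp_all only: i2_def i3_def orbit(2-4)[OF that] assms(4,5) p_def[symmetric] q_def[symmetric] r_def[symmetric])
    have "h4 = Re (complex_of_real h4)" by simp
    also have "\<dots> = h" unfolding assms(6) by (simp add: h_def z_def orbit(2-4)[OF that] algebra_simps)
    finally show h: "h = h4" ..
    show "G2 = g2" unfolding G2_def i2 i3 assms(8) ..
    show "G3 = g3" unfolding G3_def i2 i3 h assms(9) assms(7) by (simp add: p_def q_def r_def)
    show "\<kappa> * t = \<tau> t" unfolding \<kappa>_def unfolding assms(10) p_def q_def ..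
    show "Y t = (cmod (c t))^2 - (I2 + I3) / 3" by (simp add: Y_def w_def i2 i3)
  qed
  have ex1: "\<exists>!abc. case abc of (a, b, c) \<Rightarrow> euler_solution \<alpha>12 \<alpha>13 \<alpha>23 a0 b0 c0 a b c"
    by (rule euler_ex1[OF \<alpha>(1,2)])
  \<comment> \<open>The reality of the roots concerns only the initial data but is read off from an
    orbit, so the existence of a solution enters already here.\<close>
  then obtain a b c where sol: "euler_solution \<alpha>12 \<alpha>13 \<alpha>23 a0 b0 c0 a b c" by auto
  have roots: "\<forall>Y::complex. 4 * Y^3 - of_real g2 * Y - of_real g3 = 0 \<longrightarrow> Y \<in> \<real>"
    using euler_orbit.roots_real[OF orbit(1)[OF sol]] unfolding params[OF sol] by blast
  have weierstrass: "euler_weierstrass p q r a b c wp \<zeta> \<sigma> \<omega>1 \<omega>2 e1 e2 e3"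
    if sol: "euler_solution \<alpha>12 \<alpha>13 \<alpha>23 a0 b0 c0 a b c" and
      "{Y::complex. 4 * Y^3 - of_real g2 * Y - of_real g3 = 0} = {of_real e1, of_real e2, of_real e3} \<and>
          e1 > e2 \<and> e2 > e3 \<and>
          weierstrass_functions (of_real g2) (of_real g3) wp \<zeta> \<sigma> \<and>
          fundamental_half_periods wp \<omega>1 \<omega>2 \<and>
          Re \<omega>1 > 0 \<and> Im \<omega>1 = 0 \<and> Re \<omega>2 = 0 \<and> Im \<omega>2 > 0"
    for a b c wp \<zeta> \<sigma> \<omega>1 \<omega>2 and e1 e2 e3 :: real
    unfolding euler_weierstrass_def weierstrass_real_def weierstrass_def weierstrass_real_axioms_def params[OF sol]
    using orbit(1)[OF sol] that(2) by blast
  have shift: "of_real ((cmod (c t))^2) = X + complex_of_real (1/3 * (I2 + I3)) \<longleftrightarrow> of_real (euler_orbit.Y p q r a b c t) = X"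
    if sol: "euler_solution \<alpha>12 \<alpha>13 \<alpha>23 a0 b0 c0 a b c" for a b c t X
    unfolding params(7)[OF sol] by (auto simp: field_simps)
  show ?thesis
  proof (intro conjI allI impI, goal_cases)
    case 1
    thus ?case using roots by blast
  next
    case 2
    show ?case by (rule ex1)
  next
    case (3 a b c e1 e2 e3 \<omega>1 \<omega>2 wp \<zeta> \<sigma>)
    show ?case unfolding shift[OF 3(1)]
      using euler_weierstrass.ex_tau0[OF weierstrass[OF 3]] unfolding params(6)[OF 3(1)] .
  next
    case (4 a b c e1 e2 e3 \<omega>1 \<omega>2 wp \<zeta> \<sigma> \<tau>0 x \<mu>1 \<mu>2 \<mu>3)
    note sol = 4(1)
    note W = weierstrass[OF 4(1,2)]
    have Y: "of_real (euler_orbit.Y p q r a b c t) = wp (of_real (euler_orbit.\<kappa> p q * t - \<tau>0) + \<omega>2)" for t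
      using 4(3) unfolding shift[OF sol] params(6)[OF sol] by blast
    have x: "x = - of_real \<tau>0 + \<omega>2" using 4(3) by blast
    have \<mu>: "\<not> is_pole wp \<mu>1" "deriv wp \<mu>1 \<noteq> 0" "wp \<mu>1 = of_real (2/3 * euler_orbit.i2 p r a c - 1/3 * euler_orbit.i3 q r b c)"
      "\<not> is_pole wp \<mu>2" "deriv wp \<mu>2 \<noteq> 0" "wp \<mu>2 = of_real (- 1/3 * euler_orbit.i2 p r a c + 2/3 * euler_orbit.i3 q r b c)"
      "\<not> is_pole wp \<mu>3" "deriv wp \<mu>3 \<noteq> 0" "wp \<mu>3 = of_real (- 1/3 * euler_orbit.i2 p r a c - 1/3 * euler_orbit.i3 q r b c)"
      unfolding params[OF sol] using 4(3) by blast+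
    note s = euler_weierstrass.solution_a[OF W Y x \<mu>(1-3)] euler_weierstrass.solution_b[OF W Y x \<mu>(4-6)]
      euler_weierstrass.solution_c[OF W Y x \<mu>(7-9)]
    show ?case
      unfolding Let_def using s unfolding params(6)[OF sol] orbit(2-4)[OF sol] unfolding p_def q_def r_def by blast
  next
    case (5 a b c)
    show ?case
      using euler_geodesic_lift[OF \<alpha> 5] unfolding Let_def by blast
  qed
qed

end
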